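(* Let $H_0:=P_{10}$ and, for $n\ge 1$, $H_n:=H(H_{n-1},P_{10},P_{10},P_{10})$, where $P_{10}$ is the Petersen graph and $H(\cdot,\cdot,\cdot,\cdot)$ is the construction described in the context. Then $\mathcal H:=\bigcup_{n=0}^\infty\{H_n\}$ is an infinite set of cyclically $5$-edge connected permutation snarks, and $H_n\in\mathcal H$ has $10+24n$ vertices.
   Context: Basic notions. A circuit is a $2$-regular $2$-connected graph. A CDC of a graph $G$ is a set $S$ of subgraphs of $G$, every component of each of which is a circuit, such that every edge of $G$ lies in exactly two elements of $S$; a $2$-factor is contained in a CDC consisting of circuits if each of its circuits is an element of it. A cycle permutation graph is a cubic graph with a $2$-factor consisting of two chordless circuits (a permutation $2$-factor). A snark is a cyclically $4$-edge connected cubic graph of girth at least $5$ that is not $3$-edge colorable; a permutation snark is a cycle permutation graph that is a snark. $\lambda_c(G)$ is the minimum number of edges whose deletion yields two components each containing a circuit; cyclically $k$-edge connected means $\lambda_c\ge k$. The graphs $Q^i$ and $\widetilde Q^i$. For $i\in\{1,2,3,4\}$ let $Q^i$ be a cyclically $5$-edge connected permutation snark with a permutation $2$-factor $F^i$, with circuits $C^i_1,C^i_2$, such that $F^i$ is not contained in any CDC of $Q^i$. Label vertices so that $C^i_1$ contains a subpath with consecutive vertices $x^i_1,x^i_2,z^i_2,x^i_6$, and $C^i_2$ contains a subpath with consecutive vertices $x^i_4,z^i_1,x^i_5$, where $z^i_1z^i_2\in E(Q^i)$. Let $\widetilde Q^i$ be obtained from $Q^i$ by removing the edge $x^i_1x^i_2$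 and the vertices $z^i_1,z^i_2$, and adding new vertices $y^i_1,\dots,y^i_6$ and edges $e^i_3:=x^i_2y^i_3$ and $e^i_s:=x^i_sy^i_s$ for $s=1,2,4,5,6$. The graph $H(Q^1,Q^2,Q^3,Q^4)$. In $\widetilde Q^1,\dots,\widetilde Q^4$ regard each $e^i_j$ as a half-edge (delete $y^i_j$), except $e^1_2,e^2_3,e^3_2,e^4_3$, which keep their degree-$1$ endvertices. $H$ is obtained from the disjoint union by gluing half-edges pairwise into single edges (gluing half-edges at $u$ and $v$ gives the edge $uv$): $e^1_1$ with $e^4_4$, $e^1_3$ with $e^4_5$; $e^4_1$ with $e^3_4$, $e^4_2$ with $e^3_5$; $e^3_1$ with $e^2_4$, $e^3_3$ with $e^2_5$; $e^2_1$ with $e^1_4$, $e^2_2$ with $e^1_5$; $e^1_6$ with $e^3_6$; $e^2_6$ with $e^4_6$; by identifying the degree-$1$ endvertices of $e^1_2$ and $e^3_2$ to one vertex $p$ and those of $e^2_3$ and $e^4_3$ to one vertex $q$; and by adding the edge $\alpha=pq$. The edges of $H$ coming from the edges $e^i_j$ and from the remaining edges of the $F^i$ (those of $F^i$ not deleted in passing to $\widetilde Q^i$) form a permutation $2$-factor $F$ of $H$. In the recursive definition of $H_n$, the graph $H_{n-1}$ plays the role of $Q^1$ and three copies of $P_{10}$ play the roles of $Q^2,Q^3,Q^4$; the permutation $2$-factor used for $P_{10}$ is one consisting of two chordless $5$-circuits, the one used for $H_{n-1}$ ($n\ge2$) is the $2$-factor $F$ given by its construction, and the subpaths $x_1,x_2,z_2,x_6$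 and $x_4,z_1,x_5$ as required above are assumed to be chosen in these $2$-factors (any choice). *)

theory Defs
  imports Main "HOL-Library.Extended_Nat"
begin

section \<open>Simple graphs\<close>

record 'a ugraph =
  verts :: "'a set"
  edges :: "'a set set"

definition simple_graph :: "'a ugraph \<Rightarrow> bool" where
  "simple_graph G \<longleftrightarrow> finite (verts G) \<and> (\<forall>e\<in>edges G. e \<subseteq> verts G \<and> card e = 2)"

definition subgraph :: "'a ugraph \<Rightarrow> 'a ugraph \<Rightarrow> bool" where
  "subgraph H G \<longleftrightarrow> simple_graph H \<and> verts H \<subseteq> verts G \<and> edges H \<subseteq> edges G"

definition degree :: "'a ugraph \<Rightarrow> 'a \<Rightarrow> nat" where
  "degree G v = card {e \<in> edges G. v \<in> e}"

definition regular :: "nat \<Rightarrow> 'a ugraph \<Rightarrow> bool" where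
  "regular k G \<longleftrightarrow> (\<forall>v\<in>verts G. degree G v = k)"

definition delete_vertices :: "'a ugraph \<Rightarrow> 'a set \<Rightarrow> 'a ugraph" where
  "delete_vertices G X =
     \<lparr>verts = verts G - X, edges = {e \<in> edges G. e \<inter> X = {}}\<rparr>"

definition delete_edges :: "'a ugraph \<Rightarrow> 'a set set \<Rightarrow> 'a ugraph" where
  "delete_edges G X = \<lparr>verts = verts G, edges = edges G - X\<rparr>"

definition connected_graph :: "'a ugraph \<Rightarrow> bool" where
  "connected_graph G \<longleftrightarrow> verts G \<noteq> {} \<and>
     (\<forall>u\<in>verts G. \<forall>v\<in>verts G. (u, v) \<in> {(a, b). {a, b} \<in> edges G}\<^sup>*)"

definition is_component :: "'a ugraph \<Rightarrow> 'a ugraph \<Rightarrow> bool" where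
  "is_component C G \<longleftrightarrow> subgraph C G \<and> connected_graph C \<and>
     (\<forall>D. subgraph D G \<and> connected_graph D \<and> subgraph C D \<longrightarrow> D = C)"

definition two_connected :: "'a ugraph \<Rightarrow> bool" where
  "two_connected G \<longleftrightarrow> card (verts G) \<ge> 3 \<and> connected_graph G \<and>
     (\<forall>v\<in>verts G. connected_graph (delete_vertices G {v}))"

definition circuit :: "'a ugraph \<Rightarrow> bool" where
  "circuit C \<longleftrightarrow> simple_graph C \<and> regular 2 C \<and> two_connected C"

definition graph_iso :: "('a ugraph \<times> 'a ugraph) set" where
  "graph_iso = {(G, H). \<exists>f. bij_betw f (verts G) (verts H) \<and>
     (\<forall>u\<in>verts G. \<forall>v\<in>verts G. {u, v} \<in> edges G \<longleftrightarrow> {f u, f v} \<in> edges H)}"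


section \<open>Snarks and permutation 2-factors\<close>

definition cubic :: "'a ugraph \<Rightarrow> bool" where
  "cubic G \<longleftrightarrow> simple_graph G \<and> regular 3 G"

definition edge_colorable :: "nat \<Rightarrow> 'a ugraph \<Rightarrow> bool" where
  "edge_colorable k G \<longleftrightarrow> (\<exists>c :: 'a set \<Rightarrow> nat. (\<forall>e\<in>edges G. c e < k) \<and>
     (\<forall>e\<in>edges G. \<forall>f\<in>edges G. e \<noteq> f \<and> e \<inter> f \<noteq> {} \<longrightarrow> c e \<noteq> c f))"

text \<open>Girth and cyclic edge connectivity are \<open>\<infinity>\<close> if there is no circuit or no cyclic
  edge cut, respectively.\<close>

definition girth :: "'a ugraph \<Rightarrow> enat" where
  "girth G = (INF C \<in> {C. subgraph C G \<and> circuit C}. enat (card (verts C)))"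

definition cyclic_edge_cut :: "'a ugraph \<Rightarrow> 'a set set \<Rightarrow> bool" where
  "cyclic_edge_cut G X \<longleftrightarrow> X \<subseteq> edges G \<and>
     (\<exists>A B. A \<noteq> B \<and> is_component A (delete_edges G X) \<and> is_component B (delete_edges G X) \<and>
        (\<exists>C. subgraph C A \<and> circuit C) \<and> (\<exists>D. subgraph D B \<and> circuit D))"

definition cyclic_edge_connectivity :: "'a ugraph \<Rightarrow> enat" where
  "cyclic_edge_connectivity G = (INF X \<in> {X. cyclic_edge_cut G X}. enat (card X))"

definition cyclically_edge_connected :: "nat \<Rightarrow> 'a ugraph \<Rightarrow> bool" where
  "cyclically_edge_connected k G \<longleftrightarrow> enat k \<le> cyclic_edge_connectivity G"

definition snark :: "'a ugraph \<Rightarrow> bool" where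
  "snark G \<longleftrightarrow> cubic G \<and> cyclically_edge_connected 4 G \<and> 5 \<le> girth G \<and> \<not> edge_colorable 3 G"

definition two_factor :: "'a ugraph \<Rightarrow> 'a ugraph \<Rightarrow> bool" where
  "two_factor G F \<longleftrightarrow> subgraph F G \<and> verts F = verts G \<and> regular 2 F"

definition chordless :: "'a ugraph \<Rightarrow> 'a ugraph \<Rightarrow> bool" where
  "chordless G C \<longleftrightarrow> (\<forall>e\<in>edges G. e \<subseteq> verts C \<longrightarrow> e \<in> edges C)"

definition permutation_two_factor :: "'a ugraph \<Rightarrow> 'a ugraph \<Rightarrow> bool" where
  "permutation_two_factor G F \<longleftrightarrow> two_factor G F \<and> card {C. is_component C F} = 2 \<and>
     (\<forall>C. is_component C F \<longrightarrow> circuit C \<and> chordless G C)"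

definition cycle_permutation_graph :: "'a ugraph \<Rightarrow> bool" where
  "cycle_permutation_graph G \<longleftrightarrow> cubic G \<and> (\<exists>F. permutation_two_factor G F)"

definition permutation_snark :: "'a ugraph \<Rightarrow> bool" where
  "permutation_snark G \<longleftrightarrow> cycle_permutation_graph G \<and> snark G"


section \<open>Circuit double covers\<close>

definition cdc :: "'a ugraph \<Rightarrow> 'a ugraph set \<Rightarrow> bool" where
  "cdc G S \<longleftrightarrow> (\<forall>H\<in>S. subgraph H G \<and> (\<forall>C. is_component C H \<longrightarrow> circuit C)) \<and>
     (\<forall>e\<in>edges G. card {H \<in> S. e \<in> edges H} = 2)"

definition contained_in_some_cdc :: "'a ugraph \<Rightarrow> 'a ugraph \<Rightarrow> bool" where
  "contained_in_some_cdc G F \<longleftrightarrow>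
     (\<exists>S. cdc G S \<and> (\<forall>C\<in>S. circuit C) \<and> (\<forall>C. is_component C F \<longrightarrow> C \<in> S))"


section \<open>The construction of H\<close>

text \<open>The requirements on a pair \<open>(Q\<^sup>i, F\<^sup>i)\<close>.\<close>

definition admissible :: "'a ugraph \<Rightarrow> 'a ugraph \<Rightarrow> bool" where
  "admissible Q F \<longleftrightarrow> cyclically_edge_connected 5 Q \<and> permutation_snark Q \<and>
     permutation_two_factor Q F \<and> \<not> contained_in_some_cdc Q F"

text \<open>Only \<open>x 1, x 2, x 4, x 5, x 6\<close> and \<open>z 1, z 2\<close> are meaningful. Either circuit of \<open>F\<close> may
  play the role of \<open>C\<^sub>1\<close>.\<close>

definition labelling :: "'a ugraph \<Rightarrow> 'a ugraph \<Rightarrow> (nat \<Rightarrow> 'a) \<Rightarrow> (nat \<Rightarrow> 'a) \<Rightarrow> bool" where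
  "labelling Q F x z \<longleftrightarrow>
     (\<exists>C1 C2. C1 \<noteq> C2 \<and> is_component C1 F \<and> is_component C2 F \<and>
        distinct [x 1, x 2, z 2, x 6] \<and>
        {x 1, x 2} \<in> edges C1 \<and> {x 2, z 2} \<in> edges C1 \<and> {z 2, x 6} \<in> edges C1 \<and>
        distinct [x 4, z 1, x 5] \<and>
        {x 4, z 1} \<in> edges C2 \<and> {z 1, x 5} \<in> edges C2 \<and>
        {z 1, z 2} \<in> edges Q)"

text \<open>Vertices of the graphs \<open>H\<^sub>n\<close>: \<open>Base\<close> gives the vertices of the Petersen graph, \<open>Part i v\<close> is
  the copy of \<open>v\<close> coming from \<open>Q\<^sup>i\<close>, and \<open>Pv\<close>, \<open>Qv\<close> are the vertices \<open>p\<close>, \<open>q\<close>.\<close>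

datatype vertex = Base nat | Part nat vertex | Pv | Qv

text \<open>The graph \<open>Q\<close> without \<open>z\<^sub>1\<close>, \<open>z\<^sub>2\<close> and the edge \<open>x\<^sub>1x\<^sub>2\<close>, i.e. \<open>Q\<close> tilde without the
  edges \<open>e\<^sub>1, \<dots>, e\<^sub>6\<close> and their endvertices \<open>y\<^sub>1, \<dots>, y\<^sub>6\<close>.\<close>

definition core :: "'a ugraph \<Rightarrow> (nat \<Rightarrow> 'a) \<Rightarrow> (nat \<Rightarrow> 'a) \<Rightarrow> 'a ugraph" where
  "core Q x z = delete_edges (delete_vertices Q {z 1, z 2}) {{x 1, x 2}}"

text \<open>The endvertex of the half-edge \<open>e\<^sup>i\<^sub>j\<close> in the \<open>i\<close>-th part; both \<open>e\<^sub>2\<close> and \<open>e\<^sub>3\<close> are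
  attached to \<open>x\<^sub>2\<close>.\<close>

definition foot :: "(nat \<Rightarrow> nat \<Rightarrow> vertex) \<Rightarrow> nat \<times> nat \<Rightarrow> vertex" where
  "foot x = (\<lambda>(i, j). Part i (if j = 3 then x i 2 else x i j))"

definition glued :: "((nat \<times> nat) \<times> (nat \<times> nat)) set" where
  "glued = {((1,1), (4,4)), ((1,3), (4,5)),
            ((4,1), (3,4)), ((4,2), (3,5)),
            ((3,1), (2,4)), ((3,3), (2,5)),
            ((2,1), (1,4)), ((2,2), (1,5)),
            ((1,6), (3,6)), ((2,6), (4,6))}"

text \<open>All edges of \<open>H\<close> that come from the edges \<open>e\<^sup>i\<^sub>j\<close>.\<close>

definition link_edges :: "(nat \<Rightarrow> nat \<Rightarrow> vertex) \<Rightarrow> vertex set set" where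
  "link_edges x = (\<lambda>(h, k). {foot x h, foot x k}) ` glued \<union>
     {{foot x (1,2), Pv}, {foot x (3,2), Pv}, {foot x (2,3), Qv}, {foot x (4,3), Qv}}"

definition assemble ::
  "(nat \<Rightarrow> vertex ugraph) \<Rightarrow> (nat \<Rightarrow> nat \<Rightarrow> vertex) \<Rightarrow> (nat \<Rightarrow> nat \<Rightarrow> vertex) \<Rightarrow> vertex ugraph" where
  "assemble Q x z =
     \<lparr>verts = (\<Union>i\<in>{1..4}. Part i ` verts (core (Q i) (x i) (z i))) \<union> {Pv, Qv},
      edges = (\<Union>i\<in>{1..4}. (\<lambda>e. Part i ` e) ` edges (core (Q i) (x i) (z i))) \<union> link_edges x\<rparr>"

definition H_graph ::
  "(nat \<Rightarrow> vertex ugraph) \<Rightarrow> (nat \<Rightarrow> nat \<Rightarrow> vertex) \<Rightarrow> (nat \<Rightarrow> nat \<Rightarrow> vertex) \<Rightarrow> vertex ugraph" where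
  "H_graph Q x z =
     \<lparr>verts = verts (assemble Q x z), edges = insert {Pv, Qv} (edges (assemble Q x z))\<rparr>"

text \<open>The 2-factor of \<open>H\<close>: the edges coming from the \<open>e\<^sup>i\<^sub>j\<close> and the remaining edges of
  the \<open>F\<^sup>i\<close>.\<close>

definition H_factor ::
  "(nat \<Rightarrow> vertex ugraph) \<Rightarrow> (nat \<Rightarrow> nat \<Rightarrow> vertex) \<Rightarrow> (nat \<Rightarrow> nat \<Rightarrow> vertex) \<Rightarrow> vertex ugraph" where
  "H_factor F x z = assemble F x z"


section \<open>The graphs \<open>H\<^sub>n\<close>\<close>

definition petersen :: "vertex ugraph" where
  "petersen =
     \<lparr>verts = Base ` {0..<10},
      edges = (\<Union>i\<in>{0..<5}. {{Base i, Base ((i + 1) mod 5)},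
                              {Base i, Base (i + 5)},
                              {Base (i + 5), Base ((i + 2) mod 5 + 5)}})\<rparr>"

text \<open>\<open>H_stage n G F\<close>: for some choice of 2-factors of the Petersen graph and of labellings, the
  \<open>n\<close>-th graph is \<open>G\<close> and its 2-factor is \<open>F\<close>. Circuits of length 5 need not be demanded for the
  2-factors of the Petersen graph: its permutation 2-factors have no others.\<close>

inductive H_stage :: "nat \<Rightarrow> vertex ugraph \<Rightarrow> vertex ugraph \<Rightarrow> bool" where
  zero: "permutation_two_factor petersen F \<Longrightarrow> H_stage 0 petersen F"
| step: "\<lbrakk>H_stage n (Q 1) (F 1);
          \<forall>i\<in>{2..4}. Q i = petersen;
          \<forall>i\<in>{1..4}. admissible (Q i) (F i) \<and> labelling (Q i) (F i) (x i) (z i)\<rbrakk>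
         \<Longrightarrow> H_stage (Suc n) (H_graph Q x z) (H_factor F x z)"

end

(* All the required properties follow from an invariant that the construction preserves. First, the
   edge cut of a vertex set A has at least as many edges as that of a tree with the size of A or of
   its complement, up to a maximum of 5; this gives cyclic 5-edge connectivity and girth 5. Second,
   the 2-factor F has no "pair colouring", i.e. its edges cannot be coloured such that the two edges
   of F at either end of an edge outside F have the same two distinct colours; 3-edge colourings and
   circuit double covers containing F would both give one.

   The Petersen graph is checked directly. For H, the cut condition of the four parts bounds the cuts
   of their cores in terms of the positions of the x_j, and a finite search over these positions shows
   that no cut of H is too small. In a pair colouring of H, each colour occurs on an even number of
   the edges e_1, ..., e_6 leaving a part, and the colouring does not extend to Q^i; this leaves two
   types of colourings of these six edges, which cannot be combined around H.

   Connectivity is always used in the form that a nonempty set left by no edge is the whole graph. *)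
theory Submission
  imports Defs
begin

section \<open>Edge cuts and connectivity\<close>

text \<open>Nothing may be used about a part except the invariant: its labels are chosen arbitrarily
  and \<open>Q 1\<close> is any earlier stage, so only the Petersen graph is ever inspected edge by
  edge. The bound has to distinguish the sizes 0, 1 and 2 because a vertex set of \<open>H\<close>
  can meet one core in one or two vertices and contain most of another. In a cubic graph, a set of n
  > 0 vertices inducing a forest is left by at least n + 2 edges; this is the origin of
  \<open>tree_cut\<close>. A circuit double cover supplies one colour per circuit, so the number of
  colours is unbounded and the colourings of a part cannot be enumerated; parity takes the place of
  enumeration. The two types of colourings differ in whether \<open>e\<^sub>4\<close> and
  \<open>e\<^sub>5\<close> have equal colours. These two edges of each part are glued to
  \<open>e\<^sub>1\<close> and one of \<open>e\<^sub>2\<close>, \<open>e\<^sub>3\<close> of another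
  part, so equality is passed on around the cycle of four parts and all parts have the same type.
  For either type the colours of the factor edges at \<open>p\<close> and \<open>q\<close> violate
  the condition at the edge \<open>pq\<close>.\<close>

definition crosses :: "'a set \<Rightarrow> 'a set \<Rightarrow> bool" where
  "crosses A e \<longleftrightarrow> e \<inter> A \<noteq> {} \<and> \<not> e \<subseteq> A"

definition cut :: "'a set set \<Rightarrow> 'a set \<Rightarrow> nat" where
  "cut E A = card {e \<in> E. crosses A e}"

lemma crosses_pair [simp]: "crosses A {u, v} \<longleftrightarrow> (u \<in> A) \<noteq> (v \<in> A)"
  by (auto simp: crosses_def)

lemma cut_sum: "finite E \<Longrightarrow> cut E A = (\<Sum>e\<in>E. of_bool (crosses A e))"
  by (simp add: cut_def sum_of_bool_eq Int_def)

lemma simple_graph_finite_edges: "simple_graph G \<Longrightarrow> finite (edges G)"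
  unfolding simple_graph_def by (meson Pow_iff finite_Pow_iff finite_subset subsetI)

lemma simple_graph_edgeE:
  assumes "simple_graph G" "e \<in> edges G"
  obtains u v where "e = {u, v}" "u \<noteq> v" "u \<in> verts G" "v \<in> verts G"
proof -
  have "e \<subseteq> verts G" "card e = 2" using assms by (auto simp: simple_graph_def)
  moreover obtain u v where "e = {u, v}" "u \<noteq> v" using calculation by (meson card_2_iff)
  ultimately show ?thesis using that by simp
qed

lemma simple_graph_pairD:
  assumes "simple_graph G" "{u, v} \<in> edges G"
  shows "u \<noteq> v" "u \<in> verts G" "v \<in> verts G"
  using assms unfolding simple_graph_def by fastforce+

text \<open>Double counting: an edge is counted once for each of its ends in \<open>A\<close>, hence
  once if it crosses \<open>A\<close> and twice if it lies inside. It speaks of a bare edge set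
  because it is also applied to the edges of a single colour.\<close>

lemma sum_incidences:
  assumes "finite E" "\<forall>e\<in>E. card e = 2" "finite A"
  shows "(\<Sum>v\<in>A. card {e \<in> E. v \<in> e}) = cut E A + 2 * card {e \<in> E. e \<subseteq> A}"
proof -
  have *: "card (e \<inter> A) = of_bool (crosses A e) + 2 * of_bool (e \<subseteq> A)" if "e \<in> E" for e
  proof -
    obtain u v where e: "e = {u, v}" "u \<noteq> v" using assms(2) \<open>e \<in> E\<close> by (auto simp: card_2_iff)
    then show ?thesis by (cases "u \<in> A"; cases "v \<in> A") auto
  qed
  have "(\<Sum>v\<in>A. card {e \<in> E. v \<in> e}) = (\<Sum>v\<in>A. \<Sum>e\<in>E. of_bool (v \<in> e))"
    using assms(1) by (simp add: sum_of_bool_eq Int_def)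
  also have "\<dots> = (\<Sum>e\<in>E. \<Sum>v\<in>A. of_bool (v \<in> e))" by (rule sum.swap)
  also have "\<dots> = (\<Sum>e\<in>E. card (e \<inter> A))"
    using assms(3) by (simp add: sum_of_bool_eq Int_commute)
  also have "\<dots> = (\<Sum>e\<in>E. of_bool (crosses A e) + 2 * of_bool (e \<subseteq> A))"
    using * by simp
  also have "\<dots> = cut E A + 2 * card {e \<in> E. e \<subseteq> A}"
    using assms(1) by (simp add: sum.distrib cut_sum sum_of_bool_eq Int_def flip: sum_distrib_left)
  finally show ?thesis .
qed

lemma connected_graph_iff:
  assumes "simple_graph G"
  shows "connected_graph G \<longleftrightarrow> verts G \<noteq> {} \<and>
    (\<forall>A \<subseteq> verts G. A \<noteq> {} \<longrightarrow> (\<forall>e\<in>edges G. \<not> crosses A e) \<longrightarrow> A = verts G)"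
proof
  let ?R = "{(a, b). {a, b} \<in> edges G}"
  assume c: "connected_graph G"
  have "A = verts G" if A: "A \<subseteq> verts G" "A \<noteq> {}" "\<forall>e\<in>edges G. \<not> crosses A e" for A
  proof -
    obtain u where u: "u \<in> A" using A by auto
    have "v \<in> A" if "(u, v) \<in> ?R\<^sup>*" for v
      using that by induction (use u A(3) in fastforce)+
    then show ?thesis using c u A(1) unfolding connected_graph_def by blast
  qed
  then show "verts G \<noteq> {} \<and>
    (\<forall>A \<subseteq> verts G. A \<noteq> {} \<longrightarrow> (\<forall>e\<in>edges G. \<not> crosses A e) \<longrightarrow> A = verts G)"
    using c unfolding connected_graph_def by blast
next
  let ?R = "{(a, b). {a, b} \<in> edges G}"
  assume c: "verts G \<noteq> {} \<and>
    (\<forall>A \<subseteq> verts G. A \<noteq> {} \<longrightarrow> (\<forall>e\<in>edges G. \<not> crosses A e) \<longrightarrow> A = verts G)"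
  have "(u, v) \<in> ?R\<^sup>*" if "u \<in> verts G" "v \<in> verts G" for u v
  proof -
    let ?A = "{w \<in> verts G. (u, w) \<in> ?R\<^sup>*}"
    have "\<not> crosses ?A e" if e: "e \<in> edges G" for e
    proof -
      obtain a b where ab: "e = {a, b}" "a \<in> verts G" "b \<in> verts G"
        using e assms by (meson simple_graph_edgeE)
      then have "(a, b) \<in> ?R" "(b, a) \<in> ?R" using e by (auto simp: insert_commute)
      then have "(u, a) \<in> ?R\<^sup>* \<longleftrightarrow> (u, b) \<in> ?R\<^sup>*" by (meson rtrancl.rtrancl_into_rtrancl)
      then show ?thesis using ab by simp
    qed
    then have "?A = verts G" using c \<open>u \<in> verts G\<close>
      by (metis (no_types, lifting) empty_iff mem_Collect_eq rtrancl.rtrancl_refl subsetI)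
    then show ?thesis using \<open>v \<in> verts G\<close> by blast
  qed
  then show "connected_graph G" using c unfolding connected_graph_def by blast
qed

section \<open>Components as connected induced subgraphs that no edge leaves\<close>

definition induced :: "'a ugraph \<Rightarrow> 'a set \<Rightarrow> 'a ugraph" where
  "induced G K = \<lparr>verts = K, edges = {e \<in> edges G. e \<subseteq> K}\<rparr>"

lemma induced_sel [simp]:
  "verts (induced G K) = K" "edges (induced G K) = {e \<in> edges G. e \<subseteq> K}"
  by (simp_all add: induced_def)

lemma simple_graph_induced: "simple_graph G \<Longrightarrow> K \<subseteq> verts G \<Longrightarrow> simple_graph (induced G K)"
  by (auto simp: simple_graph_def intro: finite_subset)

text \<open>Maximality is tested on only two extensions of \<open>C\<close>: the subgraph induced on
  its own vertex set, which makes \<open>C\<close> induced, and the one with a single further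
  vertex, which shows that no edge leaves \<open>C\<close>.\<close>

lemma is_component_iff:
  assumes G: "simple_graph G"
  shows "is_component C G \<longleftrightarrow> verts C \<subseteq> verts G \<and> C = induced G (verts C) \<and>
    connected_graph C \<and> (\<forall>e\<in>edges G. \<not> crosses (verts C) e)"
proof
  assume C: "is_component C G"
  then have sub: "subgraph C G" and con: "connected_graph C"
    and mx: "\<And>D. subgraph D G \<Longrightarrow> connected_graph D \<Longrightarrow> subgraph C D \<Longrightarrow> D = C"
    by (auto simp: is_component_def)
  have sC: "simple_graph C" and vC: "verts C \<subseteq> verts G" and eC: "edges C \<subseteq> edges G"
    using sub by (auto simp: subgraph_def)
  have eK: "e \<subseteq> verts C" if "e \<in> edges C" for e using sC that by (auto simp: simple_graph_def)
  \<comment> \<open>Connectivity of the extension: a set \<open>A\<close> that no edge inside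
    \<open>K\<close> leaves either misses \<open>C\<close> or contains it. So unless
    \<open>A = K\<close>, one of \<open>A\<close> and \<open>K - A\<close> is a nonempty set of new
    vertices, and the third premise provides an edge leaving it.\<close>
  have ext: "induced G K = C"
    if K: "verts C \<subseteq> K" "K \<subseteq> verts G" "\<And>B. B \<subseteq> K \<Longrightarrow> verts C \<inter> B = {} \<Longrightarrow> B \<noteq> {} \<Longrightarrow>
      \<exists>e\<in>edges G. e \<subseteq> K \<and> crosses B e" for K
  proof (rule mx)
    have sK: "simple_graph (induced G K)" using G K(2) by (rule simple_graph_induced)
    show "subgraph (induced G K) G" using sK K by (auto simp: subgraph_def)
    show "subgraph C (induced G K)" using sC K eC eK by (fastforce simp: subgraph_def)
    have "A = K" if A: "A \<subseteq> K" "A \<noteq> {}" "\<forall>e\<in>edges G. e \<subseteq> K \<longrightarrow> \<not> crosses A e" for A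
    proof (rule ccontr)
      assume "A \<noteq> K"
      have cl: "\<forall>e\<in>edges C. \<not> crosses (A \<inter> verts C) e"
        using A eC eK K(1) by (fastforce simp: crosses_def)
      show False
      proof (cases "A \<inter> verts C = {}")
        case True
        then show False using K(3)[of A] A by (metis inf_commute)
      next
        case False
        then have "A \<inter> verts C = verts C"
          using con cl unfolding connected_graph_iff[OF sC] by (metis inf_le2)
        then have "verts C \<inter> (K - A) = {}" "K - A \<noteq> {}" using \<open>A \<noteq> K\<close> A by auto
        then obtain e where "e \<in> edges G" "e \<subseteq> K" "crosses (K - A) e" using K(3)[of "K - A"] by blast
        then show False using A by (auto simp: crosses_def)
      qed
    qed
    then show "connected_graph (induced G K)"
      using con K(1) unfolding connected_graph_iff[OF sK] connected_graph_iff[OF sC] by auto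
  qed
  have "induced G (verts C) = C" using vC by (intro ext) auto
  then have 1: "C = induced G (verts C)" by (rule sym)
  have "\<not> crosses (verts C) e" if e: "e \<in> edges G" for e
  proof
    assume cr: "crosses (verts C) e"
    obtain a b where ab: "e = {a, b}" "a \<in> verts G" "b \<in> verts G" "a \<in> verts C" "b \<notin> verts C"
      using simple_graph_edgeE[OF G e] cr by (metis crosses_pair insert_commute)
    have "induced G (insert b (verts C)) = C"
    proof (rule ext)
      fix B assume B: "B \<subseteq> insert b (verts C)" "verts C \<inter> B = {}" "B \<noteq> {}"
      then have "B = {b}" by auto
      then show "\<exists>e\<in>edges G. e \<subseteq> insert b (verts C) \<and> crosses B e"
        using ab e by (intro bexI[of _ e]) auto
    qed (use ab vC in auto)
    then show False using ab(5) by (metis induced_sel(1) insertI1)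
  qed
  then show "verts C \<subseteq> verts G \<and> C = induced G (verts C) \<and>
    connected_graph C \<and> (\<forall>e\<in>edges G. \<not> crosses (verts C) e)" using 1 con vC by auto
next
  assume C: "verts C \<subseteq> verts G \<and> C = induced G (verts C) \<and>
    connected_graph C \<and> (\<forall>e\<in>edges G. \<not> crosses (verts C) e)"
  then have sC: "simple_graph C" using simple_graph_induced[OF G] by metis
  have eC: "edges C = {e \<in> edges G. e \<subseteq> verts C}" using C by (metis induced_sel(2))
  have "D = C" if D: "subgraph D G" "connected_graph D" "subgraph C D" for D
  proof -
    have sD: "simple_graph D" using D by (simp add: subgraph_def)
    have "verts C = verts D"
      using D(2) connected_graph_iff[OF sD] C connected_graph_iff[OF sC] D(1,3)
      unfolding subgraph_def by (metis subsetD)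
    moreover have "edges D = edges C"
      using D(1,3) sD eC calculation unfolding subgraph_def simple_graph_def by auto
    ultimately show ?thesis by simp
  qed
  then show "is_component C G" using C sC eC unfolding is_component_def subgraph_def by auto
qed

text \<open>The component of \<open>v\<close> is a minimal set containing \<open>v\<close> that no
  edge leaves: if it were disconnected, the piece containing \<open>v\<close> would be a smaller
  such set.\<close>

lemma component_of_vertex:
  assumes G: "simple_graph G" and v: "v \<in> verts G"
  obtains C where "is_component C G" "v \<in> verts C"
proof -
  define S where "S = {A. A \<subseteq> verts G \<and> v \<in> A \<and> (\<forall>e\<in>edges G. \<not> crosses A e)}"
  have fin: "finite S" unfolding S_def using G unfolding simple_graph_def
    by (metis (no_types, lifting) finite_Pow_iff finite_subset mem_Collect_eq PowI subsetI)
  have "\<forall>e\<in>edges G. \<not> crosses (verts G) e"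
    using G unfolding simple_graph_def crosses_def by blast
  then have "verts G \<in> S" using v by (auto simp: S_def)
  then obtain K where K': "K \<in> S" and mn': "\<forall>A\<in>S. A \<subseteq> K \<longrightarrow> K = A"
    using finite_has_minimal2[OF fin] by blast
  then have K: "K \<subseteq> verts G \<and> v \<in> K \<and> (\<forall>e\<in>edges G. \<not> crosses K e)" by (simp add: S_def)
  have mn: "A = K" if "v \<in> A" "A \<subseteq> K" "\<forall>e\<in>edges G. \<not> crosses A e" for A
    using mn' that K by (auto simp: S_def)
  have sK: "simple_graph (induced G K)" using G K by (intro simple_graph_induced) auto
  have "A = K" if A: "A \<subseteq> K" "A \<noteq> {}" "\<forall>e\<in>edges G. e \<subseteq> K \<longrightarrow> \<not> crosses A e" for A
  proof -
    have cl: "\<not> crosses A e" "\<not> crosses (K - A) e" if "e \<in> edges G" for e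
      using that A K by (fastforce simp: crosses_def)+
    show ?thesis
    proof (cases "v \<in> A")
      case True
      then show ?thesis using mn[of A] A K cl by auto
    next
      case False
      then have "K - A = K" using mn[of "K - A"] A K cl by auto
      then show ?thesis using A by auto
    qed
  qed
  then have "connected_graph (induced G K)"
    using K unfolding connected_graph_iff[OF sK] by auto
  then have "is_component (induced G K) G"
    using K unfolding is_component_iff[OF G] by auto
  then show ?thesis using K that[of "induced G K"] by auto
qed

section \<open>Degree counts, and circuits as connected 2-regular graphs\<close>

lemma degree_sum:
  assumes "finite (edges G)"
  shows "degree G v = (\<Sum>e\<in>edges G. of_bool (v \<in> e))"
  using assms by (simp add: degree_def sum_of_bool_eq Int_def)

lemma degree_induced:
  assumes "\<forall>e\<in>edges G. \<not> crosses K e" "v \<in> K"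
  shows "degree (induced G K) v = degree G v"
proof -
  have "{e \<in> edges (induced G K). v \<in> e} = {e \<in> edges G. v \<in> e}"
    using assms by (auto simp: crosses_def)
  then show ?thesis by (simp add: degree_def)
qed

lemma sum_degrees:
  assumes "simple_graph G" "A \<subseteq> verts G"
  shows "(\<Sum>v\<in>A. degree G v) = cut (edges G) A + 2 * card {e \<in> edges G. e \<subseteq> A}"
  unfolding degree_def using assms simple_graph_finite_edges[OF assms(1)]
  by (intro sum_incidences) (auto simp: simple_graph_def intro: finite_subset)

lemma regular_2_edges:
  assumes "simple_graph G" "regular 2 G"
  shows "card (edges G) = card (verts G)"
proof -
  have "{e \<in> edges G. e \<subseteq> verts G} = edges G" "cut (edges G) (verts G) = 0"
    using assms(1) by (auto simp: simple_graph_def cut_def crosses_def card_eq_0_iff)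
  then show ?thesis
    using sum_degrees[OF assms(1) subset_refl] assms(2) by (simp add: regular_def)
qed

lemma regular_2_neighbours:
  assumes G: "simple_graph G" "regular 2 G" and v: "v \<in> verts G"
  obtains a b where "a \<noteq> b" "a \<noteq> v" "b \<noteq> v" "a \<in> verts G" "b \<in> verts G"
    "{e \<in> edges G. v \<in> e} = {{v, a}, {v, b}}"
proof -
  have "card {e \<in> edges G. v \<in> e} = 2" using assms by (auto simp: regular_def degree_def)
  then obtain e f where ef: "{e \<in> edges G. v \<in> e} = {e, f}" "e \<noteq> f" by (meson card_2_iff)
  then have "e \<in> edges G" "f \<in> edges G" "v \<in> e" "v \<in> f" by auto
  moreover have "\<exists>a. g = {v, a} \<and> a \<noteq> v \<and> a \<in> verts G" if "g \<in> edges G" "v \<in> g" for g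
    using simple_graph_edgeE[OF G(1) that(1)] that(2) by (metis empty_iff insert_commute insert_iff)
  ultimately obtain a b where "e = {v, a}" "f = {v, b}" "a \<noteq> v" "b \<noteq> v" "a \<in> verts G" "b \<in> verts G"
    by metis
  then show ?thesis using that[of a b] ef by auto
qed

text \<open>2-connectedness follows by parity. A set \<open>A\<close> that no edge of
  \<open>G - v\<close> leaves is left in \<open>G\<close> only by edges at \<open>v\<close>, and by
  an even number of them because all degrees are 2. None contradicts connectivity of
  \<open>G\<close>; if both edges at \<open>v\<close> lead to \<open>A\<close>, then no edge leaves
  the set of vertices outside \<open>A\<close> and \<open>v\<close>, which again contradicts
  connectivity.\<close>

lemma circuitI:
  assumes G: "simple_graph G" "regular 2 G" and con: "connected_graph G"
  shows "circuit G"
proof -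
  have fin: "finite (verts G)" using G by (simp add: simple_graph_def)
  obtain v where v: "v \<in> verts G" using con by (auto simp: connected_graph_def)
  obtain a b where "a \<noteq> b" "a \<noteq> v" "b \<noteq> v" "a \<in> verts G" "b \<in> verts G"
    using regular_2_neighbours[OF G v] by metis
  then have "card {v, a, b} = 3" "{v, a, b} \<subseteq> verts G" using v by auto
  then have 3: "3 \<le> card (verts G)" using fin by (metis card_mono)
  have "connected_graph (delete_vertices G {v})" if v: "v \<in> verts G" for v
  proof -
    let ?D = "delete_vertices G {v}"
    have sD: "simple_graph ?D" using G by (auto simp: simple_graph_def delete_vertices_def)
    have "verts ?D \<noteq> {}"
      using 3 card_mono[of "{v}" "verts G"] by (auto simp: delete_vertices_def)
    moreover have "A = verts ?D" if A: "A \<subseteq> verts ?D" "A \<noteq> {}" "\<forall>e\<in>edges ?D. \<not> crosses A e" for A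
    proof (rule ccontr)
      assume ne: "A \<noteq> verts ?D"
      have AV: "A \<subseteq> verts G" "v \<notin> A" using A by (auto simp: delete_vertices_def)
      let ?X = "{e \<in> edges G. crosses A e}" and ?Y = "{e \<in> edges G. v \<in> e}"
      have sub: "?X \<subseteq> ?Y"
        using A(3) by (auto simp: delete_vertices_def)
      have cY: "card ?Y = 2" using G(2) v by (simp add: regular_def degree_def)
      have fY: "finite ?Y" using simple_graph_finite_edges[OF G(1)] by auto
      have "(\<Sum>v\<in>A. degree G v) = 2 * card A" using G(2) AV by (auto simp: regular_def subset_iff)
      then have "even (card ?X)"
        using sum_degrees[OF G(1) AV(1)] unfolding cut_def by presburger
      moreover have "card ?X \<le> 2" using card_mono[OF fY sub] cY by simp
      ultimately consider "card ?X = 0" | "card ?X = 2" by fastforce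
      then show False
      proof cases
        case 1
        then have "\<forall>e\<in>edges G. \<not> crosses A e" using finite_subset[OF sub fY] by auto
        then have "A = verts G" using con AV A(2) unfolding connected_graph_iff[OF G(1)] by blast
        then show False using AV v by auto
      next
        case 2
        then have XY: "?X = ?Y" using card_subset_eq[OF fY sub] cY by simp
        let ?B = "verts G - A - {v}"
        have "\<not> crosses ?B e" if e: "e \<in> edges G" for e
        proof
          assume cr: "crosses ?B e"
          have "e \<subseteq> verts G" using e G(1) by (simp add: simple_graph_def)
          then obtain s t where st: "s \<in> e" "t \<in> e" "s \<in> ?B" "t \<notin> ?B" "t \<in> verts G"
            using cr unfolding crosses_def by auto
          show False
          proof (cases "v \<in> e")
            case True
            then have "e \<in> ?X" using XY e by blast
            then obtain a where "a \<in> e" "a \<in> A" by (auto simp: crosses_def)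
            moreover have "card e = 2" using e G(1) by (simp add: simple_graph_def)
            moreover have "a \<noteq> s" "a \<noteq> v" "s \<noteq> v" using calculation st AV by auto
            moreover have "{a, s, v} \<subseteq> e" using calculation st True by auto
            moreover have "card {a, s, v} = 3" using \<open>a \<noteq> s\<close> \<open>a \<noteq> v\<close> \<open>s \<noteq> v\<close> by simp
            ultimately show False
              using card_mono[of e "{a, s, v}"] card.infinite[of e] by fastforce
          next
            case False
            then have "t \<in> A" using st by auto
            then have "e \<in> ?X" using st e by (auto simp: crosses_def)
            then show False using False XY by blast
          qed
        qed
        moreover have "?B \<noteq> {}" "?B \<subseteq> verts G"
          using ne A by (auto simp: delete_vertices_def)
        ultimately have "?B = verts G" using con unfolding connected_graph_iff[OF G(1)] by blast
        then show False using v by blast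
      qed
    qed
    ultimately show ?thesis unfolding connected_graph_iff[OF sD] by blast
  qed
  then show ?thesis using G con 3 by (simp add: circuit_def two_connected_def)
qed

lemma circuit_card: "circuit C \<Longrightarrow> 3 \<le> card (verts C)"
  by (simp add: circuit_def two_connected_def)

section \<open>Permutation 2-factors\<close>

text \<open>\<open>K\<close> and \<open>L\<close> are the vertex sets of the two circuits of a
  permutation 2-factor, described by closed sets alone. The minimality clause expresses that each
  circuit is connected; the last clause is the chordlessness of both circuits at once.\<close>

definition halves :: "'a ugraph \<Rightarrow> 'a ugraph \<Rightarrow> 'a set \<Rightarrow> 'a set \<Rightarrow> bool" where
  "halves G F K L \<longleftrightarrow> K \<union> L = verts G \<and> K \<inter> L = {} \<and> K \<noteq> {} \<and> L \<noteq> {} \<and>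
     (\<forall>e\<in>edges F. \<not> crosses K e) \<and>
     (\<forall>A. A \<noteq> {} \<longrightarrow> (\<forall>e\<in>edges F. \<not> crosses A e) \<longrightarrow> (A \<subseteq> K \<longrightarrow> A = K) \<and> (A \<subseteq> L \<longrightarrow> A = L)) \<and>
     (\<forall>e\<in>edges G - edges F. crosses K e)"

lemma crosses_complement:
  assumes "e \<subseteq> K \<union> L" "K \<inter> L = {}"
  shows "crosses L e \<longleftrightarrow> crosses K e"
  using assms by (auto simp: crosses_def)

lemma halves_commute:
  assumes "simple_graph G" "subgraph F G" "halves G F K L"
  shows "halves G F L K"
proof -
  have e: "crosses L e \<longleftrightarrow> crosses K e" if "e \<in> edges G" for e
    using assms that by (intro crosses_complement) (auto simp: halves_def simple_graph_def)
  then have "\<forall>e\<in>edges F. \<not> crosses L e" "\<forall>e\<in>edges G - edges F. crosses L e"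
    using assms(2,3) unfolding halves_def subgraph_def by (metis subsetD, metis Diff_iff)
  then show ?thesis using assms(3) unfolding halves_def by (auto simp: Un_commute Int_commute)
qed

lemma component_induced:
  assumes F: "simple_graph F" and K: "K \<subseteq> verts F" "K \<noteq> {}" "\<forall>e\<in>edges F. \<not> crosses K e"
    and mn: "\<And>A. A \<noteq> {} \<Longrightarrow> A \<subseteq> K \<Longrightarrow> (\<forall>e\<in>edges F. \<not> crosses A e) \<Longrightarrow> A = K"
  shows "is_component (induced F K) F"
proof -
  have s: "simple_graph (induced F K)" using F K by (intro simple_graph_induced)
  have "A = K" if A: "A \<subseteq> K" "A \<noteq> {}" "\<forall>e\<in>edges F. e \<subseteq> K \<longrightarrow> \<not> crosses A e" for A
  proof (rule mn[OF A(2,1)], rule)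
    fix e assume "e \<in> edges F"
    then show "\<not> crosses A e" using A(1,3) K(3) by (meson crosses_def disjoint_iff subset_iff)
  qed
  then have "connected_graph (induced F K)"
    using K unfolding connected_graph_iff[OF s] by auto
  then show ?thesis using K unfolding is_component_iff[OF F] by auto
qed

text \<open>No edge leaves the intersection of the two vertex sets, so by connectivity it is all of
  each.\<close>

lemma components_eq:
  assumes F: "simple_graph F" "is_component C F" "is_component D F" "verts C \<inter> verts D \<noteq> {}"
  shows "C = D"
proof -
  let ?A = "verts C \<inter> verts D"
  have C: "simple_graph C" "simple_graph D" using F by (auto simp: is_component_def subgraph_def)
  have cl: "\<forall>e\<in>edges F. \<not> crosses (verts C) e" "\<forall>e\<in>edges F. \<not> crosses (verts D) e"
    using F is_component_iff by blast+
  have "\<forall>e\<in>edges F. \<not> crosses ?A e" using cl by (fastforce simp: crosses_def)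
  then have "\<forall>e\<in>edges C. \<not> crosses ?A e" "\<forall>e\<in>edges D. \<not> crosses ?A e"
    using F by (auto simp: is_component_def subgraph_def)
  then have "?A = verts C" "?A = verts D"
    using F(2-4) connected_graph_iff[OF C(1)] connected_graph_iff[OF C(2)]
    unfolding is_component_def by (metis inf_le1, metis inf_le2)
  then show ?thesis using F(2,3) is_component_iff[OF F(1)] by metis
qed

lemma permutation_two_factorI:
  assumes G: "simple_graph G" and F: "two_factor G F" and h: "halves G F K L"
  shows "permutation_two_factor G F"
proof -
  have sF: "simple_graph F" and vF: "verts F = verts G" and sub: "subgraph F G" and r: "regular 2 F"
    using F by (auto simp: two_factor_def subgraph_def)
  have h': "halves G F L K" using halves_commute[OF G sub h] .
  have circ: "is_component (induced F K) F \<and> circuit (induced F K) \<and> chordless G (induced F K)"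
    if h: "halves G F K L" for K L
  proof -
    have KL: "K \<subseteq> verts F" "K \<noteq> {}" "\<forall>e\<in>edges F. \<not> crosses K e" using h vF by (auto simp: halves_def)
    then have c: "is_component (induced F K) F"
      using h by (intro component_induced[OF sF]) (auto simp: halves_def)
    have "regular 2 (induced F K)"
      using r KL degree_induced[OF KL(3)] by (auto simp: regular_def)
    moreover have "simple_graph (induced F K)" "connected_graph (induced F K)"
      using c by (auto simp: is_component_def subgraph_def)
    ultimately have "circuit (induced F K)" by (intro circuitI)
    moreover have "chordless G (induced F K)"
      using h by (auto simp: chordless_def halves_def crosses_def)
    ultimately show ?thesis using c by auto
  qed
  have "C = induced F K \<or> C = induced F L" if C: "is_component C F" for C
  proof -
    have "verts C \<noteq> {}" "verts C \<subseteq> verts F" using C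
      by (auto simp: is_component_def connected_graph_def subgraph_def)
    then have "verts C \<inter> verts (induced F K) \<noteq> {} \<or> verts C \<inter> verts (induced F L) \<noteq> {}"
      using h vF by (auto simp: halves_def)
    then show ?thesis using components_eq[OF sF C] circ[OF h] circ[OF h'] by blast
  qed
  then have "{C. is_component C F} = {induced F K, induced F L}"
    using circ[OF h] circ[OF h'] by blast
  moreover have "induced F K \<noteq> induced F L"
    using h by (auto simp: halves_def dest!: arg_cong[of _ _ verts])
  ultimately have "card {C. is_component C F} = 2"
    and "\<And>C. is_component C F \<longleftrightarrow> C = induced F K \<or> C = induced F L"
    by (simp, blast)
  then show ?thesis
    using F circ[OF h] circ[OF h'] unfolding permutation_two_factor_def by metis
qed

lemma permutation_two_factor_halves:
  assumes G: "simple_graph G" and F: "permutation_two_factor G F"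
    and C: "is_component C F" "is_component D F" "C \<noteq> D"
  shows "halves G F (verts C) (verts D)"
proof -
  have sF: "simple_graph F" and vF: "verts F = verts G" and eF: "edges F \<subseteq> edges G"
    and two: "card {C. is_component C F} = 2"
    using F by (auto simp: permutation_two_factor_def two_factor_def subgraph_def)
  have all: "E = C \<or> E = D" if "is_component E F" for E
  proof -
    obtain x y where "{C. is_component C F} = {x, y}" using two unfolding card_2_iff by blast
    then have "\<And>C. is_component C F \<longleftrightarrow> C = x \<or> C = y" by blast
    then show ?thesis using that C by metis
  qed
  have sub: "verts C \<subseteq> verts G" "verts D \<subseteq> verts G" using C vF
    by (auto simp: is_component_def subgraph_def)
  have "v \<in> verts C \<union> verts D" if "v \<in> verts G" for v
    using component_of_vertex[OF sF] that vF all by (metis UnI1 UnI2)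
  then have un: "verts C \<union> verts D = verts G" using sub by auto
  have dis: "verts C \<inter> verts D = {}" using components_eq[OF sF C(1,2)] C(3) by auto
  have ne: "verts C \<noteq> {}" "verts D \<noteq> {}" using C by (auto simp: is_component_def connected_graph_def)
  have cl: "\<forall>e\<in>edges F. \<not> crosses (verts C) e" using C is_component_iff[OF sF] by blast
  have mn: "A = verts E" if "is_component E F" "A \<noteq> {}" "\<forall>e\<in>edges F. \<not> crosses A e" "A \<subseteq> verts E" for A E
    using that connected_graph_iff unfolding is_component_def subgraph_def by (metis subsetD)
  have "crosses (verts C) e" if e: "e \<in> edges G - edges F" for e
  proof (rule ccontr)
    assume n: "\<not> crosses (verts C) e"
    have "e \<subseteq> verts G" using e G by (auto simp: simple_graph_def)
    then have "e \<subseteq> verts C \<or> e \<subseteq> verts D" using n un dis by (auto simp: crosses_def)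
    then have "e \<in> edges C \<or> e \<in> edges D"
      using F C e unfolding permutation_two_factor_def chordless_def by blast
    then show False using e C by (auto simp: is_component_def subgraph_def)
  qed
  then show ?thesis unfolding halves_def using un dis ne cl mn C by blast
qed

lemma permutation_two_factor_halvesE:
  assumes G: "simple_graph G" and F: "permutation_two_factor G F"
  obtains K L where "halves G F K L" "is_component (induced F K) F" "is_component (induced F L) F"
proof -
  obtain C D where CD: "{C. is_component C F} = {C, D}" "C \<noteq> D"
    using F unfolding permutation_two_factor_def card_2_iff by blast
  then have c: "is_component C F" "is_component D F" by auto
  have sF: "simple_graph F" using F by (auto simp: permutation_two_factor_def two_factor_def subgraph_def)
  show ?thesis using that[OF permutation_two_factor_halves[OF G F c CD(2)]] c
    is_component_iff[OF sF] by metis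
qed

section \<open>An invariant implying admissibility\<close>

definition colour_degree :: "'a ugraph \<Rightarrow> ('a set \<Rightarrow> 'c) \<Rightarrow> 'c \<Rightarrow> 'a \<Rightarrow> nat" where
  "colour_degree F \<phi> c v = card {f \<in> edges F. v \<in> f \<and> \<phi> f = c}"

text \<open>A colouring of a 2-factor \<open>F\<close> such that the two factor edges at either end of an edge outside
  \<open>F\<close> carry the same two distinct colours. A 3-edge-colouring of \<open>G\<close> restricts to one, and so does
  a circuit double cover containing the circuits of \<open>F\<close>: colour \<open>f\<close> with the other circuit
  through \<open>f\<close>.\<close>

definition pair_colouring :: "'a ugraph \<Rightarrow> 'a ugraph \<Rightarrow> ('a set \<Rightarrow> 'c) \<Rightarrow> bool" where
  "pair_colouring G F \<phi> \<longleftrightarrow> (\<forall>c. (\<forall>v\<in>verts G. colour_degree F \<phi> c v \<le> 1) \<and>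
     (\<forall>u v. {u, v} \<in> edges G - edges F \<longrightarrow> colour_degree F \<phi> c u = colour_degree F \<phi> c v))"

text \<open>The size of an edge cut around a tree with \<open>n\<close> vertices in a cubic graph, capped at 5.\<close>

definition tree_cut :: "nat \<Rightarrow> nat" where
  "tree_cut n = (if n = 0 then 0 else min 5 (n + 2))"

text \<open>For a cubic graph the cut condition is a numerical form of cyclic 5-edge connectivity.
  The order 10 guarantees that a circuit with at most four vertices leaves at least three outside,
  and that every core has at least 8 vertices. The colour type is fixed to \<open>nat\<close>
  because a definition cannot quantify over types; \<open>pair_colouring_nat\<close> handles the
  others.\<close>

definition good :: "'a ugraph \<Rightarrow> 'a ugraph \<Rightarrow> bool" where
  "good G F \<longleftrightarrow> cubic G \<and> permutation_two_factor G F \<and> 10 \<le> card (verts G) \<and>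
     (\<forall>A \<subseteq> verts G. min (tree_cut (card A)) (tree_cut (card (verts G - A))) \<le> cut (edges G) A) \<and>
     (\<forall>\<phi> :: 'a set \<Rightarrow> nat. \<not> pair_colouring G F \<phi>)"

text \<open>Only finitely many colours occur on \<open>F\<close>, so they can be numbered
  injectively; a number that stands for none of them has colour degree 0 everywhere.\<close>

lemma pair_colouring_nat:
  fixes \<phi> :: "'a set \<Rightarrow> 'c"
  assumes fin: "finite (edges F)" and pc: "pair_colouring G F \<phi>"
  obtains \<psi> :: "'a set \<Rightarrow> nat" where "pair_colouring G F \<psi>"
proof -
  obtain g :: "'c \<Rightarrow> nat" where g: "inj_on g (\<phi> ` edges F)"
    using fin by (meson finite_imageI finite_imp_inj_to_nat_seg)
  have deg: "colour_degree F (g \<circ> \<phi>) (g d) v = colour_degree F \<phi> d v" if "d \<in> \<phi> ` edges F" for d v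
  proof -
    have "{f \<in> edges F. v \<in> f \<and> (g \<circ> \<phi>) f = g d} = {f \<in> edges F. v \<in> f \<and> \<phi> f = d}"
      using g that by (auto dest: inj_onD)
    then show ?thesis by (simp add: colour_degree_def)
  qed
  have deg0: "colour_degree F (g \<circ> \<phi>) c v = 0" if "c \<notin> g ` \<phi> ` edges F" for c v
  proof -
    have "{f \<in> edges F. v \<in> f \<and> (g \<circ> \<phi>) f = c} = {}" using that by auto
    then show ?thesis by (simp only: colour_degree_def card.empty)
  qed
  have "pair_colouring G F (g \<circ> \<phi>)"
    unfolding pair_colouring_def
  proof
    fix c
    show "(\<forall>v\<in>verts G. colour_degree F (g \<circ> \<phi>) c v \<le> 1) \<and> (\<forall>u v. {u, v} \<in> edges G - edges F \<longrightarrow>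
      colour_degree F (g \<circ> \<phi>) c u = colour_degree F (g \<circ> \<phi>) c v)"
    proof (cases "c \<in> g ` \<phi> ` edges F")
      case True
      then obtain d where "d \<in> \<phi> ` edges F" "c = g d" by blast
      then show ?thesis using deg pc unfolding pair_colouring_def by metis
    next
      case False
      then show ?thesis using deg0 by simp
    qed
  qed
  then show ?thesis using that by blast
qed

lemma non_factor_edge:
  assumes G: "cubic G" and F: "two_factor G F" and v: "v \<in> verts G"
  obtains w where "{v, w} \<in> edges G - edges F" "w \<in> verts G"
    "{e \<in> edges G. v \<in> e} = insert {v, w} {f \<in> edges F. v \<in> f}"
proof -
  have sG: "simple_graph G" using G by (simp add: cubic_def)
  have 3: "card {e \<in> edges G. v \<in> e} = 3" using G v by (simp add: cubic_def regular_def degree_def)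
  have 2: "card {e \<in> edges F. v \<in> e} = 2"
    using F v by (simp add: two_factor_def regular_def degree_def)
  have sub: "{e \<in> edges F. v \<in> e} \<subseteq> {e \<in> edges G. v \<in> e}"
    using F by (auto simp: two_factor_def subgraph_def)
  have "card ({e \<in> edges G. v \<in> e} - {e \<in> edges F. v \<in> e}) = 1"
    using card_Diff_subset[OF _ sub] 2 3 by (simp add: card_ge_0_finite)
  then obtain m where m: "{e \<in> edges G. v \<in> e} - {e \<in> edges F. v \<in> e} = {m}"
    by (meson card_1_singletonE)
  then have mG: "m \<in> edges G" "v \<in> m" "m \<notin> edges F" by auto
  obtain a b where "m = {a, b}" "a \<in> verts G" "b \<in> verts G" using simple_graph_edgeE[OF sG mG(1)] .
  then obtain w where "m = {v, w}" "w \<in> verts G" using mG(2) by (auto simp: insert_commute)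
  then show ?thesis using that[of w] m mG sub by auto
qed

text \<open>All three colours occur at each vertex, so the two factor edges at \<open>v\<close>
  carry exactly the two colours different from that of the non-factor edge \<open>{v, w}\<close>,
  and the same holds at \<open>w\<close>.\<close>

lemma edge_colouring_pair_colouring:
  assumes G: "cubic G" and F: "two_factor G F" and c: "edge_colorable 3 G"
  obtains \<phi> :: "'a set \<Rightarrow> nat" where "pair_colouring (G :: 'a ugraph) F \<phi>"
proof -
  obtain c :: "'a set \<Rightarrow> nat" where c3: "\<forall>e\<in>edges G. c e < 3" and
    proper: "\<forall>e\<in>edges G. \<forall>f\<in>edges G. e \<noteq> f \<and> e \<inter> f \<noteq> {} \<longrightarrow> c e \<noteq> c f"
    using c unfolding edge_colorable_def by blast
  have eF: "edges F \<subseteq> edges G" using F by (auto simp: two_factor_def subgraph_def)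
  have inj: "inj_on c {e \<in> edges G. v \<in> e}" for v
    using proper by (force simp: inj_on_def)
  have deg: "colour_degree F c k v = of_bool (k < 3 \<and> k \<noteq> c {v, w})"
    if vw: "v \<in> verts G" "{v, w} \<in> edges G - edges F" for v w k
  proof -
    obtain w' where w': "{v, w'} \<in> edges G - edges F" "w' \<in> verts G"
      and st: "{e \<in> edges G. v \<in> e} = insert {v, w'} {f \<in> edges F. v \<in> f}"
      by (rule non_factor_edge[OF G F vw(1)])
    have "{v, w} \<in> {e \<in> edges G. v \<in> e}" using vw(2) by simp
    then have "{v, w} \<in> insert {v, w'} {f \<in> edges F. v \<in> f}" unfolding st .
    then have ww: "{v, w} = {v, w'}" using vw(2) by auto
    have "card (c ` {e \<in> edges G. v \<in> e}) = 3"
      using card_image[OF inj] G vw(1) by (simp add: cubic_def regular_def degree_def)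
    moreover have "c ` {e \<in> edges G. v \<in> e} \<subseteq> {..<3}" using c3 by auto
    ultimately have "c ` {e \<in> edges G. v \<in> e} = {..<3}" by (intro card_subset_eq) auto
    then have im: "{..<3} = insert (c {v, w}) (c ` {f \<in> edges F. v \<in> f})" using st ww by simp
    have ne: "c f \<noteq> c {v, w}" if "f \<in> edges F" "v \<in> f" for f
    proof -
      have "f \<noteq> {v, w}" "f \<in> edges G" "{v, w} \<in> edges G" "f \<inter> {v, w} \<noteq> {}"
        using that vw(2) eF by auto
      then show ?thesis using proper[rule_format, of f "{v, w}"] by simp
    qed
    show ?thesis
    proof (cases "k < 3 \<and> k \<noteq> c {v, w}")
      case True
      then obtain f where f: "f \<in> edges F" "v \<in> f" "k = c f" using im by (auto simp: set_eq_iff)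
      have "{g \<in> edges F. v \<in> g \<and> c g = k} = {f}"
        using f inj[of v] eF by (auto simp: inj_on_def)
      then show ?thesis using True by (simp add: colour_degree_def)
    next
      case False
      then have "{g \<in> edges F. v \<in> g \<and> c g = k} = {}" using ne c3 eF by auto
      then have "colour_degree F c k v = 0" by (simp only: colour_degree_def card.empty)
      then show ?thesis using False by simp
    qed
  qed
  have "pair_colouring G F c"
    unfolding pair_colouring_def
  proof (intro allI conjI ballI impI)
    fix k v assume "v \<in> verts G"
    then show "colour_degree F c k v \<le> 1" using non_factor_edge[OF G F] deg by (metis of_bool_less_eq_one)
  next
    fix k u v assume uv: "{u, v} \<in> edges G - edges F"
    then have "u \<in> verts G" "v \<in> verts G" using G by (auto simp: cubic_def simple_graph_def)
    then show "colour_degree F c k u = colour_degree F c k v"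
      using deg[of u v] deg[of v u] uv by (simp add: insert_commute)
  qed
  then show ?thesis using that by blast
qed

text \<open>Without the circuits of \<open>F\<close>, the cover contains each factor edge once and
  every other edge twice. A circuit has degree 0 or 2 at a vertex, so the two circuits through the
  non-factor edge at \<open>v\<close> are precisely the colours of the two factor edges at
  \<open>v\<close>.\<close>

lemma cdc_pair_colouring:
  fixes G :: "'a ugraph"
  assumes G: "cubic G" and F: "two_factor G F" and c: "contained_in_some_cdc G F"
  obtains \<phi> :: "'a set \<Rightarrow> 'a ugraph" where "pair_colouring G F \<phi>"
proof -
  obtain S where S: "cdc G S" "\<forall>C\<in>S. circuit C" "\<forall>C. is_component C F \<longrightarrow> C \<in> S"
    using c unfolding contained_in_some_cdc_def by blast
  have eF: "edges F \<subseteq> edges G" and sF: "simple_graph F"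
    using F by (auto simp: two_factor_def subgraph_def)
  define T where "T = {H \<in> S. \<not> is_component H F}"
  have two: "card {H \<in> S. e \<in> edges H} = 2" if "e \<in> edges G" for e
    using S(1) that by (simp add: cdc_def)
  have comp: "edges C \<subseteq> edges F" if "is_component C F" for C
    using that by (simp add: is_component_def subgraph_def)
  have two': "{H \<in> T. e \<in> edges H} = {H \<in> S. e \<in> edges H}" if "e \<in> edges G - edges F" for e
    using that comp by (auto simp: T_def)
  have one: "card {H \<in> T. e \<in> edges H} = 1" if e: "e \<in> edges F" for e
  proof -
    obtain u v where uv: "e = {u, v}" "u \<in> verts F" "v \<in> verts F"
      using simple_graph_edgeE[OF sF e] by metis
    obtain C where C: "is_component C F" "u \<in> verts C" using component_of_vertex[OF sF uv(2)] .
    then have ind: "C = induced F (verts C)" "\<not> crosses (verts C) e"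
      using is_component_iff[OF sF] e by blast+
    then have "e \<subseteq> verts C" using C uv by auto
    then have eC: "e \<in> edges C" using e by (subst ind(1)) simp
    have un: "D = C" if D: "is_component D F" "e \<in> edges D" for D
    proof (rule components_eq[OF sF D(1) C(1)])
      have "u \<in> verts D" using D uv by (auto simp: is_component_def subgraph_def simple_graph_def)
      then show "verts D \<inter> verts C \<noteq> {}" using C by auto
    qed
    have "{H \<in> T. e \<in> edges H} = {H \<in> S. e \<in> edges H} - {C}"
      using un C by (auto simp: T_def)
    moreover have "C \<in> {H \<in> S. e \<in> edges H}" using S(3) C eC by auto
    ultimately show ?thesis using two[of e] e eF by (simp add: subset_iff)
  qed
  define \<phi> where "\<phi> f = (THE H. H \<in> T \<and> f \<in> edges H)" for f
  have phi: "H \<in> T \<and> f \<in> edges H \<longleftrightarrow> H = \<phi> f" if f: "f \<in> edges F" for H f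
  proof -
    obtain D where "{H \<in> T. f \<in> edges H} = {D}" using one[OF f] by (rule card_1_singletonE)
    then have D: "\<And>H. H \<in> T \<and> f \<in> edges H \<longleftrightarrow> H = D" by blast
    then show ?thesis unfolding \<phi>_def by simp
  qed
  have deg: "colour_degree F \<phi> H v = of_bool (H \<in> T \<and> {v, w} \<in> edges H)"
    if vw: "v \<in> verts G" "{v, w} \<in> edges G - edges F" for v w H
  proof (cases "H \<in> T")
    case False
    then have "{f \<in> edges F. v \<in> f \<and> \<phi> f = H} = {}" using phi by auto
    then have "colour_degree F \<phi> H v = 0" by (simp only: colour_degree_def card.empty)
    then show ?thesis using False by simp
  next
    case True
    obtain w' where w': "{v, w'} \<in> edges G - edges F" "w' \<in> verts G"
      and st: "{e \<in> edges G. v \<in> e} = insert {v, w'} {f \<in> edges F. v \<in> f}"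
      by (rule non_factor_edge[OF G F vw(1)])
    have "{v, w} \<in> {e \<in> edges G. v \<in> e}" using vw(2) by simp
    then have "{v, w} \<in> insert {v, w'} {f \<in> edges F. v \<in> f}" unfolding st .
    then have ww: "{v, w'} = {v, w}" using vw(2) by auto
    have star: "{f \<in> edges H. v \<in> f} =
        {f \<in> edges F. v \<in> f \<and> \<phi> f = H} \<union> (if {v, w} \<in> edges H then {{v, w}} else {})"
      if H: "H \<in> T" for H
    proof -
      have "edges H \<subseteq> edges G" using H S(1) by (auto simp: T_def cdc_def subgraph_def)
      have "f \<in> edges H \<and> v \<in> f \<longleftrightarrow>
          (f \<in> edges F \<and> v \<in> f \<and> \<phi> f = H) \<or> ({v, w} \<in> edges H \<and> f = {v, w})" for f
      proof -
        have "f \<in> {e \<in> edges G. v \<in> e} \<longleftrightarrow> f = {v, w} \<or> f \<in> edges F \<and> v \<in> f"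
          unfolding st ww by simp
        moreover have "f \<in> edges H \<Longrightarrow> f \<in> edges G" using \<open>edges H \<subseteq> edges G\<close> by auto
        moreover have "f \<in> edges F \<Longrightarrow> \<phi> f = H \<longleftrightarrow> f \<in> edges H" using phi[of f H] H by auto
        ultimately show ?thesis by (cases "f = {v, w}") auto
      qed
      then have "{f \<in> edges H. v \<in> f} =
          {f. (f \<in> edges F \<and> v \<in> f \<and> \<phi> f = H) \<or> ({v, w} \<in> edges H \<and> f = {v, w})}"
        by (simp only: mem_Collect_eq)
      then show ?thesis by auto
    qed
    have fin: "finite {f \<in> edges F. v \<in> f \<and> \<phi> f = H}" for H
      using simple_graph_finite_edges[OF sF] by auto
    have dH: "card {f \<in> edges H. v \<in> f} = 0 \<or> card {f \<in> edges H. v \<in> f} = 2" if H: "H \<in> T" for H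
    proof -
      have "circuit H" using H S(2) by (simp add: T_def)
      then have "simple_graph H" "regular 2 H" by (auto simp: circuit_def)
      moreover have "{f \<in> edges H. v \<in> f} = {}" if "v \<notin> verts H"
        using that \<open>simple_graph H\<close> by (auto simp: simple_graph_def)
      ultimately show ?thesis by (metis card.empty degree_def regular_def)
    qed
    have sum: "card {f \<in> edges H. v \<in> f} = colour_degree F \<phi> H v + of_bool ({v, w} \<in> edges H)"
      if "H \<in> T" for H
      unfolding star[OF that] colour_degree_def using fin[of H] vw(2)
      by (subst card_Un_disjoint) auto
    show ?thesis
    proof (cases "{v, w} \<in> edges H")
      case m: True
      then show ?thesis using sum[OF True] dH[OF True] True by auto
    next
      case m: False
      \<comment> \<open>If both factor edges at \<open>v\<close> had colour \<open>H\<close>, a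
        circuit of \<open>T\<close> through \<open>{v, w}\<close> would need one of them as its
        second edge at \<open>v\<close> and would equal \<open>H\<close>, which avoids
        \<open>{v, w}\<close>.\<close>
      have "colour_degree F \<phi> H v \<noteq> 2"
      proof
        assume "colour_degree F \<phi> H v = 2"
        then have "card {f \<in> edges F. v \<in> f} = card {f \<in> edges F. v \<in> f \<and> \<phi> f = H}"
          using F vw(1) by (simp add: colour_degree_def two_factor_def regular_def degree_def)
        then have all: "{f \<in> edges F. v \<in> f \<and> \<phi> f = H} = {f \<in> edges F. v \<in> f}"
          using simple_graph_finite_edges[OF sF] by (intro card_subset_eq) auto
        have "card {H \<in> T. {v, w} \<in> edges H} = 2" using two' two vw(2) by auto
        then obtain H' where H': "H' \<in> T" "{v, w} \<in> edges H'" by (metis (no_types, lifting) card.empty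
              empty_Collect_eq zero_neq_numeral)
        then have "colour_degree F \<phi> H' v = 1" using sum[OF H'(1)] dH[OF H'(1)] by auto
        then have "{f \<in> edges F. v \<in> f \<and> \<phi> f = H'} \<noteq> {}"
          unfolding colour_degree_def by (metis card.empty zero_neq_one)
        then have "H' = H" using all by blast
        then show False using m H' by simp
      qed
      then show ?thesis using sum[OF True] dH[OF True] m by auto
    qed
  qed
  have "pair_colouring G F \<phi>"
    unfolding pair_colouring_def
  proof (intro allI conjI ballI impI)
    fix H v assume "v \<in> verts G"
    then show "colour_degree F \<phi> H v \<le> 1" using non_factor_edge[OF G F] deg by (metis of_bool_less_eq_one)
  next
    fix H u v assume uv: "{u, v} \<in> edges G - edges F"
    then have "u \<in> verts G" "v \<in> verts G" using G by (auto simp: cubic_def simple_graph_def)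
    then show "colour_degree F \<phi> H u = colour_degree F \<phi> H v"
      using deg[of u v] deg[of v u] uv by (simp add: insert_commute)
  qed
  then show ?thesis using that by blast
qed

section \<open>Cyclic edge connectivity, girth and admissibility from the invariant\<close>

lemma good_cut:
  assumes "good G F" "A \<subseteq> verts G" "3 \<le> card A" "3 \<le> card (verts G - A)"
  shows "5 \<le> cut (edges G) A"
proof -
  have "tree_cut (card A) = 5" "tree_cut (card (verts G - A)) = 5"
    using assms(3,4) by (auto simp: tree_cut_def)
  moreover have "min (tree_cut (card A)) (tree_cut (card (verts G - A))) \<le> cut (edges G) A"
    using assms(1,2) by (simp add: good_def)
  ultimately show ?thesis by simp
qed

text \<open>A circuit has at least three vertices, so a component containing one of the two circuits
  and its complement are both large enough for the bound 5; every edge leaving that component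
  belongs to \<open>X\<close>.\<close>

lemma good_cyclically_edge_connected:
  assumes "good G F"
  shows "cyclically_edge_connected 5 G"
  unfolding cyclically_edge_connected_def cyclic_edge_connectivity_def
proof (rule INF_greatest)
  fix X assume "X \<in> {X. cyclic_edge_cut G X}"
  then obtain A B C D where X: "X \<subseteq> edges G" and AB: "A \<noteq> B" "is_component A (delete_edges G X)"
      "is_component B (delete_edges G X)" and CD: "subgraph C A" "circuit C" "subgraph D B" "circuit D"
    unfolding cyclic_edge_cut_def by blast
  let ?D = "delete_edges G X"
  have sG: "simple_graph G" using assms by (simp add: good_def cubic_def)
  have sD: "simple_graph ?D" using sG by (auto simp: simple_graph_def delete_edges_def)
  have V: "verts A \<subseteq> verts G" "verts B \<subseteq> verts G" and fin: "finite (verts G)"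
    using AB sG by (auto simp: is_component_def subgraph_def delete_edges_def simple_graph_def)
  have dis: "verts A \<inter> verts B = {}" using components_eq[OF sD AB(2,3)] AB(1) by blast
  have c: "3 \<le> card (verts C)" "3 \<le> card (verts D)" using CD circuit_card by auto
  have "verts C \<subseteq> verts A" "verts D \<subseteq> verts G - verts A"
    using CD V dis by (auto simp: subgraph_def)
  then have "3 \<le> card (verts A)" "3 \<le> card (verts G - verts A)"
    using c fin V by (meson card_mono finite_Diff finite_subset le_trans)+
  then have "5 \<le> cut (edges G) (verts A)" using good_cut[OF assms V(1)] by blast
  moreover have "{e \<in> edges G. crosses (verts A) e} \<subseteq> X"
    using AB(2) unfolding is_component_iff[OF sD] by (auto simp: delete_edges_def)
  then have "cut (edges G) (verts A) \<le> card X"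
    unfolding cut_def using X simple_graph_finite_edges[OF sG] by (meson card_mono finite_subset)
  ultimately show "enat 5 \<le> enat (card X)" by simp
qed

text \<open>A circuit with n vertices spans at least n edges, so at most 3n - 2n = n edges leave it.
  For n at most 4 this is below the bound 5, which applies because at least 6 vertices lie
  outside.\<close>

lemma good_girth:
  assumes "good G F"
  shows "5 \<le> girth G"
  unfolding girth_def
proof (rule INF_greatest)
  fix C assume "C \<in> {C. subgraph C G \<and> circuit C}"
  then have C: "subgraph C G" "circuit C" by auto
  have sG: "simple_graph G" using assms by (simp add: good_def cubic_def)
  have V: "verts C \<subseteq> verts G" "edges C \<subseteq> edges G" and sC: "simple_graph C" and r: "regular 2 C"
    using C by (auto simp: subgraph_def circuit_def)
  have "(\<Sum>v\<in>verts C. degree G v) = 3 * card (verts C)"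
    using assms V(1) by (simp add: good_def cubic_def regular_def subset_iff)
  then have s: "3 * card (verts C) = cut (edges G) (verts C) + 2 * card {e \<in> edges G. e \<subseteq> verts C}"
    using sum_degrees[OF sG V(1)] by simp
  have "edges C \<subseteq> {e \<in> edges G. e \<subseteq> verts C}" using V sC by (auto simp: simple_graph_def)
  then have "card (verts C) \<le> card {e \<in> edges G. e \<subseteq> verts C}"
    using regular_2_edges[OF sC r] simple_graph_finite_edges[OF sG]
      card_mono[of "{e \<in> edges G. e \<subseteq> verts C}" "edges C"] by simp
  then have le: "cut (edges G) (verts C) \<le> card (verts C)" using s by linarith
  show "5 \<le> enat (card (verts C))"
  proof (rule ccontr)
    assume "\<not> ?thesis"
    then have lt: "card (verts C) < 5" by (simp add: numeral_eq_enat)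
    have "card (verts G - verts C) = card (verts G) - card (verts C)"
      using V sC by (simp add: card_Diff_subset simple_graph_def)
    moreover have "10 \<le> card (verts G)" using assms by (simp add: good_def)
    ultimately have "3 \<le> card (verts G - verts C)" using lt by linarith
    then have "5 \<le> cut (edges G) (verts C)" using good_cut[OF assms V(1)] circuit_card[OF C(2)] by blast
    then show False using le lt by linarith
  qed
qed

lemma good_admissible:
  assumes "good G F"
  shows "admissible G F"
proof -
  have G: "cubic G" and P: "permutation_two_factor G F"
    and np: "\<And>\<phi> :: 'a set \<Rightarrow> nat. \<not> pair_colouring G F \<phi>"
    using assms by (auto simp: good_def)
  have F: "two_factor G F" using P by (simp add: permutation_two_factor_def)
  then have fin: "finite (edges F)"
    by (simp add: two_factor_def subgraph_def simple_graph_finite_edges)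
  have "\<not> edge_colorable 3 G" using edge_colouring_pair_colouring[OF G F] np by blast
  moreover have "\<not> contained_in_some_cdc G F"
    using cdc_pair_colouring[OF G F] pair_colouring_nat[OF fin] np by metis
  moreover have "cyclically_edge_connected 4 G"
    using good_cyclically_edge_connected[OF assms] unfolding cyclically_edge_connected_def
    using order_trans[of "enat 4" "enat 5"] by simp
  ultimately show ?thesis
    using good_cyclically_edge_connected[OF assms] good_girth[OF assms] G P
    unfolding admissible_def permutation_snark_def cycle_permutation_graph_def snark_def by blast
qed

section \<open>The Petersen graph\<close>

lemma petersen_verts:
  "verts petersen = {Base 0, Base 1, Base 2, Base 3, Base 4, Base 5, Base 6, Base 7, Base 8, Base 9}"
proof -
  have "{0..<10::nat} = {0, 1, 2, 3, 4, 5, 6, 7, 8, 9}" by auto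
  then show ?thesis by (simp add: petersen_def)
qed

lemma petersen_edges:
  "edges petersen =
    {{Base 4, Base 0}, {Base 4, Base 9}, {Base 9, Base 6},
     {Base 3, Base 4}, {Base 3, Base 8}, {Base 8, Base 5},
     {Base 2, Base 3}, {Base 2, Base 7}, {Base 7, Base 9},
     {Base 1, Base 2}, {Base 1, Base 6}, {Base 6, Base 8},
     {Base 0, Base 1}, {Base 0, Base 5}, {Base 5, Base 7}}"
proof -
  have "{0..<5::nat} = {0, 1, 2, 3, 4}" by auto
  then show ?thesis by (simp add: petersen_def numeral_2_eq_2)
qed

lemma sum_petersen_edges:
  fixes h :: "vertex set \<Rightarrow> nat"
  shows "(\<Sum>e\<in>edges petersen. h e) =
    h {Base 0, Base 1} + h {Base 1, Base 2} + h {Base 2, Base 3} + h {Base 3, Base 4} + h {Base 4, Base 0} +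
    h {Base 0, Base 5} + h {Base 1, Base 6} + h {Base 2, Base 7} + h {Base 3, Base 8} + h {Base 4, Base 9} +
    h {Base 5, Base 7} + h {Base 6, Base 8} + h {Base 7, Base 9} + h {Base 8, Base 5} + h {Base 9, Base 6}"
  by (simp add: petersen_edges doubleton_eq_iff)

lemma simple_petersen: "simple_graph petersen"
  by (simp add: simple_graph_def petersen_verts petersen_edges)

lemma Base_in_petersen: "Base i \<in> verts petersen \<longleftrightarrow> i < 10"
  by (auto simp: petersen_def)

lemma card_verts_petersen: "card (verts petersen) = 10"
  by (simp add: petersen_verts)

lemma sum_petersen_verts:
  fixes h :: "vertex \<Rightarrow> nat"
  shows "(\<Sum>v\<in>verts petersen. h v) = h (Base 0) + h (Base 1) + h (Base 2) + h (Base 3) + h (Base 4) +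
    h (Base 5) + h (Base 6) + h (Base 7) + h (Base 8) + h (Base 9)"
  by (simp add: petersen_verts)

lemma card_petersen_subset:
  assumes "A \<subseteq> verts petersen"
  shows "card A = of_bool (Base 0 \<in> A) + of_bool (Base 1 \<in> A) + of_bool (Base 2 \<in> A) +
    of_bool (Base 3 \<in> A) + of_bool (Base 4 \<in> A) + of_bool (Base 5 \<in> A) + of_bool (Base 6 \<in> A) +
    of_bool (Base 7 \<in> A) + of_bool (Base 8 \<in> A) + of_bool (Base 9 \<in> A)"
proof -
  have "card A = card (A \<inter> verts petersen)" using assms by (simp add: inf_absorb1)
  also have "\<dots> = (\<Sum>v\<in>verts petersen. of_bool (v \<in> A))"
    by (simp add: sum_of_bool_eq petersen_verts Int_commute)
  also have "\<dots> = of_bool (Base 0 \<in> A) + of_bool (Base 1 \<in> A) + of_bool (Base 2 \<in> A) +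
    of_bool (Base 3 \<in> A) + of_bool (Base 4 \<in> A) + of_bool (Base 5 \<in> A) + of_bool (Base 6 \<in> A) +
    of_bool (Base 7 \<in> A) + of_bool (Base 8 \<in> A) + of_bool (Base 9 \<in> A)"
    by (simp add: sum_petersen_verts)
  finally show ?thesis .
qed

text \<open>The variable \<open>ai\<close> says whether vertex i lies in the set; all 1024 vertex
  sets are evaluated.\<close>

lemma petersen_cut_check:
  "\<forall>a0 a1 a2 a3 a4 a5 a6 a7 a8 a9.
   min (tree_cut (of_bool a0 + of_bool a1 + of_bool a2 + of_bool a3 + of_bool a4 +
         of_bool a5 + of_bool a6 + of_bool a7 + of_bool a8 + of_bool a9))
       (tree_cut (of_bool (\<not> a0) + of_bool (\<not> a1) + of_bool (\<not> a2) + of_bool (\<not> a3) + of_bool (\<not> a4) +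
         of_bool (\<not> a5) + of_bool (\<not> a6) + of_bool (\<not> a7) + of_bool (\<not> a8) + of_bool (\<not> a9)))
   \<le> of_bool (a0 \<noteq> a1) + of_bool (a1 \<noteq> a2) + of_bool (a2 \<noteq> a3) + of_bool (a3 \<noteq> a4) + of_bool (a4 \<noteq> a0) +
     of_bool (a0 \<noteq> a5) + of_bool (a1 \<noteq> a6) + of_bool (a2 \<noteq> a7) + of_bool (a3 \<noteq> a8) + of_bool (a4 \<noteq> a9) +
     of_bool (a5 \<noteq> a7) + of_bool (a6 \<noteq> a8) + of_bool (a7 \<noteq> a9) + of_bool (a8 \<noteq> a5) + of_bool (a9 \<noteq> a6)"
  by code_simp

lemma petersen_cut:
  assumes "A \<subseteq> verts petersen"
  shows "min (tree_cut (card A)) (tree_cut (card (verts petersen - A))) \<le> cut (edges petersen) A"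
proof -
  have c: "card (verts petersen - A) =
      of_bool (Base 0 \<notin> A) + of_bool (Base 1 \<notin> A) + of_bool (Base 2 \<notin> A) + of_bool (Base 3 \<notin> A) +
      of_bool (Base 4 \<notin> A) + of_bool (Base 5 \<notin> A) + of_bool (Base 6 \<notin> A) + of_bool (Base 7 \<notin> A) +
      of_bool (Base 8 \<notin> A) + of_bool (Base 9 \<notin> A)"
    unfolding card_petersen_subset[OF Diff_subset] Diff_iff by (simp add: Base_in_petersen)
  show ?thesis
    unfolding c card_petersen_subset[OF assms] cut_sum[OF simple_graph_finite_edges[OF simple_petersen]]
      sum_petersen_edges crosses_pair
    by (rule petersen_cut_check[rule_format])
qed

section \<open>Pair colourings of the Petersen graph\<close>

lemma Collect_insert: "{x \<in> insert a S. P x} = (if P a then insert a {x \<in> S. P x} else {x \<in> S. P x})"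
  by auto

lemma two_factor_star:
  assumes "two_factor G F" "v \<in> verts G" "{e \<in> edges G. v \<in> e} = {a, b, c}" "distinct [a, b, c]"
  shows "a \<notin> edges F \<and> {e \<in> edges F. v \<in> e} = {b, c} \<or>
    b \<notin> edges F \<and> {e \<in> edges F. v \<in> e} = {a, c} \<or>
    c \<notin> edges F \<and> {e \<in> edges F. v \<in> e} = {a, b}"
proof -
  let ?S = "{e \<in> edges F. v \<in> e}"
  have "card ?S = 2" using assms by (simp add: two_factor_def regular_def degree_def)
  moreover have sub: "?S \<subseteq> {a, b, c}"
    using assms(1) unfolding assms(3)[symmetric] by (auto simp: two_factor_def subgraph_def)
  moreover have "v \<in> a" "v \<in> b" "v \<in> c" using assms(3) by auto
  ultimately have S: "?S = {x \<in> {a, b, c}. x \<in> edges F}" by auto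
  then have "card {x \<in> {a, b, c}. x \<in> edges F} = 2" using \<open>card ?S = 2\<close> by simp
  then show ?thesis
    using assms(4) unfolding S Collect_insert by (simp split: if_splits)
qed

definition same_pair :: "'c \<Rightarrow> 'c \<Rightarrow> 'c \<Rightarrow> 'c \<Rightarrow> bool" where
  "same_pair p q r s \<longleftrightarrow> p \<noteq> q \<and> (p = r \<and> q = s \<or> p = s \<and> q = r)"

text \<open>This is the form in which a pair of colours appears in \<open>pair_colouring\<close>:
  only its multiplicities are compared, and none may exceed 1.\<close>

lemma same_pair_iff:
  fixes p q r s :: 'c
  shows "same_pair p q r s \<longleftrightarrow> (\<forall>c. (of_bool (p = c) + of_bool (q = c) :: nat) \<le> 1 \<and>
     (of_bool (p = c) + of_bool (q = c) :: nat) = of_bool (r = c) + of_bool (s = c))"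
    (is "_ \<longleftrightarrow> (\<forall>c. ?P c)")
proof
  assume "\<forall>c. ?P c"
  then have "?P p" "?P q" by blast+
  then show "same_pair p q r s" 
    by (cases "p = q"; cases "p = r"; cases "p = s"; cases "q = r"; cases "q = s"; simp add: same_pair_def)
qed (auto simp: same_pair_def)

lemma colour_degree_star:
  assumes "{e \<in> edges F. v \<in> e} = {a, b}" "a \<noteq> b"
  shows "colour_degree F \<phi> c v = of_bool (\<phi> a = c) + of_bool (\<phi> b = c)"
proof -
  have eq: "{f \<in> edges F. v \<in> f \<and> \<phi> f = c} = {f \<in> {a, b}. \<phi> f = c}"
    unfolding assms(1)[symmetric] by auto
  show ?thesis unfolding colour_degree_def eq Collect_insert using assms(2) by simp
qed

lemma pair_colouring_same_pair:
  assumes "simple_graph G" "pair_colouring G F \<phi>" "{u, v} \<in> edges G - edges F"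
    "{e \<in> edges F. u \<in> e} = {a, b}" "a \<noteq> b" "{e \<in> edges F. v \<in> e} = {c, d}" "c \<noteq> d"
  shows "same_pair (\<phi> a) (\<phi> b) (\<phi> c) (\<phi> d)"
  unfolding same_pair_iff
proof
  fix k
  have "u \<in> verts G" using assms(1,3) simple_graph_pairD by fastforce
  then have "colour_degree F \<phi> k u \<le> 1" "colour_degree F \<phi> k u = colour_degree F \<phi> k v"
    using assms(2,3) unfolding pair_colouring_def by blast+
  then show "of_bool (\<phi> a = k) + of_bool (\<phi> b = k) \<le> (1::nat) \<and>
      of_bool (\<phi> a = k) + of_bool (\<phi> b = k) = (of_bool (\<phi> c = k) + of_bool (\<phi> d = k) :: nat)"
    using colour_degree_star[OF assms(4,5)] colour_degree_star[OF assms(6,7)] by metis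
qed

lemma petersen_star:
  "{e \<in> edges petersen. Base 0 \<in> e} = {{Base 0, Base 1}, {Base 4, Base 0}, {Base 0, Base 5}}"
  "{e \<in> edges petersen. Base 1 \<in> e} = {{Base 1, Base 2}, {Base 0, Base 1}, {Base 1, Base 6}}"
  "{e \<in> edges petersen. Base 2 \<in> e} = {{Base 2, Base 3}, {Base 1, Base 2}, {Base 2, Base 7}}"
  "{e \<in> edges petersen. Base 3 \<in> e} = {{Base 3, Base 4}, {Base 2, Base 3}, {Base 3, Base 8}}"
  "{e \<in> edges petersen. Base 4 \<in> e} = {{Base 4, Base 0}, {Base 3, Base 4}, {Base 4, Base 9}}"
  "{e \<in> edges petersen. Base 5 \<in> e} = {{Base 5, Base 7}, {Base 8, Base 5}, {Base 0, Base 5}}"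
  "{e \<in> edges petersen. Base 6 \<in> e} = {{Base 6, Base 8}, {Base 9, Base 6}, {Base 1, Base 6}}"
  "{e \<in> edges petersen. Base 7 \<in> e} = {{Base 7, Base 9}, {Base 5, Base 7}, {Base 2, Base 7}}"
  "{e \<in> edges petersen. Base 8 \<in> e} = {{Base 8, Base 5}, {Base 6, Base 8}, {Base 3, Base 8}}"
  "{e \<in> edges petersen. Base 9 \<in> e} = {{Base 9, Base 6}, {Base 7, Base 9}, {Base 4, Base 9}}"
  unfolding petersen_edges Collect_insert by (simp_all, simp_all add: insert_commute)

lemma cubic_petersen: "cubic petersen"
proof -
  have "\<forall>v\<in>verts petersen. card {e \<in> edges petersen. v \<in> e} = 3"
    unfolding petersen_verts ball_simps petersen_star by (simp add: doubleton_eq_iff)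
  then show ?thesis using simple_petersen by (simp add: cubic_def regular_def degree_def)
qed

text \<open>The factor consisting of the outer and the inner 5-circuit, with one premise per spoke.
  Here \<open>oi\<close> is the edge from i to i + 1 and \<open>ni\<close> the edge from the inner
  neighbour of i to that of i + 2, modulo 5.\<close>

lemma petersen_no_colours_spokes:
  assumes "same_pair o0 o4 n0 n3" "same_pair o1 o0 n1 n4" "same_pair o2 o1 n2 n0"
    "same_pair o3 o2 n3 n1" "same_pair o4 o3 n4 n2"
  shows False
  using assms unfolding same_pair_def by (elim conjE disjE; clarify)

text \<open>The other case up to rotation: the non-factor edges are the spoke at 0 and the edges
  numbered \<open>o1\<close>, \<open>o3\<close>, \<open>n1\<close>, \<open>n2\<close>, one premise
  for each.\<close>

lemma petersen_no_colours_one_spoke: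
  assumes "same_pair o0 o4 n0 n3" "same_pair o0 s1 o2 s2" "same_pair o2 s3 o4 s4"
    "same_pair n4 s1 n3 s3" "same_pair n0 s2 n4 s4"
  shows False
  using assms unfolding same_pair_def by (elim conjE disjE; clarify)

text \<open>\<open>Oi\<close>, \<open>Si\<close>, \<open>Ni\<close> say whether the outer edges, spokes and inner edges lie in the factor;
  the small letters are their colours.\<close>

lemma petersen_no_colours:
  fixes o0 o1 o2 o3 o4 s0 s1 s2 s3 s4 n0 n1 n2 n3 n4 :: nat
  assumes
    "\<not> O0 \<and> O4 \<and> S0 \<or> O0 \<and> \<not> O4 \<and> S0 \<or> O0 \<and> O4 \<and> \<not> S0"
    "\<not> O1 \<and> O0 \<and> S1 \<or> O1 \<and> \<not> O0 \<and> S1 \<or> O1 \<and> O0 \<and> \<not> S1"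
    "\<not> O2 \<and> O1 \<and> S2 \<or> O2 \<and> \<not> O1 \<and> S2 \<or> O2 \<and> O1 \<and> \<not> S2"
    "\<not> O3 \<and> O2 \<and> S3 \<or> O3 \<and> \<not> O2 \<and> S3 \<or> O3 \<and> O2 \<and> \<not> S3"
    "\<not> O4 \<and> O3 \<and> S4 \<or> O4 \<and> \<not> O3 \<and> S4 \<or> O4 \<and> O3 \<and> \<not> S4"
    "\<not> N0 \<and> N3 \<and> S0 \<or> N0 \<and> \<not> N3 \<and> S0 \<or> N0 \<and> N3 \<and> \<not> S0"
    "\<not> N1 \<and> N4 \<and> S1 \<or> N1 \<and> \<not> N4 \<and> S1 \<or> N1 \<and> N4 \<and> \<not> S1"
    "\<not> N2 \<and> N0 \<and> S2 \<or> N2 \<and> \<not> N0 \<and> S2 \<or> N2 \<and> N0 \<and> \<not> S2"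
    "\<not> N3 \<and> N1 \<and> S3 \<or> N3 \<and> \<not> N1 \<and> S3 \<or> N3 \<and> N1 \<and> \<not> S3"
    "\<not> N4 \<and> N2 \<and> S4 \<or> N4 \<and> \<not> N2 \<and> S4 \<or> N4 \<and> N2 \<and> \<not> S4"
    and
    "\<not> S0 \<Longrightarrow> same_pair o0 o4 n0 n3" "\<not> S1 \<Longrightarrow> same_pair o1 o0 n1 n4" "\<not> S2 \<Longrightarrow> same_pair o2 o1 n2 n0"
    "\<not> S3 \<Longrightarrow> same_pair o3 o2 n3 n1" "\<not> S4 \<Longrightarrow> same_pair o4 o3 n4 n2"
    "\<not> O0 \<Longrightarrow> same_pair o4 s0 o1 s1" "\<not> O1 \<Longrightarrow> same_pair o0 s1 o2 s2" "\<not> O2 \<Longrightarrow> same_pair o1 s2 o3 s3"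
    "\<not> O3 \<Longrightarrow> same_pair o2 s3 o4 s4" "\<not> O4 \<Longrightarrow> same_pair o3 s4 o0 s0"
    "\<not> N0 \<Longrightarrow> same_pair n3 s0 n2 s2" "\<not> N1 \<Longrightarrow> same_pair n4 s1 n3 s3" "\<not> N2 \<Longrightarrow> same_pair n0 s2 n4 s4"
    "\<not> N3 \<Longrightarrow> same_pair n1 s3 n0 s0" "\<not> N4 \<Longrightarrow> same_pair n2 s4 n1 s1"
  shows False
proof -
  \<comment> \<open>The edges outside the factor form a perfect matching. It consists either of all
    five spokes or of one spoke and four further edges that this spoke determines; the five
    rotations are treated separately.\<close>
  have "\<not> S0 \<or> \<not> S1 \<or> \<not> S2 \<or> \<not> S3 \<or> \<not> S4" using assms(1-10) by argo
  moreover have "S0 \<or> S1 \<or> S2 \<or> S3 \<or> S4"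
    using petersen_no_colours_spokes[of o0 o4 n0 n3 o1 n1 n4 o2 n2 o3] assms(11-15) by blast
  moreover have False if "\<not> S0" "S0 \<or> S1 \<or> S2 \<or> S3 \<or> S4"
  proof -
    have "\<not> O1 \<and> \<not> O3 \<and> \<not> N1 \<and> \<not> N2" using assms(1-10) that by argo
    then show False using petersen_no_colours_one_spoke[of o0 o4 n0 n3 s1 o2 s2 s3 s4 n4] assms(11-25) that(1) by blast
  qed
  moreover have False if "\<not> S1" "S0 \<or> S1 \<or> S2 \<or> S3 \<or> S4"
  proof -
    have "\<not> O2 \<and> \<not> O4 \<and> \<not> N2 \<and> \<not> N3" using assms(1-10) that by argo
    then show False using petersen_no_colours_one_spoke[of o1 o0 n1 n4 s2 o3 s3 s4 s0 n0]
        assms(11-25) that(1) by blast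
  qed
  moreover have False if "\<not> S2" "S0 \<or> S1 \<or> S2 \<or> S3 \<or> S4"
  proof -
    have "\<not> O3 \<and> \<not> O0 \<and> \<not> N3 \<and> \<not> N4" using assms(1-10) that by argo
    then show False using petersen_no_colours_one_spoke[of o2 o1 n2 n0 s3 o4 s4 s0 s1 n1]
        assms(11-25) that(1) by blast
  qed
  moreover have False if "\<not> S3" "S0 \<or> S1 \<or> S2 \<or> S3 \<or> S4"
  proof -
    have "\<not> O4 \<and> \<not> O1 \<and> \<not> N4 \<and> \<not> N0" using assms(1-10) that by argo
    then show False using petersen_no_colours_one_spoke[of o3 o2 n3 n1 s4 o0 s0 s1 s2 n2]
        assms(11-25) that(1) by blast
  qed
  moreover have False if "\<not> S4" "S0 \<or> S1 \<or> S2 \<or> S3 \<or> S4"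
  proof -
    have "\<not> O0 \<and> \<not> O2 \<and> \<not> N0 \<and> \<not> N1" using assms(1-10) that by argo
    then show False using petersen_no_colours_one_spoke[of o4 o3 n4 n2 s0 o1 s1 s2 s3 n3]
        assms(11-25) that(1) by blast
  qed
  ultimately show False by blast
qed

lemma non_factor_edge_same_pair:
  assumes G: "simple_graph G" and F: "two_factor G F" and c: "pair_colouring G F \<phi>"
    and n: "{u, v} \<in> edges G" "{u, v} \<notin> edges F"
    and u: "{e \<in> edges G. u \<in> e} = {a, b, {u, v}}" "distinct [a, b, {u, v}]"
    and v: "{e \<in> edges G. v \<in> e} = {c, d, {u, v}}" "distinct [c, d, {u, v}]"
  shows "same_pair (\<phi> a) (\<phi> b) (\<phi> c) (\<phi> d)"
proof -
  have uv: "u \<in> verts G" "v \<in> verts G" using simple_graph_pairD[OF G n(1)] by auto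
  have no: "{u, v} \<notin> {e \<in> edges F. u \<in> e}" "{u, v} \<notin> {e \<in> edges F. v \<in> e}" using n by auto
  have "{e \<in> edges F. u \<in> e} = {a, b}"
    using two_factor_star[OF F uv(1) u] no(1) by (elim disjE conjE) simp_all
  moreover have "{e \<in> edges F. v \<in> e} = {c, d}"
    using two_factor_star[OF F uv(2) v] no(2) by (elim disjE conjE) simp_all
  ultimately show ?thesis using n u(2) v(2) by (intro pair_colouring_same_pair[OF G c]) auto
qed

text \<open>\<open>petersen_no_colours\<close> receives one premise per vertex, from its degree in
  \<open>F\<close>, and one per edge, from the colouring condition in case the edge lies outside
  \<open>F\<close>.\<close>

lemma petersen_no_pair_colouring:
  fixes \<phi> :: "vertex set \<Rightarrow> nat"
  assumes F: "two_factor petersen F"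
  shows "\<not> pair_colouring petersen F \<phi>"
proof
  assume c: "pair_colouring petersen F \<phi>"
  have star: "a \<notin> edges F \<and> b \<in> edges F \<and> c \<in> edges F \<or> a \<in> edges F \<and> b \<notin> edges F \<and> c \<in> edges F \<or>
      a \<in> edges F \<and> b \<in> edges F \<and> c \<notin> edges F"
    if "{e \<in> edges petersen. Base i \<in> e} = {a, b, c}" "distinct [a, b, c]" "i < 10" for i a b c
  proof -
    have v: "Base i \<in> verts petersen" using that(3) by (simp add: Base_in_petersen)
    have mem: "x \<in> edges F \<and> y \<in> edges F" if "{e \<in> edges F. Base i \<in> e} = {x, y}" for x y
      using that by auto
    from two_factor_star[OF F v that(1,2)] show ?thesis
    proof (elim disjE conjE)
      assume "a \<notin> edges F" "{e \<in> edges F. Base i \<in> e} = {b, c}"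
      then show ?thesis using mem[of b c] by blast
    next
      assume "b \<notin> edges F" "{e \<in> edges F. Base i \<in> e} = {a, c}"
      then show ?thesis using mem[of a c] by blast
    next
      assume "c \<notin> edges F" "{e \<in> edges F. Base i \<in> e} = {a, b}"
      then show ?thesis using mem[of a b] by blast
    qed
  qed
  note pair = non_factor_edge_same_pair[OF simple_petersen F c]
  show False
  proof (rule petersen_no_colours)
    show "{Base 0, Base 1} \<notin> edges F \<and> {Base 4, Base 0} \<in> edges F \<and> {Base 0, Base 5} \<in> edges F \<or>
        {Base 0, Base 1} \<in> edges F \<and> {Base 4, Base 0} \<notin> edges F \<and> {Base 0, Base 5} \<in> edges F \<or>
        {Base 0, Base 1} \<in> edges F \<and> {Base 4, Base 0} \<in> edges F \<and> {Base 0, Base 5} \<notin> edges F"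
      using star[OF petersen_star(1)] by (simp add: doubleton_eq_iff)
    show "{Base 1, Base 2} \<notin> edges F \<and> {Base 0, Base 1} \<in> edges F \<and> {Base 1, Base 6} \<in> edges F \<or>
        {Base 1, Base 2} \<in> edges F \<and> {Base 0, Base 1} \<notin> edges F \<and> {Base 1, Base 6} \<in> edges F \<or>
        {Base 1, Base 2} \<in> edges F \<and> {Base 0, Base 1} \<in> edges F \<and> {Base 1, Base 6} \<notin> edges F"
      using star[OF petersen_star(2)] by (simp add: doubleton_eq_iff)
    show "{Base 2, Base 3} \<notin> edges F \<and> {Base 1, Base 2} \<in> edges F \<and> {Base 2, Base 7} \<in> edges F \<or>
        {Base 2, Base 3} \<in> edges F \<and> {Base 1, Base 2} \<notin> edges F \<and> {Base 2, Base 7} \<in> edges F \<or>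
        {Base 2, Base 3} \<in> edges F \<and> {Base 1, Base 2} \<in> edges F \<and> {Base 2, Base 7} \<notin> edges F"
      using star[OF petersen_star(3)] by (simp add: doubleton_eq_iff)
    show "{Base 3, Base 4} \<notin> edges F \<and> {Base 2, Base 3} \<in> edges F \<and> {Base 3, Base 8} \<in> edges F \<or>
        {Base 3, Base 4} \<in> edges F \<and> {Base 2, Base 3} \<notin> edges F \<and> {Base 3, Base 8} \<in> edges F \<or>
        {Base 3, Base 4} \<in> edges F \<and> {Base 2, Base 3} \<in> edges F \<and> {Base 3, Base 8} \<notin> edges F"
      using star[OF petersen_star(4)] by (simp add: doubleton_eq_iff)
    show "{Base 4, Base 0} \<notin> edges F \<and> {Base 3, Base 4} \<in> edges F \<and> {Base 4, Base 9} \<in> edges F \<or>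
        {Base 4, Base 0} \<in> edges F \<and> {Base 3, Base 4} \<notin> edges F \<and> {Base 4, Base 9} \<in> edges F \<or>
        {Base 4, Base 0} \<in> edges F \<and> {Base 3, Base 4} \<in> edges F \<and> {Base 4, Base 9} \<notin> edges F"
      using star[OF petersen_star(5)] by (simp add: doubleton_eq_iff)
    show "{Base 5, Base 7} \<notin> edges F \<and> {Base 8, Base 5} \<in> edges F \<and> {Base 0, Base 5} \<in> edges F \<or>
        {Base 5, Base 7} \<in> edges F \<and> {Base 8, Base 5} \<notin> edges F \<and> {Base 0, Base 5} \<in> edges F \<or>
        {Base 5, Base 7} \<in> edges F \<and> {Base 8, Base 5} \<in> edges F \<and> {Base 0, Base 5} \<notin> edges F"
      using star[OF petersen_star(6)] by (simp add: doubleton_eq_iff)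
    show "{Base 6, Base 8} \<notin> edges F \<and> {Base 9, Base 6} \<in> edges F \<and> {Base 1, Base 6} \<in> edges F \<or>
        {Base 6, Base 8} \<in> edges F \<and> {Base 9, Base 6} \<notin> edges F \<and> {Base 1, Base 6} \<in> edges F \<or>
        {Base 6, Base 8} \<in> edges F \<and> {Base 9, Base 6} \<in> edges F \<and> {Base 1, Base 6} \<notin> edges F"
      using star[OF petersen_star(7)] by (simp add: doubleton_eq_iff)
    show "{Base 7, Base 9} \<notin> edges F \<and> {Base 5, Base 7} \<in> edges F \<and> {Base 2, Base 7} \<in> edges F \<or>
        {Base 7, Base 9} \<in> edges F \<and> {Base 5, Base 7} \<notin> edges F \<and> {Base 2, Base 7} \<in> edges F \<or>
        {Base 7, Base 9} \<in> edges F \<and> {Base 5, Base 7} \<in> edges F \<and> {Base 2, Base 7} \<notin> edges F"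
      using star[OF petersen_star(8)] by (simp add: doubleton_eq_iff)
    show "{Base 8, Base 5} \<notin> edges F \<and> {Base 6, Base 8} \<in> edges F \<and> {Base 3, Base 8} \<in> edges F \<or>
        {Base 8, Base 5} \<in> edges F \<and> {Base 6, Base 8} \<notin> edges F \<and> {Base 3, Base 8} \<in> edges F \<or>
        {Base 8, Base 5} \<in> edges F \<and> {Base 6, Base 8} \<in> edges F \<and> {Base 3, Base 8} \<notin> edges F"
      using star[OF petersen_star(9)] by (simp add: doubleton_eq_iff)
    show "{Base 9, Base 6} \<notin> edges F \<and> {Base 7, Base 9} \<in> edges F \<and> {Base 4, Base 9} \<in> edges F \<or>
        {Base 9, Base 6} \<in> edges F \<and> {Base 7, Base 9} \<notin> edges F \<and> {Base 4, Base 9} \<in> edges F \<or>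
        {Base 9, Base 6} \<in> edges F \<and> {Base 7, Base 9} \<in> edges F \<and> {Base 4, Base 9} \<notin> edges F"
      using star[OF petersen_star(10)] by (simp add: doubleton_eq_iff)
  next
    assume "{Base 0, Base 5} \<notin> edges F"
    then show "same_pair (\<phi> {Base 0, Base 1}) (\<phi> {Base 4, Base 0}) (\<phi> {Base 5, Base 7}) (\<phi> {Base 8, Base 5})"
      by (intro pair[of "Base 0" "Base 5"])
        ((simp only: petersen_star insert_commute; fail | simp add: petersen_edges doubleton_eq_iff; fail)+)
  next
    assume "{Base 1, Base 6} \<notin> edges F"
    then show "same_pair (\<phi> {Base 1, Base 2}) (\<phi> {Base 0, Base 1}) (\<phi> {Base 6, Base 8}) (\<phi> {Base 9, Base 6})"
      by (intro pair[of "Base 1" "Base 6"])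
        ((simp only: petersen_star insert_commute; fail | simp add: petersen_edges doubleton_eq_iff; fail)+)
  next
    assume "{Base 2, Base 7} \<notin> edges F"
    then show "same_pair (\<phi> {Base 2, Base 3}) (\<phi> {Base 1, Base 2}) (\<phi> {Base 7, Base 9}) (\<phi> {Base 5, Base 7})"
      by (intro pair[of "Base 2" "Base 7"])
        ((simp only: petersen_star insert_commute; fail | simp add: petersen_edges doubleton_eq_iff; fail)+)
  next
    assume "{Base 3, Base 8} \<notin> edges F"
    then show "same_pair (\<phi> {Base 3, Base 4}) (\<phi> {Base 2, Base 3}) (\<phi> {Base 8, Base 5}) (\<phi> {Base 6, Base 8})"
      by (intro pair[of "Base 3" "Base 8"])
        ((simp only: petersen_star insert_commute; fail | simp add: petersen_edges doubleton_eq_iff; fail)+)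
  next
    assume "{Base 4, Base 9} \<notin> edges F"
    then show "same_pair (\<phi> {Base 4, Base 0}) (\<phi> {Base 3, Base 4}) (\<phi> {Base 9, Base 6}) (\<phi> {Base 7, Base 9})"
      by (intro pair[of "Base 4" "Base 9"])
        ((simp only: petersen_star insert_commute; fail | simp add: petersen_edges doubleton_eq_iff; fail)+)
  next
    assume "{Base 0, Base 1} \<notin> edges F"
    then show "same_pair (\<phi> {Base 4, Base 0}) (\<phi> {Base 0, Base 5}) (\<phi> {Base 1, Base 2}) (\<phi> {Base 1, Base 6})"
      by (intro pair[of "Base 0" "Base 1"])
        ((simp only: petersen_star insert_commute; fail | simp add: petersen_edges doubleton_eq_iff; fail)+)
  next
    assume "{Base 1, Base 2} \<notin> edges F"
    then show "same_pair (\<phi> {Base 0, Base 1}) (\<phi> {Base 1, Base 6}) (\<phi> {Base 2, Base 3}) (\<phi> {Base 2, Base 7})"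
      by (intro pair[of "Base 1" "Base 2"])
        ((simp only: petersen_star insert_commute; fail | simp add: petersen_edges doubleton_eq_iff; fail)+)
  next
    assume "{Base 2, Base 3} \<notin> edges F"
    then show "same_pair (\<phi> {Base 1, Base 2}) (\<phi> {Base 2, Base 7}) (\<phi> {Base 3, Base 4}) (\<phi> {Base 3, Base 8})"
      by (intro pair[of "Base 2" "Base 3"])
        ((simp only: petersen_star insert_commute; fail | simp add: petersen_edges doubleton_eq_iff; fail)+)
  next
    assume "{Base 3, Base 4} \<notin> edges F"
    then show "same_pair (\<phi> {Base 2, Base 3}) (\<phi> {Base 3, Base 8}) (\<phi> {Base 4, Base 0}) (\<phi> {Base 4, Base 9})"
      by (intro pair[of "Base 3" "Base 4"])
        ((simp only: petersen_star insert_commute; fail | simp add: petersen_edges doubleton_eq_iff; fail)+)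
  next
    assume "{Base 4, Base 0} \<notin> edges F"
    then show "same_pair (\<phi> {Base 3, Base 4}) (\<phi> {Base 4, Base 9}) (\<phi> {Base 0, Base 1}) (\<phi> {Base 0, Base 5})"
      by (intro pair[of "Base 4" "Base 0"])
        ((simp only: petersen_star insert_commute; fail | simp add: petersen_edges doubleton_eq_iff; fail)+)
  next
    assume "{Base 5, Base 7} \<notin> edges F"
    then show "same_pair (\<phi> {Base 8, Base 5}) (\<phi> {Base 0, Base 5}) (\<phi> {Base 7, Base 9}) (\<phi> {Base 2, Base 7})"
      by (intro pair[of "Base 5" "Base 7"])
        ((simp only: petersen_star insert_commute; fail | simp add: petersen_edges doubleton_eq_iff; fail)+)
  next
    assume "{Base 6, Base 8} \<notin> edges F"
    then show "same_pair (\<phi> {Base 9, Base 6}) (\<phi> {Base 1, Base 6}) (\<phi> {Base 8, Base 5}) (\<phi> {Base 3, Base 8})"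
      by (intro pair[of "Base 6" "Base 8"])
        ((simp only: petersen_star insert_commute; fail | simp add: petersen_edges doubleton_eq_iff; fail)+)
  next
    assume "{Base 7, Base 9} \<notin> edges F"
    then show "same_pair (\<phi> {Base 5, Base 7}) (\<phi> {Base 2, Base 7}) (\<phi> {Base 9, Base 6}) (\<phi> {Base 4, Base 9})"
      by (intro pair[of "Base 7" "Base 9"])
        ((simp only: petersen_star insert_commute; fail | simp add: petersen_edges doubleton_eq_iff; fail)+)
  next
    assume "{Base 8, Base 5} \<notin> edges F"
    then show "same_pair (\<phi> {Base 6, Base 8}) (\<phi> {Base 3, Base 8}) (\<phi> {Base 5, Base 7}) (\<phi> {Base 0, Base 5})"
      by (intro pair[of "Base 8" "Base 5"])
        ((simp only: petersen_star insert_commute; fail | simp add: petersen_edges doubleton_eq_iff; fail)+)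
  next
    assume "{Base 9, Base 6} \<notin> edges F"
    then show "same_pair (\<phi> {Base 7, Base 9}) (\<phi> {Base 4, Base 9}) (\<phi> {Base 6, Base 8}) (\<phi> {Base 1, Base 6})"
      by (intro pair[of "Base 9" "Base 6"])
        ((simp only: petersen_star insert_commute; fail | simp add: petersen_edges doubleton_eq_iff; fail)+)
  qed
qed

lemma petersen_good:
  assumes "permutation_two_factor petersen F"
  shows "good petersen F"
  using assms petersen_no_pair_colouring petersen_cut cubic_petersen card_verts_petersen
  unfolding good_def permutation_two_factor_def by auto

section \<open>A permutation 2-factor of the Petersen graph\<close>

definition petersen_factor :: "vertex ugraph" where
  "petersen_factor = \<lparr>verts = verts petersen, edges =
     {{Base 0, Base 1}, {Base 1, Base 2}, {Base 2, Base 3}, {Base 3, Base 4}, {Base 4, Base 0},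
      {Base 5, Base 7}, {Base 7, Base 9}, {Base 9, Base 6}, {Base 6, Base 8}, {Base 8, Base 5}}\<rparr>"

lemma petersen_factor_star:
  "{e \<in> edges petersen_factor. Base 0 \<in> e} = {{Base 0, Base 1}, {Base 4, Base 0}}"
  "{e \<in> edges petersen_factor. Base 1 \<in> e} = {{Base 1, Base 2}, {Base 0, Base 1}}"
  "{e \<in> edges petersen_factor. Base 2 \<in> e} = {{Base 2, Base 3}, {Base 1, Base 2}}"
  "{e \<in> edges petersen_factor. Base 3 \<in> e} = {{Base 3, Base 4}, {Base 2, Base 3}}"
  "{e \<in> edges petersen_factor. Base 4 \<in> e} = {{Base 4, Base 0}, {Base 3, Base 4}}"
  "{e \<in> edges petersen_factor. Base 5 \<in> e} = {{Base 5, Base 7}, {Base 8, Base 5}}"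
  "{e \<in> edges petersen_factor. Base 6 \<in> e} = {{Base 6, Base 8}, {Base 9, Base 6}}"
  "{e \<in> edges petersen_factor. Base 7 \<in> e} = {{Base 7, Base 9}, {Base 5, Base 7}}"
  "{e \<in> edges petersen_factor. Base 8 \<in> e} = {{Base 8, Base 5}, {Base 6, Base 8}}"
  "{e \<in> edges petersen_factor. Base 9 \<in> e} = {{Base 9, Base 6}, {Base 7, Base 9}}"
  unfolding petersen_factor_def ugraph.simps Collect_insert by (simp_all, simp_all add: insert_commute)

text \<open>This makes stage 0 of the recursion inhabited. Membership in a closed set is passed
  along four edges of each 5-circuit, which gives minimality.\<close>

lemma petersen_factor: "permutation_two_factor petersen petersen_factor"
proof (rule permutation_two_factorI[OF simple_petersen])
  have "\<forall>v\<in>verts petersen. card {e \<in> edges petersen_factor. v \<in> e} = 2"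
    unfolding petersen_verts ball_simps petersen_factor_star by (simp add: doubleton_eq_iff)
  moreover have "verts petersen_factor = verts petersen" by (simp add: petersen_factor_def)
  moreover have sub: "edges petersen_factor \<subseteq> edges petersen"
    unfolding petersen_factor_def petersen_edges by auto
  ultimately show "two_factor petersen petersen_factor"
    using simple_petersen
    by (auto simp: two_factor_def subgraph_def regular_def degree_def simple_graph_def subset_iff)
  let ?K = "{Base 0, Base 1, Base 2, Base 3, Base 4}" and ?L = "{Base 5, Base 6, Base 7, Base 8, Base 9}"
  have "A = ?K" if ne: "A \<noteq> {}" and cl: "\<forall>e\<in>edges petersen_factor. \<not> crosses A e" and sub: "A \<subseteq> ?K" for A
  proof -
    have mem: "u \<in> A \<longleftrightarrow> v \<in> A" if "{u, v} \<in> edges petersen_factor" for u v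
      using cl[rule_format, OF that] by simp
    have "Base 0 \<in> A \<longleftrightarrow> Base 1 \<in> A" "Base 1 \<in> A \<longleftrightarrow> Base 2 \<in> A" "Base 2 \<in> A \<longleftrightarrow> Base 3 \<in> A"
      "Base 3 \<in> A \<longleftrightarrow> Base 4 \<in> A"
      by (rule mem, simp add: petersen_factor_def)+
    then have "?K \<subseteq> A \<or> ?K \<inter> A = {}" by (cases "Base 0 \<in> A") simp_all
    then show ?thesis using ne sub by (meson disjoint_iff ex_in_conv subset_antisym subsetD)
  qed
  moreover have "A = ?L" if ne: "A \<noteq> {}" and cl: "\<forall>e\<in>edges petersen_factor. \<not> crosses A e" and sub: "A \<subseteq> ?L" for A
  proof -
    have mem: "u \<in> A \<longleftrightarrow> v \<in> A" if "{u, v} \<in> edges petersen_factor" for u v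
      using cl[rule_format, OF that] by simp
    have "Base 5 \<in> A \<longleftrightarrow> Base 7 \<in> A" "Base 7 \<in> A \<longleftrightarrow> Base 9 \<in> A" "Base 9 \<in> A \<longleftrightarrow> Base 6 \<in> A"
      "Base 6 \<in> A \<longleftrightarrow> Base 8 \<in> A"
      by (rule mem, simp add: petersen_factor_def)+
    then have "?L \<subseteq> A \<or> ?L \<inter> A = {}" by (cases "Base 5 \<in> A") simp_all
    then show ?thesis using ne sub by (meson disjoint_iff ex_in_conv subset_antisym subsetD)
  qed
  moreover have "\<forall>e\<in>edges petersen_factor. \<not> crosses ?K e"
    by (simp add: petersen_factor_def)
  moreover have "e \<in> edges petersen_factor \<or> crosses ?K e" if "e \<in> edges petersen" for e
    using that unfolding petersen_edges insert_iff by (elim disjE) (simp_all add: petersen_factor_def)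
  ultimately show "halves petersen petersen_factor ?K ?L"
    unfolding halves_def petersen_verts by (intro conjI) (simp_all, blast+)
qed

section \<open>One part of the construction\<close>

lemma edge_degree_three:
  assumes G: "cubic G" and v: "v \<in> verts G" and s: "S \<subseteq> {e \<in> edges G. v \<in> e}" "card S = 3"
  shows "{e \<in> edges G. v \<in> e} = S"
proof -
  have "card {e \<in> edges G. v \<in> e} = 3" using G v by (simp add: cubic_def regular_def degree_def)
  then show ?thesis using s by (metis card_gt_0_iff card_subset_eq zero_less_numeral)
qed

lemma two_factor_degree_two:
  assumes F: "two_factor G F" and v: "v \<in> verts G" and s: "S \<subseteq> {e \<in> edges F. v \<in> e}" "card S = 2"
  shows "{e \<in> edges F. v \<in> e} = S"
proof -
  have "card {e \<in> edges F. v \<in> e} = 2" using F v by (simp add: two_factor_def regular_def degree_def)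
  then show ?thesis using s by (metis card_gt_0_iff card_subset_eq zero_less_numeral)
qed

text \<open>All degrees in \<open>F\<close> are 2, so incidence counting makes every cut of
  \<open>F\<close> even. This replaces any explicit handling of paths: a set left by at most two
  known edges is left by both or by neither, and in the latter case it is empty.\<close>

lemma halves_cut:
  assumes F: "two_factor G F" and h: "halves G F K L" and B: "B \<subseteq> K \<or> B \<subseteq> L" "B \<noteq> K" "B \<noteq> L"
  shows "even (cut (edges F) B)" "cut (edges F) B = 0 \<Longrightarrow> B = {}"
proof -
  have sF: "simple_graph F" and r: "regular 2 F" and vF: "verts F = verts G"
    using F by (auto simp: two_factor_def subgraph_def)
  have "B \<subseteq> verts F" using B(1) h vF by (auto simp: halves_def)
  moreover from this have "(\<Sum>v\<in>B. degree F v) = 2 * card B" using r by (auto simp: regular_def subset_iff)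
  ultimately have "2 * card B = cut (edges F) B + 2 * card {e \<in> edges F. e \<subseteq> B}"
    using sum_degrees[OF sF] by metis
  then show "even (cut (edges F) B)" by presburger
  assume "cut (edges F) B = 0"
  then have "\<forall>e\<in>edges F. \<not> crosses B e"
    using simple_graph_finite_edges[OF sF] by (auto simp: cut_def)
  then show "B = {}" using h B unfolding halves_def by metis
qed

lemma even_of_bool_6:
  "even (of_bool p1 + of_bool p2 + of_bool p3 + of_bool p4 + of_bool p5 + of_bool p6 :: nat) \<longleftrightarrow>
    (p1 \<longleftrightarrow> (p2 \<longleftrightarrow> (p3 \<longleftrightarrow> (p4 \<longleftrightarrow> (p5 \<longleftrightarrow> p6)))))"
  by simp

text \<open>If \<open>a1\<close> differs from \<open>a2\<close> and \<open>a3\<close>, each of these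
  three distinct colours must occur an odd number of times among \<open>a4\<close>,
  \<open>a5\<close>, \<open>a6\<close>, hence exactly once. If \<open>a1 = a2\<close>, parity places
  \<open>a3\<close> among \<open>a4\<close>, \<open>a5\<close>, \<open>a6\<close> and makes the
  other two equal; the assumption \<open>n2\<close> excludes \<open>a3\<close> on only one of
  \<open>a4\<close>, \<open>a5\<close>. The case \<open>a1 = a3\<close> is symmetric.\<close>

lemma even_colours:
  assumes ev: "\<And>c. even (of_bool (a1 = c) + of_bool (a2 = c) + of_bool (a3 = c) + of_bool (a4 = c) +
     of_bool (a5 = c) + of_bool (a6 = c) :: nat)" and ne: "a2 \<noteq> a3"
    and n2: "a1 = a2 \<Longrightarrow> \<not> same_pair a3 a6 a4 a5" and n3: "a1 = a3 \<Longrightarrow> \<not> same_pair a2 a6 a4 a5"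
  shows "(a1 = a2 \<and> a6 = a3 \<or> a1 = a3 \<and> a6 = a2) \<and> a4 = a5 \<or>
   a1 \<noteq> a2 \<and> a1 \<noteq> a3 \<and> a4 \<noteq> a5 \<and> a4 \<noteq> a6 \<and> a5 \<noteq> a6 \<and> {a4, a5, a6} = {a1, a2, a3}"
proof -
  note e = ev[unfolded even_of_bool_6]
  show ?thesis
  proof (cases "a1 = a2 \<or> a1 = a3")
    case True
    then show ?thesis using e[of a1] e[of a2] e[of a3] e[of a4] e[of a5] e[of a6] ne n2 n3 unfolding same_pair_def
      by (smt (verit))
  next
    case False
    then have "(a4 = a1 \<and> a5 = a2 \<and> a6 = a3) \<or> (a4 = a1 \<and> a5 = a3 \<and> a6 = a2) \<or> (a4 = a2 \<and> a5 = a1 \<and> a6 = a3) \<or>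
      (a4 = a2 \<and> a5 = a3 \<and> a6 = a1) \<or> (a4 = a3 \<and> a5 = a1 \<and> a6 = a2) \<or> (a4 = a3 \<and> a5 = a2 \<and> a6 = a1)"
      using e[of a1] e[of a2] e[of a3] ne by (smt (verit))
    then show ?thesis using False ne by (elim disjE conjE) (simp_all add: insert_commute eq_commute)
  qed
qed
declare One_nat_def [simp del]

locale labelled =
  fixes Q F :: "'a ugraph" and x z :: "nat \<Rightarrow> 'a"
  assumes good: "good Q F" and lab: "labelling Q F x z"
begin

lemma cubic: "cubic Q" and simple: "simple_graph Q" and factor: "two_factor Q F"
  and simple_F: "simple_graph F" and verts_F: "verts F = verts Q" and edges_F: "edges F \<subseteq> edges Q"
  using good
  by (auto simp: good_def cubic_def permutation_two_factor_def two_factor_def subgraph_def)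

lemma finite_edges: "finite (edges Q)" "finite (edges F)"
  using simple simple_F simple_graph_finite_edges by auto

lemma finite_verts: "finite (verts Q)"
  using simple by (simp add: simple_graph_def)

lemma circuits:
  obtains K L where "halves Q F K L" "x 1 \<in> K" "x 2 \<in> K" "z 2 \<in> K" "x 6 \<in> K"
    "x 4 \<in> L" "z 1 \<in> L" "x 5 \<in> L" "distinct [x 1, x 2, z 2, x 6]" "distinct [x 4, z 1, x 5]"
    "{x 1, x 2} \<in> edges F" "{x 2, z 2} \<in> edges F" "{z 2, x 6} \<in> edges F"
    "{z 1, x 4} \<in> edges F" "{z 1, x 5} \<in> edges F" "{z 1, z 2} \<in> edges Q"
proof -
  obtain C1 C2 where C: "C1 \<noteq> C2" "is_component C1 F" "is_component C2 F"
    and d: "distinct [x 1, x 2, z 2, x 6]" "distinct [x 4, z 1, x 5]"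
    and e: "{x 1, x 2} \<in> edges C1" "{x 2, z 2} \<in> edges C1" "{z 2, x 6} \<in> edges C1"
      "{x 4, z 1} \<in> edges C2" "{z 1, x 5} \<in> edges C2" "{z 1, z 2} \<in> edges Q"
    using lab unfolding labelling_def by blast
  have "simple_graph C1" "simple_graph C2" "edges C1 \<subseteq> edges F" "edges C2 \<subseteq> edges F"
    using C by (auto simp: is_component_def subgraph_def)
  moreover from this have "x 1 \<in> verts C1" "x 2 \<in> verts C1" "z 2 \<in> verts C1" "x 6 \<in> verts C1"
      "x 4 \<in> verts C2" "z 1 \<in> verts C2" "x 5 \<in> verts C2"
    using e by (blast dest: simple_graph_pairD)+
  moreover have "{x 1, x 2} \<in> edges F" "{x 2, z 2} \<in> edges F" "{z 2, x 6} \<in> edges F"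
      "{z 1, x 4} \<in> edges F" "{z 1, x 5} \<in> edges F"
    using e calculation(3,4) by (auto simp: insert_commute)
  moreover have "halves Q F (verts C1) (verts C2)"
    using permutation_two_factor_halves[OF simple _ C(2,3,1)] good by (simp add: good_def)
  ultimately show ?thesis
    using that d e(6) by blast
qed

lemma distinct_verts: "distinct [x 1, x 2, x 4, x 5, x 6, z 1, z 2]"
proof -
  obtain K L where "halves Q F K L" "x 1 \<in> K" "x 2 \<in> K" "z 2 \<in> K" "x 6 \<in> K"
    "x 4 \<in> L" "z 1 \<in> L" "x 5 \<in> L" "distinct [x 1, x 2, z 2, x 6]" "distinct [x 4, z 1, x 5]"
    by (rule circuits)
  then have K: "x 1 \<in> K" "x 2 \<in> K" "z 2 \<in> K" "x 6 \<in> K" and L: "x 4 \<in> L" "z 1 \<in> L" "x 5 \<in> L"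
    and d: "distinct [x 1, x 2, z 2, x 6]" "distinct [x 4, z 1, x 5]" and "K \<inter> L = {}"
    by (simp_all add: halves_def)
  then have ne: "u \<noteq> v" if "u \<in> K" "v \<in> L" for u v using that by blast
  show ?thesis
    using d ne[OF K(1) L(1)] ne[OF K(1) L(2)] ne[OF K(1) L(3)] ne[OF K(2) L(1)] ne[OF K(2) L(2)]
      ne[OF K(2) L(3)] ne[OF K(3) L(1)] ne[OF K(3) L(2)] ne[OF K(3) L(3)] ne[OF K(4) L(1)]
      ne[OF K(4) L(2)] ne[OF K(4) L(3)]
    by auto
qed

text \<open>The same inequalities in the opposite orientation, so that the simplifier can decide
  equations between labels either way round.\<close>

lemma distinct_verts': "distinct [z 2, z 1, x 6, x 5, x 4, x 2, x 1]"
  using distinct_verts distinct_rev[of "[x 1, x 2, x 4, x 5, x 6, z 1, z 2]"] by simp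

lemma labels_in_verts: "x 1 \<in> verts Q" "x 2 \<in> verts Q" "x 4 \<in> verts Q" "x 5 \<in> verts Q" "x 6 \<in> verts Q"
  "z 1 \<in> verts Q" "z 2 \<in> verts Q"
proof -
  obtain K L where "halves Q F K L" "x 1 \<in> K" "x 2 \<in> K" "z 2 \<in> K" "x 6 \<in> K"
    "x 4 \<in> L" "z 1 \<in> L" "x 5 \<in> L"
    by (rule circuits)
  moreover from this have "K \<subseteq> verts Q" "L \<subseteq> verts Q" by (auto simp: halves_def)
  ultimately show "x 1 \<in> verts Q" "x 2 \<in> verts Q" "x 4 \<in> verts Q" "x 5 \<in> verts Q" "x 6 \<in> verts Q"
    "z 1 \<in> verts Q" "z 2 \<in> verts Q" by (simp_all add: subset_iff)
qed

lemma factor_edges: "{x 1, x 2} \<in> edges F" "{x 2, z 2} \<in> edges F" "{z 2, x 6} \<in> edges F"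
    "{z 1, x 4} \<in> edges F" "{z 1, x 5} \<in> edges F"
  by (rule circuits, assumption)+

lemma z_edge: "{z 1, z 2} \<in> edges Q" "{z 1, z 2} \<notin> edges F"
proof -
  obtain K L where h: "halves Q F K L" "z 2 \<in> K" "z 1 \<in> L" "{z 1, z 2} \<in> edges Q"
    by (rule circuits)
  then have "crosses K {z 1, z 2}" by (auto simp: halves_def)
  then show "{z 1, z 2} \<in> edges Q" "{z 1, z 2} \<notin> edges F"
    using h by (auto simp: halves_def simp del: crosses_pair)
qed

lemma star_x2: "{e \<in> edges F. x 2 \<in> e} = {{x 1, x 2}, {x 2, z 2}}"
  using factor_edges distinct_verts distinct_verts'
  by (intro two_factor_degree_two[OF factor labels_in_verts(2)]) (auto simp: doubleton_eq_iff)

lemma star_F_z: "{e \<in> edges F. z 1 \<in> e} = {{z 1, x 4}, {z 1, x 5}}"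
  "{e \<in> edges F. z 2 \<in> e} = {{x 2, z 2}, {z 2, x 6}}"
  using factor_edges distinct_verts distinct_verts'
  by (intro two_factor_degree_two[OF factor]; auto simp: doubleton_eq_iff labels_in_verts)+

lemma star_Q_z: "{e \<in> edges Q. z 1 \<in> e} = {{z 1, x 4}, {z 1, x 5}, {z 1, z 2}}"
  "{e \<in> edges Q. z 2 \<in> e} = {{x 2, z 2}, {z 2, x 6}, {z 1, z 2}}"
  using factor_edges distinct_verts distinct_verts' z_edge edges_F
  by (intro edge_degree_three[OF cubic]; auto simp: doubleton_eq_iff labels_in_verts)+

abbreviation "CQ \<equiv> core Q x z"
abbreviation "CF \<equiv> core F x z"

lemma verts_core: "verts CQ = verts Q - {z 1, z 2}" "verts CF = verts Q - {z 1, z 2}"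
  by (simp_all add: core_def delete_edges_def delete_vertices_def verts_F)

lemma core_edge_iff:
  "e \<in> edges CQ \<longleftrightarrow> e \<in> edges Q \<and> z 1 \<notin> e \<and> z 2 \<notin> e \<and> e \<noteq> {x 1, x 2}"
  "e \<in> edges CF \<longleftrightarrow> e \<in> edges F \<and> z 1 \<notin> e \<and> z 2 \<notin> e \<and> e \<noteq> {x 1, x 2}"
  by (auto simp: core_def delete_edges_def delete_vertices_def)

lemma edges_eq_core:
  "edges Q = insert {x 1, x 2} (insert {x 2, z 2} (insert {z 2, x 6} (insert {z 1, x 4}
    (insert {z 1, x 5} (insert {z 1, z 2} (edges CQ))))))" (is "_ = ?Q")
  "edges F = insert {x 1, x 2} (insert {x 2, z 2} (insert {z 2, x 6} (insert {z 1, x 4}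
    (insert {z 1, x 5} (edges CF)))))" (is "_ = ?F")
proof -
  have "e \<in> edges Q \<longleftrightarrow> e \<in> ?Q" for e
  proof (cases "z 1 \<in> e \<or> z 2 \<in> e")
    case True
    then have "e \<in> edges Q \<longleftrightarrow> e \<in> {e \<in> edges Q. z 1 \<in> e} \<or> e \<in> {e \<in> edges Q. z 2 \<in> e}" by auto
    moreover have "e \<notin> edges CQ" "e \<noteq> {x 1, x 2}" using True distinct_verts by (auto simp: core_edge_iff)
    ultimately show ?thesis unfolding star_Q_z insert_iff empty_iff by metis
  next
    case False
    then have "e \<noteq> {x 2, z 2}" "e \<noteq> {z 2, x 6}" "e \<noteq> {z 1, x 4}" "e \<noteq> {z 1, x 5}" "e \<noteq> {z 1, z 2}"
      by auto
    moreover have "{x 1, x 2} \<in> edges Q" using factor_edges(1) edges_F by auto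
    ultimately show ?thesis unfolding insert_iff core_edge_iff using False by metis
  qed
  then show "edges Q = ?Q" by (rule set_eqI)
  have "e \<in> edges F \<longleftrightarrow> e \<in> ?F" for e
  proof (cases "z 1 \<in> e \<or> z 2 \<in> e")
    case True
    then have "e \<in> edges F \<longleftrightarrow> e \<in> {e \<in> edges F. z 1 \<in> e} \<or> e \<in> {e \<in> edges F. z 2 \<in> e}" by auto
    moreover have "e \<notin> edges CF" "e \<noteq> {x 1, x 2}" using True distinct_verts by (auto simp: core_edge_iff)
    ultimately show ?thesis unfolding star_F_z insert_iff empty_iff by metis
  next
    case False
    then have "e \<noteq> {x 2, z 2}" "e \<noteq> {z 2, x 6}" "e \<noteq> {z 1, x 4}" "e \<noteq> {z 1, x 5}" "e \<noteq> {z 1, z 2}"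
      by auto
    moreover have "{x 1, x 2} \<in> edges F" using factor_edges(1) by auto
    ultimately show ?thesis unfolding insert_iff core_edge_iff using False by metis
  qed
  then show "edges F = ?F" by (rule set_eqI)
qed

lemma finite_core: "finite (edges CQ)" "finite (edges CF)"
  using finite_edges edges_eq_core by (metis finite_insert)+

text \<open>Cuts, degrees and colour degrees are all written as sums over edges, so this one
  splitting transfers each of them between a part and its core.\<close>

lemma sum_edges_core:
  fixes h :: "'a set \<Rightarrow> nat"
  shows "(\<Sum>e\<in>edges Q. h e) = (\<Sum>e\<in>edges CQ. h e) + h {x 1, x 2} + h {x 2, z 2} + h {z 2, x 6} +
      h {z 1, x 4} + h {z 1, x 5} + h {z 1, z 2}"
    and "(\<Sum>e\<in>edges F. h e) = (\<Sum>e\<in>edges CF. h e) + h {x 1, x 2} + h {x 2, z 2} + h {z 2, x 6} +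
      h {z 1, x 4} + h {z 1, x 5}"
  unfolding edges_eq_core using distinct_verts distinct_verts' finite_core
  by (simp_all add: core_edge_iff doubleton_eq_iff)

lemma labels_in_core: "x 1 \<in> verts CQ" "x 2 \<in> verts CQ" "x 4 \<in> verts CQ" "x 5 \<in> verts CQ" "x 6 \<in> verts CQ"
  using labels_in_verts distinct_verts by (auto simp: verts_core)

lemma card_core: "card (verts CQ) + 2 = card (verts Q)"
proof -
  have "card (verts CQ) = card (verts Q) - card {z 1, z 2}"
    unfolding verts_core using labels_in_verts by (intro card_Diff_subset) auto
  moreover have "card {z 1, z 2} = 2" using distinct_verts by simp
  moreover have "10 \<le> card (verts Q)" using good by (simp add: good_def)
  ultimately show ?thesis by simp
qed

lemma simple_core: "simple_graph CQ" "simple_graph CF"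
  using simple simple_F verts_F by (auto simp: simple_graph_def core_edge_iff verts_core)

text \<open>The cut condition of \<open>Q\<close> is applied to \<open>A\<close> together with those
  of \<open>z 1\<close>, \<open>z 2\<close> that \<open>t1\<close>, \<open>t2\<close> select. The
  six extra terms are the edges of \<open>Q\<close> outside the core. As \<open>A\<close> says
  nothing about \<open>z 1\<close> and \<open>z 2\<close>, all four choices give valid
  bounds.\<close>

lemma cut_core:
  assumes A: "A \<subseteq> verts CQ"
  shows "min (tree_cut (card A + of_bool t1 + of_bool t2))
      (tree_cut (card (verts CQ - A) + of_bool (\<not> t1) + of_bool (\<not> t2)))
    \<le> cut (edges CQ) A + of_bool ((x 1 \<in> A) \<noteq> (x 2 \<in> A)) + of_bool ((x 2 \<in> A) \<noteq> t2) +
      of_bool (t2 \<noteq> (x 6 \<in> A)) + of_bool (t1 \<noteq> (x 4 \<in> A)) + of_bool (t1 \<noteq> (x 5 \<in> A)) + of_bool (t1 \<noteq> t2)"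
proof -
  define T where "T = {v. v = z 1 \<and> t1 \<or> v = z 2 \<and> t2}"
  have T: "T \<subseteq> {z 1, z 2}" by (auto simp: T_def)
  have z: "z 1 \<noteq> z 2" "z 1 \<notin> A" "z 2 \<notin> A" using distinct_verts A by (auto simp: verts_core)
  have finA: "finite A" using A finite_verts by (metis finite_Diff finite_subset verts_core(1))
  have cT: "card T = of_bool t1 + of_bool t2" "card ({z 1, z 2} - T) = of_bool (\<not> t1) + of_bool (\<not> t2)"
    using z(1) by (cases t1; cases t2; auto simp: T_def Collect_disj_eq insert_Diff_if)+
  have sub: "A \<union> T \<subseteq> verts Q" using A T labels_in_verts by (auto simp: verts_core)
  have c1: "card (A \<union> T) = card A + card T"
    using finA T z by (intro card_Un_disjoint) (auto intro: finite_subset)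
  have "verts Q - (A \<union> T) = (verts CQ - A) \<union> ({z 1, z 2} - T)"
    using A T labels_in_verts z by (auto simp: verts_core)
  then have c2: "card (verts Q - (A \<union> T)) = card (verts CQ - A) + card ({z 1, z 2} - T)"
    using finite_verts by (simp add: verts_core) (rule card_Un_disjoint; auto)
  have cr: "crosses (A \<union> T) e \<longleftrightarrow> crosses A e" if "e \<in> edges CQ" for e
    using that T by (auto simp: crosses_def core_edge_iff)
  have mem: "x i \<in> A \<union> T \<longleftrightarrow> x i \<in> A" if "i \<in> {1, 2, 4, 5, 6}" for i
    using that T distinct_verts distinct_verts' by auto
  have memz: "z 1 \<in> A \<union> T \<longleftrightarrow> t1" "z 2 \<in> A \<union> T \<longleftrightarrow> t2" using z by (auto simp: T_def)
  have "cut (edges Q) (A \<union> T) = cut (edges CQ) A + of_bool ((x 1 \<in> A) \<noteq> (x 2 \<in> A)) + of_bool ((x 2 \<in> A) \<noteq> t2) +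
      of_bool (t2 \<noteq> (x 6 \<in> A)) + of_bool (t1 \<noteq> (x 4 \<in> A)) + of_bool (t1 \<noteq> (x 5 \<in> A)) + of_bool (t1 \<noteq> t2)"
    unfolding cut_sum[OF finite_edges(1)] cut_sum[OF finite_core(1)] sum_edges_core crosses_pair memz
    using mem cr by simp
  moreover have "min (tree_cut (card (A \<union> T))) (tree_cut (card (verts Q - (A \<union> T)))) \<le> cut (edges Q) (A \<union> T)"
    using good sub by (simp add: good_def)
  ultimately show ?thesis unfolding c1 c2 cT by (simp add: add.assoc)
qed

lemma count_labels_le:
  assumes "A \<subseteq> verts CQ"
  shows "(of_bool (x 1 \<in> A) :: nat) + of_bool (x 2 \<in> A) + of_bool (x 4 \<in> A) + of_bool (x 5 \<in> A) + of_bool (x 6 \<in> A) \<le> card A"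
proof -
  have finA: "finite A" using assms finite_verts by (metis finite_Diff finite_subset verts_core(1))
  have "(of_bool (x 1 \<in> A) :: nat) + of_bool (x 2 \<in> A) + of_bool (x 4 \<in> A) + of_bool (x 5 \<in> A) + of_bool (x 6 \<in> A) =
      (\<Sum>v\<in>{x 1, x 2, x 4, x 5, x 6}. of_bool (v \<in> A))"
    using distinct_verts by simp
  also have "\<dots> = card ({x 1, x 2, x 4, x 5, x 6} \<inter> A)"
    by (simp only: sum_of_bool_eq finite.intros Collect_mem_eq of_nat_id)
  also have "\<dots> \<le> card A" using finA by (intro card_mono) auto
  finally show ?thesis .
qed

text \<open>In the core of \<open>F\<close>, the first circuit has become a path from
  \<open>x 1\<close> to \<open>x 6\<close> and the isolated vertex \<open>x 2\<close>, the second a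
  path from \<open>x 4\<close> to \<open>x 5\<close>. The part of \<open>A\<close> on such a path
  can be left in \<open>F\<close> only by the two edges cut off at the ends of the path, so
  \<open>halves_cut\<close> yields that both ends lie in \<open>A\<close> or neither, and that in
  the latter case the part is empty.\<close>

lemma core_closed:
  assumes h: "halves Q F K L" "x 1 \<in> K" "x 2 \<in> K" "z 2 \<in> K" "x 6 \<in> K" "x 4 \<in> L" "z 1 \<in> L" "x 5 \<in> L"
    and A: "\<forall>e\<in>edges CF. \<not> crosses A e"
  shows "x 1 \<in> A \<longleftrightarrow> x 6 \<in> A" "A \<inter> (K - {x 2, z 2}) \<noteq> {} \<Longrightarrow> x 1 \<in> A"
    "x 4 \<in> A \<longleftrightarrow> x 5 \<in> A" "A \<inter> (L - {z 1}) \<noteq> {} \<Longrightarrow> x 4 \<in> A"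
proof -
  have clK: "\<not> crosses K e" if "e \<in> edges F" for e using h(1) that by (simp add: halves_def)
  have KL: "K \<inter> L = {}" "K \<union> L = verts Q" using h(1) by (auto simp: halves_def)
  have cl: "e \<subseteq> K - {x 2, z 2} \<or> e \<subseteq> L - {z 1}" if e: "e \<in> edges CF" for e
  proof -
    have "e \<in> edges F" "z 1 \<notin> e" "z 2 \<notin> e" "e \<noteq> {x 1, x 2}" using e by (auto simp: core_edge_iff)
    moreover have "x 2 \<notin> e"
    proof
      assume "x 2 \<in> e"
      then have "e \<in> {e \<in> edges F. x 2 \<in> e}" using \<open>e \<in> edges F\<close> by simp
      then have "e = {x 1, x 2} \<or> e = {x 2, z 2}" unfolding star_x2 by simp
      then show False using \<open>z 2 \<notin> e\<close> \<open>e \<noteq> {x 1, x 2}\<close> by blast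
    qed
    moreover have "e \<subseteq> K \<union> L" using calculation(1) simple_F KL(2) verts_F by (auto simp: simple_graph_def)
    moreover have "e \<inter> K = {} \<or> e \<subseteq> K" using clK[OF calculation(1)] by (auto simp: crosses_def)
    ultimately show ?thesis by blast
  qed
  let ?K = "K - {x 2, z 2}" and ?L = "L - {z 1}"
  have noK: "\<not> crosses (A \<inter> ?K) e" "\<not> crosses (A \<inter> ?L) e" if e: "e \<in> edges CF" for e
  proof -
    have "e \<inter> A = {} \<or> e \<subseteq> A" using A e by (auto simp: crosses_def)
    moreover have "?K \<inter> ?L = {}" using KL(1) by blast
    ultimately show "\<not> crosses (A \<inter> ?K) e" "\<not> crosses (A \<inter> ?L) e"
      using cl[OF e] unfolding crosses_def by blast+
  qed
  have mem: "x 1 \<in> A \<inter> ?K \<longleftrightarrow> x 1 \<in> A" "x 6 \<in> A \<inter> ?K \<longleftrightarrow> x 6 \<in> A" "x 2 \<notin> A \<inter> ?K" "z 2 \<notin> A \<inter> ?K"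
    "z 1 \<notin> A \<inter> ?K" "x 4 \<notin> A \<inter> ?K" "x 5 \<notin> A \<inter> ?K"
    "x 4 \<in> A \<inter> ?L \<longleftrightarrow> x 4 \<in> A" "x 5 \<in> A \<inter> ?L \<longleftrightarrow> x 5 \<in> A" "x 2 \<notin> A \<inter> ?L" "z 2 \<notin> A \<inter> ?L"
    "z 1 \<notin> A \<inter> ?L" "x 1 \<notin> A \<inter> ?L" "x 6 \<notin> A \<inter> ?L"
    using h(2-8) KL(1) distinct_verts distinct_verts' by auto
  have cK: "cut (edges F) (A \<inter> ?K) = of_bool (x 1 \<in> A) + of_bool (x 6 \<in> A)"
    unfolding cut_sum[OF finite_edges(2)] sum_edges_core crosses_pair using noK mem by simp
  have cL: "cut (edges F) (A \<inter> ?L) = of_bool (x 4 \<in> A) + of_bool (x 5 \<in> A)"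
    unfolding cut_sum[OF finite_edges(2)] sum_edges_core crosses_pair using noK mem by simp
  have nK: "A \<inter> ?K \<subseteq> K \<or> A \<inter> ?K \<subseteq> L" "A \<inter> ?K \<noteq> K" "A \<inter> ?K \<noteq> L"
    by blast (metis mem(3) h(3), metis mem(6) h(6))
  have nL: "A \<inter> ?L \<subseteq> K \<or> A \<inter> ?L \<subseteq> L" "A \<inter> ?L \<noteq> K" "A \<inter> ?L \<noteq> L"
    by blast (metis mem(10) h(3), metis mem(12) h(7))
  note K = halves_cut[OF factor h(1) nK, unfolded cK] and L = halves_cut[OF factor h(1) nL, unfolded cL]
  show 1: "x 1 \<in> A \<longleftrightarrow> x 6 \<in> A" using K(1) by (auto split: if_splits simp: of_bool_def)
  show "x 1 \<in> A" if "A \<inter> ?K \<noteq> {}" using K(2) 1 that by (auto simp: of_bool_def)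
  show 2: "x 4 \<in> A \<longleftrightarrow> x 5 \<in> A" using L(1) by (auto split: if_splits simp: of_bool_def)
  show "x 4 \<in> A" if "A \<inter> ?L \<noteq> {}" using L(2) 2 that by (auto simp: of_bool_def)
qed

section \<open>Parity of the colours on the six edges leaving a part\<close>

lemma core_non_factor_edge:
  assumes v: "v \<in> verts CQ"
  shows "card {e \<in> edges CQ - edges CF. v \<in> e} = 1"
proof -
  have vQ: "v \<in> verts Q" "v \<noteq> z 1" "v \<noteq> z 2" using v by (auto simp: verts_core)
  obtain w where w: "{v, w} \<in> edges Q - edges F" "w \<in> verts Q"
    "{e \<in> edges Q. v \<in> e} = insert {v, w} {f \<in> edges F. v \<in> f}"
    by (rule non_factor_edge[OF cubic factor vQ(1)])
  have no: "e = {z 1, z 2}" if "e \<in> edges Q - edges F" "z 1 \<in> e \<or> z 2 \<in> e" for e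
  proof -
    have "e \<in> {e \<in> edges Q. z 1 \<in> e} \<or> e \<in> {e \<in> edges Q. z 2 \<in> e}" using that by auto
    then show ?thesis using that(1) factor_edges unfolding star_Q_z by auto
  qed
  have "{e \<in> edges CQ - edges CF. v \<in> e} = {{v, w}}"
  proof (rule set_eqI)
    fix e
    have "{v, w} \<noteq> {z 1, z 2}" using vQ by auto
    then have 1: "z 1 \<notin> {v, w}" "z 2 \<notin> {v, w}" using no[OF w(1)] by blast+
    have 2: "{v, w} \<noteq> {x 1, x 2}" using w(1) factor_edges(1) by auto
    have "e \<in> edges Q \<and> v \<in> e \<longleftrightarrow> e \<in> insert {v, w} {f \<in> edges F. v \<in> f}" unfolding w(3)[symmetric] by simp
    then have 3: "e \<in> edges Q - edges F \<and> v \<in> e \<longleftrightarrow> e = {v, w}" using w(1) by auto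
    show "e \<in> {e \<in> edges CQ - edges CF. v \<in> e} \<longleftrightarrow> e \<in> {{v, w}}"
    proof
      assume "e \<in> {e \<in> edges CQ - edges CF. v \<in> e}"
      then show "e \<in> {{v, w}}" using 3 by (auto simp: core_edge_iff)
    next
      assume "e \<in> {{v, w}}"
      then have "e = {v, w}" by simp
      then show "e \<in> {e \<in> edges CQ - edges CF. v \<in> e}" using 1 2 3 by (simp add: core_edge_iff)
    qed
  qed
  then show ?thesis by simp
qed

text \<open>The non-factor edges of the core match its vertices perfectly: the only non-factor edge
  lost is \<open>{z 1, z 2}\<close>, and its ends are removed with it. Matched vertices have equal
  values, so they contribute an even amount.\<close>

lemma even_core_sum:
  fixes g :: "'a \<Rightarrow> nat"
  assumes g: "\<And>u v. {u, v} \<in> edges CQ - edges CF \<Longrightarrow> g u = g v"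
  shows "even (\<Sum>v\<in>verts CQ. g v)"
proof -
  let ?M = "edges CQ - edges CF"
  have fin: "finite ?M" "finite (verts CQ)" using finite_core finite_verts by (auto simp: verts_core)
  have "(\<Sum>v\<in>verts CQ. g v) = (\<Sum>v\<in>verts CQ. \<Sum>e\<in>?M. g v * of_bool (v \<in> e))"
  proof (rule sum.cong[OF refl])
    fix v assume v: "v \<in> verts CQ"
    have "(\<Sum>e\<in>?M. g v * of_bool (v \<in> e)) = g v * card {e \<in> ?M. v \<in> e}"
      using fin(1) by (simp add: sum_of_bool_eq Int_def flip: sum_distrib_left)
    then show "g v = (\<Sum>e\<in>?M. g v * of_bool (v \<in> e))" using core_non_factor_edge[OF v] by simp
  qed
  also have "\<dots> = (\<Sum>e\<in>?M. \<Sum>v\<in>verts CQ. g v * of_bool (v \<in> e))" by (rule sum.swap)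
  also have "even \<dots>"
  proof (rule dvd_sum)
    fix e assume e: "e \<in> ?M"
    then obtain u w where uw: "e = {u, w}" "u \<noteq> w" "u \<in> verts CQ" "w \<in> verts CQ"
      using simple_graph_edgeE[OF simple_core(1)] by blast
    have "(\<Sum>v\<in>verts CQ. g v * of_bool (v \<in> e)) = (\<Sum>v\<in>{u, w}. g v * of_bool (v \<in> e))"
      using fin(2) uw by (intro sum.mono_neutral_right) auto
    also have "\<dots> = 2 * g u" using uw g[of u w] e by simp
    finally show "even (\<Sum>v\<in>verts CQ. g v * of_bool (v \<in> e))" by simp
  qed
  finally show ?thesis .
qed

text \<open>The number of edges of colour \<open>c\<close> at \<open>v\<close>, where \<open>e\<^sub>j\<close> has the colour \<open>a j\<close>.\<close>

definition part_degree :: "('a set \<Rightarrow> 'c) \<Rightarrow> (nat \<Rightarrow> 'c) \<Rightarrow> 'c \<Rightarrow> 'a \<Rightarrow> nat" where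
  "part_degree \<phi> a c v = card {f \<in> edges CF. v \<in> f \<and> \<phi> f = c} +
     of_bool (v = x 1 \<and> a 1 = c) + of_bool (v = x 2 \<and> a 2 = c) + of_bool (v = x 2 \<and> a 3 = c) +
     of_bool (v = x 4 \<and> a 4 = c) + of_bool (v = x 5 \<and> a 5 = c) + of_bool (v = x 6 \<and> a 6 = c)"

context
  fixes \<phi> :: "'a set \<Rightarrow> nat" and a :: "nat \<Rightarrow> nat"
  assumes le: "\<And>c v. v \<in> verts CQ \<Longrightarrow> part_degree \<phi> a c v \<le> 1"
    and eq: "\<And>c u v. {u, v} \<in> edges CQ - edges CF \<Longrightarrow> part_degree \<phi> a c u = part_degree \<phi> a c v"
begin

lemma part_colours_distinct: "a 2 \<noteq> a 3"
  using le[of "x 2" "a 2"] labels_in_core(2) distinct_verts by (auto simp: part_degree_def)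

text \<open>The degrees in colour \<open>c\<close> agree along the matching of the core, so their
  sum is even. A core edge of colour \<open>c\<close> contributes 2 to it and each of the six
  half-edges of colour \<open>c\<close> contributes 1.\<close>

lemma part_colours_even:
  "even (of_bool (a 1 = c) + of_bool (a 2 = c) + of_bool (a 3 = c) + of_bool (a 4 = c) +
     of_bool (a 5 = c) + of_bool (a 6 = c) :: nat)"
proof -
  let ?E = "{f \<in> edges CF. \<phi> f = c}"
  have fin: "finite (verts CQ)" using finite_verts by (simp add: verts_core)
  have "e \<subseteq> verts CQ" if "e \<in> edges CF" for e
    using simple_core(2) that by (simp add: simple_graph_def verts_core)
  then have "{e \<in> ?E. crosses (verts CQ) e} = {}" by (auto simp: crosses_def)
  then have "cut ?E (verts CQ) = 0" by (simp only: cut_def card.empty)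
  then have 1: "(\<Sum>v\<in>verts CQ. card {f \<in> ?E. v \<in> f}) = 2 * card {e \<in> ?E. e \<subseteq> verts CQ}"
    using sum_incidences[of ?E "verts CQ"] simple_core(2) finite_core fin by (simp add: simple_graph_def)
  have 2: "(\<Sum>v\<in>verts CQ. of_bool (v = y \<and> p) :: nat) = of_bool p" if "y \<in> verts CQ" for y p
  proof -
    have "(\<Sum>v\<in>verts CQ. of_bool (v = y \<and> p) :: nat) = (\<Sum>v\<in>verts CQ. if v = y then of_bool p else 0)"
      by (intro sum.cong) auto
    then show ?thesis using fin that by simp
  qed
  have 3: "{f \<in> edges CF. v \<in> f \<and> \<phi> f = c} = {f \<in> ?E. v \<in> f}" for v by auto
  have "(\<Sum>v\<in>verts CQ. part_degree \<phi> a c v) = 2 * card {e \<in> ?E. e \<subseteq> verts CQ} +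
      (of_bool (a 1 = c) + of_bool (a 2 = c) + of_bool (a 3 = c) + of_bool (a 4 = c) +
     of_bool (a 5 = c) + of_bool (a 6 = c))"
    unfolding part_degree_def sum.distrib 3 1 using 2 labels_in_core by simp
  moreover have "even (\<Sum>v\<in>verts CQ. part_degree \<phi> a c v)" using eq by (rule even_core_sum)
  ultimately show ?thesis by (simp only: dvd_add_right_iff[OF dvd_triv_left])
qed

text \<open>Otherwise the colouring extends to \<open>Q\<close>, with colour \<open>b\<close> on \<open>x\<^sub>2z\<^sub>2\<close>.\<close>

lemma part_colours_not_extendable:
  assumes b: "a 1 = a 2 \<and> b = a 3 \<or> a 1 = a 3 \<and> b = a 2"
  shows "\<not> same_pair b (a 6) (a 4) (a 5)"
proof
  assume sp: "same_pair b (a 6) (a 4) (a 5)"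
  \<comment> \<open>Both half-edges at \<open>x 2\<close> are replaced by \<open>{x 1, x 2}\<close>
    and \<open>{x 2, z 2}\<close>. With the colours \<open>a 1\<close> and \<open>b\<close> the
    vertex \<open>x 1\<close> sees the same colours as before, and so does \<open>x 2\<close>, since
    the hypothesis on \<open>b\<close> makes the pairs \<open>a 1, b\<close> and
    \<open>a 2, a 3\<close> agree.\<close>
  define \<psi> where "\<psi> e = (if e = {x 1, x 2} then a 1 else if e = {x 2, z 2} then b else
    if e = {z 2, x 6} then a 6 else if e = {z 1, x 4} then a 4 else if e = {z 1, x 5} then a 5 else \<phi> e)" for e
  have psi: "\<psi> {x 1, x 2} = a 1" "\<psi> {x 2, z 2} = b" "\<psi> {z 2, x 6} = a 6" "\<psi> {z 1, x 4} = a 4" "\<psi> {z 1, x 5} = a 5"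
    using distinct_verts distinct_verts' by (simp_all add: \<psi>_def doubleton_eq_iff)
  have psi_core: "\<psi> e = \<phi> e" if "e \<in> edges CF" for e
    using that unfolding \<psi>_def core_edge_iff by auto
  have deg: "colour_degree F \<psi> c v = card {f \<in> edges CF. v \<in> f \<and> \<phi> f = c} +
      of_bool (v \<in> {x 1, x 2} \<and> a 1 = c) + of_bool (v \<in> {x 2, z 2} \<and> b = c) + of_bool (v \<in> {z 2, x 6} \<and> a 6 = c) +
      of_bool (v \<in> {z 1, x 4} \<and> a 4 = c) + of_bool (v \<in> {z 1, x 5} \<and> a 5 = c)" for c v
  proof -
    have "colour_degree F \<psi> c v = (\<Sum>f\<in>edges F. of_bool (v \<in> f \<and> \<psi> f = c))"
      using finite_edges(2) by (simp add: colour_degree_def sum_of_bool_eq Int_def)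
    moreover have "(\<Sum>f\<in>edges CF. of_bool (v \<in> f \<and> \<psi> f = c)) = card {f \<in> edges CF. v \<in> f \<and> \<phi> f = c}"
      using finite_core(2) psi_core by (simp add: sum_of_bool_eq Int_def cong: conj_cong)
    ultimately show ?thesis unfolding sum_edges_core psi by simp
  qed
  have core: "colour_degree F \<psi> c v = part_degree \<phi> a c v" if "v \<in> verts CQ" for c v
  proof -
    have "v \<noteq> z 1" "v \<noteq> z 2" using that by (auto simp: verts_core)
    then show ?thesis unfolding deg part_degree_def using b distinct_verts distinct_verts' by auto
  qed
  have nz: "card {f \<in> edges CF. z i \<in> f \<and> \<phi> f = c} = 0" if "i = 1 \<or> i = 2" for i c
  proof -
    have "{f \<in> edges CF. z i \<in> f \<and> \<phi> f = c} = {}" using that by (auto simp: core_edge_iff)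
    then show ?thesis by (simp only: card.empty)
  qed
  have z1: "colour_degree F \<psi> c (z 1) = of_bool (a 4 = c) + of_bool (a 5 = c)" for c
    unfolding deg nz[OF disjI1[OF refl]] using distinct_verts distinct_verts' by simp
  have z2: "colour_degree F \<psi> c (z 2) = of_bool (b = c) + of_bool (a 6 = c)" for c
    unfolding deg nz[OF disjI2[OF refl]] using distinct_verts distinct_verts' by simp
  have zz: "colour_degree F \<psi> c (z 1) \<le> 1" "colour_degree F \<psi> c (z 2) = colour_degree F \<psi> c (z 1)" for c
    using sp unfolding same_pair_iff z1 z2 by metis+
  have "pair_colouring Q F \<psi>"
    unfolding pair_colouring_def
  proof (intro allI conjI ballI impI)
    fix c v assume v: "v \<in> verts Q"
    show "colour_degree F \<psi> c v \<le> 1"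
    proof (cases "v = z 1 \<or> v = z 2")
      case True
      then show ?thesis using zz by metis
    next
      case False
      then have "v \<in> verts CQ" using v by (simp add: verts_core)
      then show ?thesis using le core by simp
    qed
  next
    fix c u v assume uv: "{u, v} \<in> edges Q - edges F"
    show "colour_degree F \<psi> c u = colour_degree F \<psi> c v"
    proof (cases "{u, v} \<in> edges CQ")
      case True
      moreover have "{u, v} \<notin> edges CF" using uv by (simp add: core_edge_iff)
      moreover have "u \<in> verts CQ" "v \<in> verts CQ" using simple_graph_pairD[OF simple_core(1) True] by auto
      ultimately show ?thesis using eq[of u v] core by simp
    next
      case False
      have "{u, v} \<in> edges Q" "{u, v} \<notin> edges F" using uv by auto
      then have "{u, v} = {z 1, z 2}"
        using False factor_edges unfolding edges_eq_core(1) insert_iff by metis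
      then show ?thesis using zz by (auto simp: doubleton_eq_iff)
    qed
  qed
  then show False using good by (simp add: good_def)
qed

lemma part_colours:
  "(a 1 = a 2 \<and> a 6 = a 3 \<or> a 1 = a 3 \<and> a 6 = a 2) \<and> a 4 = a 5 \<or>
   a 1 \<noteq> a 2 \<and> a 1 \<noteq> a 3 \<and> a 4 \<noteq> a 5 \<and> a 4 \<noteq> a 6 \<and> a 5 \<noteq> a 6 \<and> {a 4, a 5, a 6} = {a 1, a 2, a 3}"
  using part_colours_even part_colours_distinct part_colours_not_extendable by (intro even_colours) blast+

end

end

section \<open>Cuts of the assembled graph\<close>

text \<open>What the cut condition of a part says about a set containing \<open>s\<close> vertices of the core and
  missing \<open>t\<close>, with \<open>c\<close> core edges in its cut; \<open>b\<^sub>j\<close> says whether \<open>x\<^sub>j\<close> lies in the set, and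
  \<open>t\<^sub>1\<close>, \<open>t\<^sub>2\<close> on which side \<open>z\<^sub>1\<close>, \<open>z\<^sub>2\<close> are put.\<close>

definition part_bound1 :: "bool \<Rightarrow> bool \<Rightarrow> bool \<Rightarrow> bool \<Rightarrow> bool \<Rightarrow> nat \<Rightarrow> nat \<Rightarrow> bool \<Rightarrow> bool \<Rightarrow> nat" where
  "part_bound1 b1 b2 b4 b5 b6 s t t1 t2 =
     min (tree_cut (s + of_bool t1 + of_bool t2)) (tree_cut (t + of_bool (\<not> t1) + of_bool (\<not> t2))) -
     (of_bool (b1 \<noteq> b2) + of_bool (b2 \<noteq> t2) + of_bool (t2 \<noteq> b6) + of_bool (t1 \<noteq> b4) + of_bool (t1 \<noteq> b5) +
      of_bool (t1 \<noteq> t2))"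

definition part_bound :: "bool \<Rightarrow> bool \<Rightarrow> bool \<Rightarrow> bool \<Rightarrow> bool \<Rightarrow> nat \<Rightarrow> nat \<Rightarrow> nat" where
  "part_bound b1 b2 b4 b5 b6 s t =
     max (max (part_bound1 b1 b2 b4 b5 b6 s t False False) (part_bound1 b1 b2 b4 b5 b6 s t False True))
       (max (part_bound1 b1 b2 b4 b5 b6 s t True False) (part_bound1 b1 b2 b4 b5 b6 s t True True))"

definition part_cut :: "bool \<Rightarrow> bool \<Rightarrow> bool \<Rightarrow> bool \<Rightarrow> bool \<Rightarrow> nat \<Rightarrow> nat \<Rightarrow> nat \<Rightarrow> bool" where
  "part_cut b1 b2 b4 b5 b6 s t c \<longleftrightarrow> (\<forall>t1 t2. part_bound1 b1 b2 b4 b5 b6 s t t1 t2 \<le> c) \<and>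
     of_bool b1 + of_bool b2 + of_bool b4 + of_bool b5 + of_bool b6 \<le> s \<and>
     of_bool (\<not> b1) + of_bool (\<not> b2) + of_bool (\<not> b4) + of_bool (\<not> b5) + of_bool (\<not> b6) \<le> t \<and> 8 \<le> s + t"

lemma (in labelled) part_cut_core:
  assumes A: "A \<subseteq> verts CQ"
  shows "part_cut (x 1 \<in> A) (x 2 \<in> A) (x 4 \<in> A) (x 5 \<in> A) (x 6 \<in> A) (card A) (card (verts CQ - A))
    (cut (edges CQ) A)"
proof -
  have "part_bound1 (x 1 \<in> A) (x 2 \<in> A) (x 4 \<in> A) (x 5 \<in> A) (x 6 \<in> A) (card A) (card (verts CQ - A)) t1 t2
      \<le> cut (edges CQ) A" for t1 t2
    using cut_core[OF A, of t1 t2] unfolding part_bound1_def le_diff_conv by (simp only: add_ac)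
  moreover have "card A + card (verts CQ - A) = card (verts CQ)"
  proof -
    have "finite (verts CQ)" using finite_verts by (simp add: verts_core)
    then show ?thesis using A card_mono[of "verts CQ" A] by (simp add: card_Diff_subset finite_subset)
  qed
  then have "8 \<le> card A + card (verts CQ - A)" using card_core good by (simp add: good_def)
  ultimately show ?thesis
    using count_labels_le[OF A] count_labels_le[of "verts CQ - A"] labels_in_core
    by (simp add: part_cut_def)
qed

text \<open>For the assembled graph, sizes matter only up to 3 and cuts with at least 5 edges are large
  enough; this leaves 76 possibilities for each part, and few combinations of them have a cut with
  at most 4 edges.\<close>

definition bools :: "bool list" where
  "bools = [False, True]"

definition part_configs :: "nat \<Rightarrow> (bool \<times> bool \<times> bool \<times> bool \<times> bool \<times> nat \<times> nat) list" where
  "part_configs c = filter (\<lambda>(b1, b2, b4, b5, b6, s, t).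
     min 3 (of_bool b1 + of_bool b2 + of_bool b4 + of_bool b5 + of_bool b6) \<le> s \<and>
     min 3 (of_bool (\<not> b1) + of_bool (\<not> b2) + of_bool (\<not> b4) + of_bool (\<not> b5) + of_bool (\<not> b6)) \<le> t \<and>
     part_bound b1 b2 b4 b5 b6 s t = c)
     (List.product bools (List.product bools (List.product bools (List.product bools (List.product bools
       [(0, 3), (1, 3), (2, 3), (3, 3), (3, 2), (3, 1), (3, 0)])))))"

text \<open>A search with a budget: the lists hold the options of cost \<open>k\<close>,
  \<open>k + 1\<close>, and so on, and lists of cost above \<open>w\<close> are not visited.
  \<open>P\<close> receives the cost together with the option.\<close>

fun all_cost :: "nat \<Rightarrow> nat \<Rightarrow> (nat \<Rightarrow> 'b \<Rightarrow> bool) \<Rightarrow> 'b list list \<Rightarrow> bool" where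
  "all_cost k w P [] = True"
| "all_cost k w P (l # ls) = (list_all (P k) l \<and> (if k < w then all_cost (Suc k) w P ls else True))"

text \<open>\<open>w\<close> is the cost of the cores and of the ten glued edges. The variables
  \<open>p\<close> and \<open>q\<close> place the two additional vertices and add the five edges at
  them.\<close>

definition final_check :: "nat \<Rightarrow> bool \<Rightarrow> bool \<Rightarrow> bool \<Rightarrow> bool \<Rightarrow> nat \<Rightarrow> nat \<Rightarrow> bool" where
  "final_check w a2 c2 b2 d2 s t \<longleftrightarrow> list_all (\<lambda>p. list_all (\<lambda>q.
     min (tree_cut (s + of_bool p + of_bool q)) (tree_cut (t + of_bool (\<not> p) + of_bool (\<not> q)))
     \<le> w + of_bool (a2 \<noteq> p) + of_bool (c2 \<noteq> p) + of_bool (b2 \<noteq> q) + of_bool (d2 \<noteq> q) + of_bool (p \<noteq> q)) bools) bools"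

text \<open>The letters \<open>a, b, c, d\<close> belong to the parts 1, 2, 3, 4.\<close>

definition assembly_check :: "(bool \<times> bool \<times> bool \<times> bool \<times> bool \<times> nat \<times> nat) list list \<Rightarrow> bool" where
  "assembly_check os \<longleftrightarrow> all_cost 0 4 (\<lambda>ka (a1, a2, a4, a5, a6, sa, ta).
     all_cost 0 (4 - ka) (\<lambda>kd (d1, d2, d4, d5, d6, sd, td).
     let w = ka + kd + of_bool (a1 \<noteq> d4) + of_bool (a2 \<noteq> d5) in if 4 < w then True else
     all_cost 0 (4 - w) (\<lambda>kc (c1, c2, c4, c5, c6, sc, tc).
     let w = w + kc + of_bool (d1 \<noteq> c4) + of_bool (d2 \<noteq> c5) + of_bool (a6 \<noteq> c6) in if 4 < w then True else
     all_cost 0 (4 - w) (\<lambda>kb (b1, b2, b4, b5, b6, sb, tb).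
     let w = w + kb + of_bool (c1 \<noteq> b4) + of_bool (c2 \<noteq> b5) + of_bool (b1 \<noteq> a4) + of_bool (b2 \<noteq> a5) +
       of_bool (b6 \<noteq> d6)
     in if 4 < w then True else final_check w a2 c2 b2 d2 (sa + sb + sc + sd) (ta + tb + tc + td)) os) os) os) os"

text \<open>The parts are visited in the order 1, 4, 3, 2 of the cycle in which they are glued, so
  each new part brings glued edges into the cost at once. A branch ends as soon as the cost exceeds
  4.\<close>

lemma assembly_check: "assembly_check (map part_configs [0, 1, 2, 3, 4])"
  by code_simp

lemma all_costD:
  assumes "all_cost k w P ls" "j < length ls" "k + j \<le> w" "y \<in> set (ls ! j)"
  shows "P (k + j) y"
  using assms
proof (induction k w P ls arbitrary: j rule: all_cost.induct)
  case (2 k w P l ls)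
  then show ?case by (cases j) (auto simp: list_all_iff split: if_splits)
qed simp

lemma all_cost_partD:
  assumes "all_cost 0 w P (map part_configs [0, 1, 2, 3, 4])" "k \<le> w" "k \<le> 4" "y \<in> set (part_configs k)"
  shows "P k y"
proof -
  have "map part_configs [0, 1, 2, 3, 4] ! k = part_configs k" "k < length (map part_configs [0, 1, 2, 3, 4])"
    using assms(3) by (auto simp: numeral_eq_Suc One_nat_def le_Suc_eq)
  then show ?thesis using all_costD[OF assms(1), of k y] assms(2,4) by simp
qed

lemma tree_cut_le: "tree_cut n \<le> 5"
  by (simp add: tree_cut_def)

text \<open>\<open>tree_cut\<close> is constantly 5 from size 3 on.\<close>

lemma tree_cut_cap: "tree_cut (min 3 n + r) = tree_cut (n + r)"
  by (auto simp: tree_cut_def min_def)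

text \<open>Capping at 3 leaves seven pairs of sizes, because a sum of at least 8 makes one of the
  two sizes at least 4. It is enough to have an option whose cost bounds \<open>c\<close> from
  below, since replacing \<open>c\<close> by something smaller only strengthens the inequality to be
  checked.\<close>

lemma part_cut_option:
  assumes "part_cut b1 b2 b4 b5 b6 s t c"
  obtains k where "k \<le> c" "(b1, b2, b4, b5, b6, min 3 s, min 3 t) \<in> set (part_configs k)"
proof
  let ?k = "part_bound b1 b2 b4 b5 b6 (min 3 s) (min 3 t)"
  have "part_bound1 b1 b2 b4 b5 b6 (min 3 s) (min 3 t) t1 t2 \<le> c" for t1 t2
    using assms by (simp add: part_cut_def part_bound1_def add.assoc tree_cut_cap)
  then show "?k \<le> c" by (simp add: part_bound_def)
  have "8 \<le> s + t" using assms by (simp add: part_cut_def)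
  then have "(min 3 s, min 3 t) \<in> {(0, 3), (1, 3), (2, 3), (3, 3), (3, 2), (3, 1), (3, 0)}"
    by (auto simp: min_def)
  moreover have "b \<in> set bools" for b by (cases b) (simp_all add: bools_def)
  moreover have "min 3 (of_bool b1 + of_bool b2 + of_bool b4 + of_bool b5 + of_bool b6) \<le> min 3 s"
    "min 3 (of_bool (\<not> b1) + of_bool (\<not> b2) + of_bool (\<not> b4) + of_bool (\<not> b5) + of_bool (\<not> b6)) \<le> min 3 t"
    using assms unfolding part_cut_def by linarith+
  ultimately show "(b1, b2, b4, b5, b6, min 3 s, min 3 t) \<in> set (part_configs ?k)"
    by (simp only: part_configs_def set_filter set_product mem_Collect_eq prod.case mem_Sigma_iff list.set simp_thms)
qed

text \<open>The right side is the size of a cut of \<open>H\<close>: four core cuts, ten glued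
  edges, four edges at \<open>p\<close> and \<open>q\<close>, and the edge between them. The left
  side is at most 5, so only totals of at most 4 are in question, and these are within the budget of
  the search.\<close>

lemma assembly_cut:
  assumes a: "part_cut a1 a2 a4 a5 a6 sa ta ca" and b: "part_cut b1 b2 b4 b5 b6 sb tb cb"
    and c: "part_cut c1 c2 c4 c5 c6 sc tc cc" and d: "part_cut d1 d2 d4 d5 d6 sd td cd"
  shows "min (tree_cut (sa + sb + sc + sd + of_bool p + of_bool q))
      (tree_cut (ta + tb + tc + td + of_bool (\<not> p) + of_bool (\<not> q)))
    \<le> ca + cb + cc + cd + of_bool (a1 \<noteq> d4) + of_bool (a2 \<noteq> d5) + of_bool (d1 \<noteq> c4) + of_bool (d2 \<noteq> c5) +
      of_bool (c1 \<noteq> b4) + of_bool (c2 \<noteq> b5) + of_bool (b1 \<noteq> a4) + of_bool (b2 \<noteq> a5) +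
      of_bool (a6 \<noteq> c6) + of_bool (b6 \<noteq> d6) + of_bool (a2 \<noteq> p) + of_bool (c2 \<noteq> p) +
      of_bool (b2 \<noteq> q) + of_bool (d2 \<noteq> q) + of_bool (p \<noteq> q)"
    (is "?l \<le> ?r")
proof (cases "5 \<le> ?r")
  case True
  moreover have "?l \<le> 5" using tree_cut_le by (rule min.coboundedI1)
  ultimately show ?thesis by linarith
next
  case small: False
  obtain ka where ka: "ka \<le> ca" "(a1, a2, a4, a5, a6, min 3 sa, min 3 ta) \<in> set (part_configs ka)"
    using part_cut_option[OF a] .
  obtain kb where kb: "kb \<le> cb" "(b1, b2, b4, b5, b6, min 3 sb, min 3 tb) \<in> set (part_configs kb)"
    using part_cut_option[OF b] .
  obtain kc where kc: "kc \<le> cc" "(c1, c2, c4, c5, c6, min 3 sc, min 3 tc) \<in> set (part_configs kc)"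
    using part_cut_option[OF c] .
  obtain kd where kd: "kd \<le> cd" "(d1, d2, d4, d5, d6, min 3 sd, min 3 td) \<in> set (part_configs kd)"
    using part_cut_option[OF d] .
  let ?os = "map part_configs [0, 1, 2, 3, 4]"
  \<comment> \<open>The partial costs after parts 1 and 4, then 3, then 2, in the order of the
    search.\<close>
  define w1 where "w1 = ka + kd + of_bool (a1 \<noteq> d4) + of_bool (a2 \<noteq> d5)"
  define w2 where "w2 = w1 + kc + of_bool (d1 \<noteq> c4) + of_bool (d2 \<noteq> c5) + of_bool (a6 \<noteq> c6)"
  define w3 where "w3 = w2 + kb + of_bool (c1 \<noteq> b4) + of_bool (c2 \<noteq> b5) + of_bool (b1 \<noteq> a4) + of_bool (b2 \<noteq> a5) +
       of_bool (b6 \<noteq> d6)"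
  have w: "ka + kd \<le> w1" "w1 + kc \<le> w2" "w2 + kb \<le> w3" by (simp_all add: w1_def w2_def w3_def)
  have "w3 + of_bool (a2 \<noteq> p) + of_bool (c2 \<noteq> p) + of_bool (b2 \<noteq> q) + of_bool (d2 \<noteq> q) + of_bool (p \<noteq> q) \<le> ?r"
    unfolding w3_def w2_def w1_def using ka(1) kb(1) kc(1) kd(1) by linarith
  then have le: "w3 + of_bool (a2 \<noteq> p) + of_bool (c2 \<noteq> p) + of_bool (b2 \<noteq> q) + of_bool (d2 \<noteq> q) + of_bool (p \<noteq> q) \<le> ?r"
    and w3: "w3 \<le> 4" using small by linarith+
  have ka4: "ka \<le> 4" and kd4: "kd \<le> 4 - ka" "kd \<le> 4" and kc4: "kc \<le> 4 - w1" "kc \<le> 4"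
    and kb4: "kb \<le> 4 - w2" "kb \<le> 4" and wle: "\<not> 4 < w1" "\<not> 4 < w2" "\<not> 4 < w3"
    using w w3 by linarith+
  have "all_cost 0 (4 - ka) (\<lambda>kd (d1, d2, d4, d5, d6, sd, td).
     let w = ka + kd + of_bool (a1 \<noteq> d4) + of_bool (a2 \<noteq> d5) in if 4 < w then True else
     all_cost 0 (4 - w) (\<lambda>kc (c1, c2, c4, c5, c6, sc, tc).
     let w = w + kc + of_bool (d1 \<noteq> c4) + of_bool (d2 \<noteq> c5) + of_bool (a6 \<noteq> c6) in if 4 < w then True else
     all_cost 0 (4 - w) (\<lambda>kb (b1, b2, b4, b5, b6, sb, tb).
     let w = w + kb + of_bool (c1 \<noteq> b4) + of_bool (c2 \<noteq> b5) + of_bool (b1 \<noteq> a4) + of_bool (b2 \<noteq> a5) +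
       of_bool (b6 \<noteq> d6)
     in if 4 < w then True else final_check w a2 c2 b2 d2 (min 3 sa + sb + sc + sd) (min 3 ta + tb + tc + td)) ?os) ?os) ?os"
    using all_cost_partD[OF assembly_check[unfolded assembly_check_def] ka4 ka4 ka(2)] by (simp only: prod.case)
  from all_cost_partD[OF this kd4 kd(2)] have "all_cost 0 (4 - w1) (\<lambda>kc (c1, c2, c4, c5, c6, sc, tc).
     let w = w1 + kc + of_bool (d1 \<noteq> c4) + of_bool (d2 \<noteq> c5) + of_bool (a6 \<noteq> c6) in if 4 < w then True else
     all_cost 0 (4 - w) (\<lambda>kb (b1, b2, b4, b5, b6, sb, tb).
     let w = w + kb + of_bool (c1 \<noteq> b4) + of_bool (c2 \<noteq> b5) + of_bool (b1 \<noteq> a4) + of_bool (b2 \<noteq> a5) +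
       of_bool (b6 \<noteq> d6)
     in if 4 < w then True else final_check w a2 c2 b2 d2 (min 3 sa + sb + sc + min 3 sd) (min 3 ta + tb + tc + min 3 td)) ?os) ?os"
    by (simp only: prod.case w1_def[symmetric] Let_def wle if_False)
  from all_cost_partD[OF this kc4 kc(2)] have "all_cost 0 (4 - w2) (\<lambda>kb (b1, b2, b4, b5, b6, sb, tb).
     let w = w2 + kb + of_bool (c1 \<noteq> b4) + of_bool (c2 \<noteq> b5) + of_bool (b1 \<noteq> a4) + of_bool (b2 \<noteq> a5) +
       of_bool (b6 \<noteq> d6)
     in if 4 < w then True else final_check w a2 c2 b2 d2 (min 3 sa + sb + min 3 sc + min 3 sd) (min 3 ta + tb + min 3 tc + min 3 td)) ?os"
    by (simp only: prod.case w2_def[symmetric] Let_def wle if_False)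
  from all_cost_partD[OF this kb4 kb(2)] have fin: "final_check w3 a2 c2 b2 d2
      (min 3 sa + min 3 sb + min 3 sc + min 3 sd) (min 3 ta + min 3 tb + min 3 tc + min 3 td)"
    by (simp only: prod.case w3_def[symmetric] Let_def wle if_False)
  have "p \<in> set bools" "q \<in> set bools" by (simp_all add: bools_def)
  then have "min (tree_cut (min 3 sa + min 3 sb + min 3 sc + min 3 sd + of_bool p + of_bool q))
      (tree_cut (min 3 ta + min 3 tb + min 3 tc + min 3 td + of_bool (\<not> p) + of_bool (\<not> q)))
    \<le> w3 + of_bool (a2 \<noteq> p) + of_bool (c2 \<noteq> p) + of_bool (b2 \<noteq> q) + of_bool (d2 \<noteq> q) + of_bool (p \<noteq> q)"
    by (rule bspec[OF bspec[OF fin[unfolded final_check_def list_all_iff]]])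
  \<comment> \<open>The search used capped sizes; the caps are removed from the sum one summand at a
    time.\<close>
  moreover have "tree_cut (min 3 u + min 3 v + min 3 x + min 3 y + r + s) = tree_cut (u + v + x + y + r + s)"
    for u v x y r s
  proof -
    have "tree_cut (min 3 u + min 3 v + min 3 x + min 3 y + r + s) = tree_cut (u + (min 3 v + min 3 x + min 3 y + r + s))"
      using tree_cut_cap[of u "min 3 v + min 3 x + min 3 y + r + s"] by (simp add: add_ac)
    also have "\<dots> = tree_cut (v + (u + min 3 x + min 3 y + r + s))"
      using tree_cut_cap[of v "u + min 3 x + min 3 y + r + s"] by (simp add: add_ac)
    also have "\<dots> = tree_cut (x + (u + v + min 3 y + r + s))"
      using tree_cut_cap[of x "u + v + min 3 y + r + s"] by (simp add: add_ac)
    also have "\<dots> = tree_cut (u + v + x + y + r + s)"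
      using tree_cut_cap[of y "u + v + x + r + s"] by (simp add: add_ac)
    finally show ?thesis .
  qed
  ultimately show ?thesis using le by simp
qed

section \<open>The assembled graph\<close>

lemma in_1_4: "i \<in> {1..4} \<longleftrightarrow> i = 1 \<or> i = 2 \<or> i = 3 \<or> i = (4::nat)"
  by auto

lemma sum_1_4: "(\<Sum>i\<in>{1..4}. f i) = f 1 + f 2 + f 3 + (f (4::nat) :: nat)"
proof -
  have "{1..4::nat} = {1, 2, 3, 4}" by auto
  then show ?thesis by simp
qed

lemma Part_mem_image [simp]: "Part i v \<in> Part j ` e \<longleftrightarrow> i = j \<and> v \<in> e"
  by auto

lemma crosses_Part [simp]: "crosses A (Part i ` e) \<longleftrightarrow> crosses (Part i -` A) e"
  by (auto simp: crosses_def)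

lemma inj_image_Part: "inj_on ((`) (Part i)) E"
  by (rule inj_on_subset[OF _ subset_UNIV]) (simp add: inj_image_eq_iff inj_on_def)

lemma link_edges_eq:
  "link_edges x =
    {{Part 1 (x 1 2), Pv}, {Part 3 (x 3 2), Pv}, {Part 2 (x 2 2), Qv}, {Part 4 (x 4 2), Qv},
     {Part 1 (x 1 1), Part 4 (x 4 4)}, {Part 1 (x 1 2), Part 4 (x 4 5)},
     {Part 4 (x 4 1), Part 3 (x 3 4)}, {Part 4 (x 4 2), Part 3 (x 3 5)},
     {Part 3 (x 3 1), Part 2 (x 2 4)}, {Part 3 (x 3 2), Part 2 (x 2 5)},
     {Part 2 (x 2 1), Part 1 (x 1 4)}, {Part 2 (x 2 2), Part 1 (x 1 5)},
     {Part 1 (x 1 6), Part 3 (x 3 6)}, {Part 2 (x 2 6), Part 4 (x 4 6)}}"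
  by (simp add: link_edges_def glued_def foot_def)

text \<open>The other end of the edge of \<open>H\<close> that comes from the half-edge \<open>e\<^sup>j\<^sub>k\<close>.\<close>

definition mate :: "(nat \<Rightarrow> nat \<Rightarrow> vertex) \<Rightarrow> nat \<Rightarrow> nat \<Rightarrow> vertex" where
  "mate x j k =
    (if j = 1 then
       (if k = 1 then Part 4 (x 4 4) else if k = 2 then Pv else if k = 3 then Part 4 (x 4 5) else
        if k = 4 then Part 2 (x 2 1) else if k = 5 then Part 2 (x 2 2) else Part 3 (x 3 6))
     else if j = 2 then
       (if k = 1 then Part 1 (x 1 4) else if k = 2 then Part 1 (x 1 5) else if k = 3 then Qv else
        if k = 4 then Part 3 (x 3 1) else if k = 5 then Part 3 (x 3 2) else Part 4 (x 4 6))
     else if j = 3 then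
       (if k = 1 then Part 2 (x 2 4) else if k = 2 then Pv else if k = 3 then Part 2 (x 2 5) else
        if k = 4 then Part 4 (x 4 1) else if k = 5 then Part 4 (x 4 2) else Part 1 (x 1 6))
     else
       (if k = 1 then Part 3 (x 3 4) else if k = 2 then Part 3 (x 3 5) else if k = 3 then Qv else
        if k = 4 then Part 1 (x 1 1) else if k = 5 then Part 1 (x 1 2) else Part 2 (x 2 6)))"

definition link :: "(nat \<Rightarrow> nat \<Rightarrow> vertex) \<Rightarrow> nat \<Rightarrow> nat \<Rightarrow> vertex set" where
  "link x j k = {foot x (j, k), mate x j k}"

definition link_sum :: "(nat \<Rightarrow> nat \<Rightarrow> vertex) \<Rightarrow> (vertex set \<Rightarrow> nat) \<Rightarrow> nat" where
  "link_sum x h =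
     h {Part 1 (x 1 1), Part 4 (x 4 4)} + h {Part 1 (x 1 2), Part 4 (x 4 5)} +
     h {Part 4 (x 4 1), Part 3 (x 3 4)} + h {Part 4 (x 4 2), Part 3 (x 3 5)} +
     h {Part 3 (x 3 1), Part 2 (x 2 4)} + h {Part 3 (x 3 2), Part 2 (x 2 5)} +
     h {Part 2 (x 2 1), Part 1 (x 1 4)} + h {Part 2 (x 2 2), Part 1 (x 1 5)} +
     h {Part 1 (x 1 6), Part 3 (x 3 6)} + h {Part 2 (x 2 6), Part 4 (x 4 6)} +
     h {Part 1 (x 1 2), Pv} + h {Part 3 (x 3 2), Pv} + h {Part 2 (x 2 2), Qv} + h {Part 4 (x 4 2), Qv}"

lemma edges_assembleE:
  assumes "e \<in> edges (assemble P x z)"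
  obtains i f where "i \<in> {1..4}" "f \<in> edges (core (P i) (x i) (z i))" "e = Part i ` f" | "e \<in> link_edges x"
  using assms unfolding assemble_def by auto

text \<open>Such an edge joins two different parts or has the end \<open>Pv\<close> or
  \<open>Qv\<close>.\<close>

lemma link_edge_not_Part: "e \<in> link_edges x \<Longrightarrow> e \<noteq> Part i ` f"
proof
  assume e: "e \<in> link_edges x" "e = Part i ` f"
  have "\<not> e \<subseteq> range (Part i)"
    using e(1) unfolding link_edges_eq by (elim insertE) (simp_all add: image_iff)
  then show False using e(2) by blast
qed

locale assembly =
  fixes Q F :: "nat \<Rightarrow> vertex ugraph" and x z :: "nat \<Rightarrow> nat \<Rightarrow> vertex"
  assumes parts: "i \<in> {1..4} \<Longrightarrow> labelled (Q i) (F i) (x i) (z i)"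
begin

abbreviation "H \<equiv> H_graph Q x z"
abbreviation "FH \<equiv> H_factor F x z"
abbreviation "coreQ i \<equiv> core (Q i) (x i) (z i)"
abbreviation "coreF i \<equiv> core (F i) (x i) (z i)"

lemma part: "labelled (Q 1) (F 1) (x 1) (z 1)" "labelled (Q 2) (F 2) (x 2) (z 2)"
  "labelled (Q 3) (F 3) (x 3) (z 3)" "labelled (Q 4) (F 4) (x 4) (z 4)"
  using parts by auto

lemmas distinct_labels = part[THEN labelled.distinct_verts] part[THEN labelled.distinct_verts']

lemma sum_link_edges: "(\<Sum>e\<in>link_edges x. h e) = link_sum x h"
  unfolding link_edges_eq link_sum_def using distinct_labels by (simp add: doubleton_eq_iff)

text \<open>\<open>P\<close> stands for \<open>Q\<close> or for \<open>F\<close>, so that counts in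
  the graph and in its 2-factor come from the same formula.\<close>

lemma sum_assemble:
  fixes h :: "vertex set \<Rightarrow> nat"
  assumes "\<And>i. i \<in> {1..4} \<Longrightarrow> simple_graph (core (P i) (x i) (z i))"
  shows "(\<Sum>e\<in>edges (assemble P x z). h e) =
    (\<Sum>i\<in>{1..4}. \<Sum>e\<in>edges (core (P i) (x i) (z i)). h (Part i ` e)) + link_sum x h"
proof -
  let ?E = "\<lambda>i. edges (core (P i) (x i) (z i))"
  let ?U = "\<Union>i\<in>{1..4}. (\<lambda>e. Part i ` e) ` ?E i"
  have fin: "finite (?E i)" if "i \<in> {1..4}" for i using simple_graph_finite_edges assms that by blast
  have ne: "e \<noteq> {}" if "i \<in> {1..4}" "e \<in> ?E i" for i e
    using assms[OF that(1)] that(2) by (auto simp: simple_graph_def)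
  have dis: "(\<lambda>e. Part i ` e) ` ?E i \<inter> (\<lambda>e. Part j ` e) ` ?E j = {}"
    if "i \<in> {1..4}" "j \<in> {1..4}" "i \<noteq> j" for i j
  proof -
    have "Part i ` e \<noteq> Part j ` f" if "e \<in> ?E i" for e f
      using ne[OF \<open>i \<in> {1..4}\<close> that] \<open>i \<noteq> j\<close> by (metis Part_mem_image ex_in_conv)
    then show ?thesis by blast
  qed
  have "?U \<inter> link_edges x = {}" using link_edge_not_Part by blast
  moreover have "finite (link_edges x)" unfolding link_edges_eq by simp
  moreover have "finite ?U" using fin by blast
  ultimately have "(\<Sum>e\<in>edges (assemble P x z). h e) = (\<Sum>e\<in>?U. h e) + (\<Sum>e\<in>link_edges x. h e)"
    unfolding assemble_def ugraph.simps by (intro sum.union_disjoint) auto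
  also have "(\<Sum>e\<in>?U. h e) = (\<Sum>i\<in>{1..4}. \<Sum>e\<in>(\<lambda>e. Part i ` e) ` ?E i. h e)"
    using fin dis by (intro sum.UNION_disjoint) auto
  also have "\<dots> = (\<Sum>i\<in>{1..4}. \<Sum>e\<in>?E i. h (Part i ` e))"
    by (simp add: sum.reindex[OF inj_image_Part])
  finally show ?thesis unfolding sum_link_edges .
qed

lemma simple_cores: "i \<in> {1..4} \<Longrightarrow> simple_graph (coreQ i)" "i \<in> {1..4} \<Longrightarrow> simple_graph (coreF i)"
  using parts labelled.simple_core by blast+

text \<open>Constant weight 1 gives degrees, the indicator of a colour gives colour degrees. The
  vertex \<open>x j 2\<close> occurs twice because it carries both \<open>e\<^sub>2\<close> and
  \<open>e\<^sub>3\<close>.\<close>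

lemma sum_incident_edges:
  fixes g :: "vertex set \<Rightarrow> nat"
  assumes P: "\<And>i. i \<in> {1..4} \<Longrightarrow> simple_graph (core (P i) (x i) (z i))" and j: "j \<in> {1..4}"
  shows "(\<Sum>e\<in>edges (assemble P x z). of_bool (Part j y \<in> e) * g e) =
    (\<Sum>e\<in>edges (core (P j) (x j) (z j)). of_bool (y \<in> e) * g (Part j ` e)) +
    of_bool (y = x j 1) * g (link x j 1) + of_bool (y = x j 2) * g (link x j 2) +
    of_bool (y = x j 2) * g (link x j 3) + of_bool (y = x j 4) * g (link x j 4) +
    of_bool (y = x j 5) * g (link x j 5) + of_bool (y = x j 6) * g (link x j 6)"
proof -
  have "(\<Sum>i\<in>{1..4}. \<Sum>e\<in>edges (core (P i) (x i) (z i)). of_bool (Part j y \<in> Part i ` e) * g (Part i ` e)) =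
      (\<Sum>i\<in>{1..4}. if i = j then \<Sum>e\<in>edges (core (P j) (x j) (z j)). of_bool (y \<in> e) * g (Part j ` e) else 0)"
    by (intro sum.cong) auto
  also have "\<dots> = (\<Sum>e\<in>edges (core (P j) (x j) (z j)). of_bool (y \<in> e) * g (Part j ` e))"
    using j by simp
  finally have 1: "(\<Sum>e\<in>edges (assemble P x z). of_bool (Part j y \<in> e) * g e) =
      (\<Sum>e\<in>edges (core (P j) (x j) (z j)). of_bool (y \<in> e) * g (Part j ` e)) +
      link_sum x (\<lambda>e. of_bool (Part j y \<in> e) * g e)"
    using sum_assemble[OF P, of "\<lambda>e. of_bool (Part j y \<in> e) * g e"] by simp
  have "link_sum x (\<lambda>e. of_bool (Part j y \<in> e) * g e) =
    of_bool (y = x j 1) * g (link x j 1) + of_bool (y = x j 2) * g (link x j 2) +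
    of_bool (y = x j 2) * g (link x j 3) + of_bool (y = x j 4) * g (link x j 4) +
    of_bool (y = x j 5) * g (link x j 5) + of_bool (y = x j 6) * g (link x j 6)"
    using j unfolding in_1_4
    by (elim disjE) (simp_all add: link_sum_def link_def foot_def mate_def insert_commute)
  then show ?thesis unfolding 1 by simp
qed

lemma sum_incident_Pv:
  assumes "\<And>i. i \<in> {1..4} \<Longrightarrow> simple_graph (core (P i) (x i) (z i))"
  shows "(\<Sum>e\<in>edges (assemble P x z). of_bool (Pv \<in> e) * g e) = (g (link x 1 2) + g (link x 3 2) :: nat)"
    "(\<Sum>e\<in>edges (assemble P x z). of_bool (Qv \<in> e) * g e) = (g (link x 2 3) + g (link x 4 3) :: nat)"
  by (subst sum_assemble[OF assms]; simp add: link_sum_def link_def foot_def mate_def image_iff)+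

lemma verts_H: "verts H = (\<Union>i\<in>{1..4}. Part i ` verts (coreQ i)) \<union> {Pv, Qv}"
  by (simp add: H_graph_def assemble_def)

lemma verts_FH: "verts FH = verts H"
proof -
  have "verts (coreF i) = verts (coreQ i)" if "i \<in> {1..4}" for i
    using labelled.verts_core[OF parts[OF that]] by simp
  then show ?thesis by (simp add: H_factor_def H_graph_def assemble_def)
qed

lemma Part_in_H: "i \<in> {1..4} \<Longrightarrow> Part i v \<in> verts H \<longleftrightarrow> v \<in> verts (coreQ i)"
  and Pv_Qv_in_H: "Pv \<in> verts H" "Qv \<in> verts H"
  by (auto simp: verts_H)

lemma edges_H: "edges H = insert {Pv, Qv} (edges (assemble Q x z))"
  by (simp add: H_graph_def)

lemma vertex_cases_H:
  assumes "v \<in> verts H"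
  obtains i y where "i \<in> {1..4}" "y \<in> verts (coreQ i)" "v = Part i y" | "v = Pv" | "v = Qv"
  using assms unfolding verts_H by blast

lemma card_H_subset:
  assumes "A \<subseteq> verts H"
  shows "card A = (\<Sum>i\<in>{1..4}. card (Part i -` A)) + of_bool (Pv \<in> A) + of_bool (Qv \<in> A)"
proof -
  have sub: "Part i -` A \<subseteq> verts (coreQ i)" if "i \<in> {1..4}" for i using assms Part_in_H that by blast
  have fin: "finite (verts (coreQ i))" if "i \<in> {1..4}" for i
    using simple_cores(1)[OF that] by (simp add: simple_graph_def)
  let ?U = "\<Union>i\<in>{1..4}. Part i ` (Part i -` A)"
  have A: "A = ?U \<union> {v \<in> {Pv, Qv}. v \<in> A}" using assms unfolding verts_H by auto
  have finU: "finite ?U" 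
    by (rule finite_UN_I[OF finite_atLeastAtMost finite_imageI[OF finite_subset[OF sub fin]]])
  have "card A = card ?U + card {v \<in> {Pv, Qv}. v \<in> A}"
    by (subst A, rule card_Un_disjoint) (use finU in auto)
  also have "card ?U = (\<Sum>i\<in>{1..4}. card (Part i ` (Part i -` A)))"
  proof (rule card_UN_disjoint)
    show "\<forall>i\<in>{1..4}. finite (Part i ` (Part i -` A))"
      using finite_imageI[OF finite_subset[OF sub fin]] by blast
  qed auto
  also have "\<dots> = (\<Sum>i\<in>{1..4}. card (Part i -` A))"
    by (intro sum.cong card_image) (auto simp: inj_on_def)
  also have "card {v \<in> {Pv, Qv}. v \<in> A} = of_bool (Pv \<in> A) + of_bool (Qv \<in> A)"
    unfolding Collect_insert by simp
  finally show ?thesis by simp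
qed

text \<open>Each of the four parts loses two vertices, and two new ones are added. With three
  Petersen graphs a stage therefore gains 30 - 6 = 24 vertices.\<close>

lemma card_verts_H: "card (verts H) + 6 = (\<Sum>i\<in>{1..4}. card (verts (Q i)))"
proof -
  have "card (Part i -` verts H) + 2 = card (verts (Q i))" if "i \<in> {1..4}" for i
  proof -
    have "Part i -` verts H = verts (coreQ i)" using Part_in_H[OF that] by auto
    then show ?thesis using parts[OF that, THEN labelled.card_core] by simp
  qed
  then have "(\<Sum>i\<in>{1..4}. card (verts (Q i))) = (\<Sum>i\<in>{1..4}. card (Part i -` verts H) + 2)" by simp
  then show ?thesis using card_H_subset[OF subset_refl] Pv_Qv_in_H unfolding sum_1_4 by simp
qed

lemma simple_assemble: "simple_graph (assemble Q x z)" "simple_graph FH"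
proof -
  have vF: "verts (coreF i) = verts (coreQ i)" if "i \<in> {1..4}" for i
    using parts[OF that] labelled.verts_core by metis
  have lab: "x i 1 \<in> verts (coreQ i)" "x i 2 \<in> verts (coreQ i)" "x i 4 \<in> verts (coreQ i)" "x i 5 \<in> verts (coreQ i)"
    "x i 6 \<in> verts (coreQ i)" if "i \<in> {1..4}" for i
    using parts[OF that] labelled.labels_in_core by blast+
  have l: "e \<subseteq> verts H \<and> card e = 2" if "e \<in> link_edges x" for e
    using that unfolding link_edges_eq by (elim insertE) (simp_all add: Part_in_H Pv_Qv_in_H lab)
  have c: "Part i ` e \<subseteq> verts H \<and> card (Part i ` e) = 2" if "i \<in> {1..4}" "e \<subseteq> verts (coreQ i) \<and> card e = 2" for i e
    using that card_image[of "Part i" e] by (auto simp: Part_in_H inj_on_def)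
  have fin: "finite (verts H)"
    unfolding verts_H using simple_cores(1) by (auto simp: simple_graph_def)
  have "e \<subseteq> verts (coreQ i) \<and> card e = 2" if "i \<in> {1..4}" "e \<in> edges (coreQ i)" for i e
    using simple_cores(1)[OF that(1)] that(2) by (simp add: simple_graph_def)
  then have "\<forall>e\<in>edges (assemble Q x z). e \<subseteq> verts H \<and> card e = 2"
    using l c edges_assembleE by metis
  moreover have "verts (assemble Q x z) = verts H" by (simp add: H_graph_def)
  ultimately show "simple_graph (assemble Q x z)" using fin by (simp add: simple_graph_def)
  have "e \<subseteq> verts (coreQ i) \<and> card e = 2" if "i \<in> {1..4}" "e \<in> edges (coreF i)" for i e
    using simple_cores(2)[OF that(1)] that vF by (simp add: simple_graph_def)
  then have "\<forall>e\<in>edges FH. e \<subseteq> verts H \<and> card e = 2"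
    using l c edges_assembleE unfolding H_factor_def by metis
  then show "simple_graph FH" using fin by (simp add: simple_graph_def verts_FH)
qed

lemma alpha_notin_assemble: "{Pv, Qv} \<notin> edges (assemble P x z)"
  unfolding assemble_def ugraph.simps link_edges_eq by (auto simp: doubleton_eq_iff set_eq_iff)

lemma simple_H: "simple_graph H"
  using simple_assemble(1) unfolding simple_graph_def edges_H by (auto simp: H_graph_def assemble_def)

lemma edges_FH_subset: "edges FH \<subseteq> edges (assemble Q x z)"
proof -
  have "edges (coreF i) \<subseteq> edges (coreQ i)" if "i \<in> {1..4}" for i
    using labelled.edges_F[OF parts[OF that]] by (auto simp: core_def delete_edges_def delete_vertices_def)
  then show ?thesis unfolding H_factor_def assemble_def ugraph.simps by blast
qed

lemma Part_edge_iff: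
  assumes "i \<in> {1..4}" "e \<noteq> {}"
  shows "Part i ` e \<in> edges (assemble P x z) \<longleftrightarrow> e \<in> edges (core (P i) (x i) (z i))"
proof -
  have "e = f \<and> i = j" if "Part i ` e = Part j ` f" for j f
    using that assms(2) by (metis Part_mem_image equals0I image_eqI inj_image_eq_iff injI vertex.inject(2))
  then show ?thesis using assms(1) link_edge_not_Part[of _ x i e]
    unfolding assemble_def ugraph.simps by blast
qed

text \<open>Comparing the sums over edges of \<open>Q i\<close> and of the assembled graph, each
  edge lost at a label is replaced by a half-edge there; \<open>x i 2\<close> loses two edges and
  receives two.\<close>

lemma degree_part:
  assumes "i \<in> {1..4}" "y \<in> verts (coreQ i)"
  shows "degree (assemble Q x z) (Part i y) = 3" "degree FH (Part i y) = 2"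
proof -
  interpret labelled "Q i" "F i" "x i" "z i" using parts assms(1) .
  have y: "y \<in> verts (Q i)" "y \<noteq> z i 1" "y \<noteq> z i 2" using assms(2) by (auto simp: verts_core)
  have d: "degree (Q i) y = 3" "degree (F i) y = 2"
    using cubic factor y(1) by (auto simp: cubic_def regular_def two_factor_def verts_F)
  have fin: "finite (edges (assemble Q x z))" "finite (edges FH)"
    using simple_assemble simple_graph_finite_edges by blast+
  show "degree (assemble Q x z) (Part i y) = 3"
    using sum_incident_edges[OF simple_cores(1) assms(1), of y "\<lambda>_. 1"] d(1) y(2,3) distinct_verts distinct_verts'
    unfolding degree_sum[OF fin(1)] degree_sum[OF finite_edges(1)] sum_edges_core by auto
  show "degree FH (Part i y) = 2"
    using sum_incident_edges[OF simple_cores(2) assms(1), of y "\<lambda>_. 1"] d(2) y(2,3) distinct_verts distinct_verts'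
    unfolding degree_sum[OF fin(2)] degree_sum[OF finite_edges(2)] sum_edges_core by (auto simp: H_factor_def)
qed

lemma degree_Pv_Qv:
  "degree (assemble Q x z) Pv = 2" "degree (assemble Q x z) Qv = 2" "degree FH Pv = 2" "degree FH Qv = 2"
proof -
  have fin: "finite (edges (assemble Q x z))" "finite (edges FH)"
    using simple_assemble simple_graph_finite_edges by blast+
  show "degree (assemble Q x z) Pv = 2" "degree (assemble Q x z) Qv = 2"
    unfolding degree_sum[OF fin(1)]
    using sum_incident_Pv[OF simple_cores(1), of "\<lambda>_. 1"] by simp_all
  show "degree FH Pv = 2" "degree FH Qv = 2"
    unfolding degree_sum[OF fin(2)]
    using sum_incident_Pv[OF simple_cores(2), of "\<lambda>_. 1"] by (simp_all add: H_factor_def)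
qed

lemma degree_H: "degree H v = degree (assemble Q x z) v + of_bool (v = Pv \<or> v = Qv)"
proof -
  have fin: "finite (edges (assemble Q x z))" "finite (edges H)"
    using simple_assemble(1) simple_H simple_graph_finite_edges by blast+
  show ?thesis
    unfolding degree_sum[OF fin(1)] degree_sum[OF fin(2)] edges_H
    using fin(1) alpha_notin_assemble by simp
qed

lemma cubic_H: "cubic H"
proof -
  have "degree H v = 3" if "v \<in> verts H" for v
    using that by (cases rule: vertex_cases_H) (simp_all add: degree_H degree_part degree_Pv_Qv)
  then show ?thesis using simple_H by (simp add: cubic_def regular_def)
qed

lemma two_factor_H: "two_factor H FH"
proof -
  have "degree FH v = 2" if "v \<in> verts H" for v
    using that by (cases rule: vertex_cases_H) (simp_all add: degree_part degree_Pv_Qv)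
  then show ?thesis using simple_assemble(2) edges_FH_subset
    by (auto simp: two_factor_def subgraph_def regular_def verts_FH edges_H)
qed

text \<open>A vertex set is decomposed into its traces on the four cores and its intersection with
  \<open>{Pv, Qv}\<close>. Sizes and cuts add up, so the claim becomes an instance of
  \<open>assembly_cut\<close>.\<close>

lemma cut_H:
  assumes A: "A \<subseteq> verts H"
  shows "min (tree_cut (card A)) (tree_cut (card (verts H - A))) \<le> cut (edges H) A"
proof -
  have fin: "finite (edges (assemble Q x z))" "finite (edges H)"
    using simple_assemble(1) simple_H simple_graph_finite_edges by blast+
  let ?A = "\<lambda>i. Part i -` A"
  have sub: "?A i \<subseteq> verts (coreQ i)" if "i \<in> {1..4}" for i using A Part_in_H that by blast
  have pc: "part_cut (x i 1 \<in> ?A i) (x i 2 \<in> ?A i) (x i 4 \<in> ?A i) (x i 5 \<in> ?A i) (x i 6 \<in> ?A i)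
      (card (?A i)) (card (verts (coreQ i) - ?A i)) (cut (edges (coreQ i)) (?A i))" if "i \<in> {1..4}" for i
    using labelled.part_cut_core[OF parts[OF that] sub[OF that]] .
  have 1: "card A = card (?A 1) + card (?A 2) + card (?A 3) + card (?A 4) + of_bool (Pv \<in> A) + of_bool (Qv \<in> A)"
    unfolding card_H_subset[OF A] sum_1_4 ..
  have "Part i -` (verts H - A) = verts (coreQ i) - ?A i" if "i \<in> {1..4}" for i
    using Part_in_H[OF that] by auto
  then have 2: "card (verts H - A) = card (verts (coreQ 1) - ?A 1) + card (verts (coreQ 2) - ?A 2) +
      card (verts (coreQ 3) - ?A 3) + card (verts (coreQ 4) - ?A 4) + of_bool (\<not> Pv \<in> A) + of_bool (\<not> Qv \<in> A)"
    unfolding card_H_subset[OF Diff_subset] sum_1_4 using Pv_Qv_in_H by simp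
  have "cut (edges (coreQ i)) (?A i) = (\<Sum>e\<in>edges (coreQ i). of_bool (crosses A (Part i ` e)))" if "i \<in> {1..4}" for i
    unfolding cut_sum[OF simple_graph_finite_edges[OF simple_cores(1)[OF that]]] by (simp only: crosses_Part)
  then have "cut (edges (assemble Q x z)) A = (\<Sum>i\<in>{1..4}. cut (edges (coreQ i)) (?A i)) +
      link_sum x (\<lambda>e. of_bool (crosses A e))"
    unfolding cut_sum[OF fin(1)]
    using sum_assemble[OF simple_cores(1), of "\<lambda>e. of_bool (crosses A e)"] by simp
  moreover have "cut (edges H) A = cut (edges (assemble Q x z)) A + of_bool ((Pv \<in> A) \<noteq> (Qv \<in> A))"
    unfolding edges_H cut_sum[OF fin(1)] cut_sum[OF fin(2)[unfolded edges_H]] using fin(1) alpha_notin_assemble by simp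
  ultimately have 3: "cut (edges H) A = cut (edges (coreQ 1)) (?A 1) + cut (edges (coreQ 2)) (?A 2) + cut (edges (coreQ 3)) (?A 3) +
      cut (edges (coreQ 4)) (?A 4) + link_sum x (\<lambda>e. of_bool (crosses A e)) + of_bool ((Pv \<in> A) \<noteq> (Qv \<in> A))"
    unfolding sum_1_4 by simp
  show ?thesis
    unfolding 1 2 3 link_sum_def crosses_pair
    using assembly_cut[OF pc[of 1] pc[of 2] pc[of 3] pc[of 4], of "Pv \<in> A" "Qv \<in> A"]
    by (simp add: add_ac)
qed

end

section \<open>Pair colourings of the assembled graph\<close>

definition part_type :: "'c \<Rightarrow> 'c \<Rightarrow> 'c \<Rightarrow> 'c \<Rightarrow> 'c \<Rightarrow> 'c \<Rightarrow> bool" where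
  "part_type a1 a2 a3 a4 a5 a6 \<longleftrightarrow> a2 \<noteq> a3 \<and>
    ((a1 = a2 \<and> a6 = a3 \<or> a1 = a3 \<and> a6 = a2) \<and> a4 = a5 \<or>
     a1 \<noteq> a2 \<and> a1 \<noteq> a3 \<and> a4 \<noteq> a5 \<and> a4 \<noteq> a6 \<and> a5 \<noteq> a6 \<and> {a4, a5, a6} = {a1, a2, a3})"

text \<open>The letters \<open>p\<close>, \<open>q\<close> are the colours at the vertices \<open>p\<close>, \<open>q\<close>, and \<open>g\<close> those of the glued edges.\<close>

lemma part_types_incompatible:
  assumes 1: "part_type g1 p1 g2 g7 g8 g9" and 2: "part_type g7 g8 q2 g5 g6 g10"
    and 3: "part_type g5 p3 g6 g3 g4 g9" and 4: "part_type g3 g4 q4 g1 g2 g10"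
    and pq: "same_pair p1 p3 q2 q4"
  shows False
proof (cases "g7 = g8")
  \<comment> \<open>Equality of the colours of \<open>e\<^sub>4\<close> and \<open>e\<^sub>5\<close>
    is handed from part 1 to part 2, then to 3 and 4. Parts 2 and 4 then force \<open>q2\<close> and
    \<open>q4\<close> to equal the colour \<open>g10\<close> of the edge that joins them, but the
    two colours at \<open>q\<close> are distinct.\<close>
  case True
  then have "g5 = g6" "g10 = q2" using 1 2 unfolding part_type_def by blast+
  then have "g3 = g4" using 3 unfolding part_type_def by blast
  then have "g10 = q4" using 4 unfolding part_type_def by blast
  then show False using \<open>g10 = q2\<close> pq unfolding same_pair_def by blast
next
  \<comment> \<open>Now parts 1, 4, 3, 2 are in turn of the second type, in which
    \<open>e\<^sub>1\<close>, \<open>e\<^sub>2\<close>, \<open>e\<^sub>3\<close> have three distinct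
    colours, and these recur on \<open>e\<^sub>4\<close>, \<open>e\<^sub>5\<close>,
    \<open>e\<^sub>6\<close>.\<close>
  case False
  then have n1: "g1 \<noteq> g2" "p1 \<noteq> g1" "p1 \<noteq> g2" "p1 \<in> {g7, g8, g9}"
    using 1 unfolding part_type_def by auto
  then have n4: "g3 \<noteq> g4" "q4 \<noteq> g3" "q4 \<noteq> g4" "q4 \<in> {g1, g2, g10}"
    using 4 unfolding part_type_def by auto
  then have n3: "g5 \<noteq> g6" "p3 \<noteq> g5" "p3 \<noteq> g6" "p3 \<in> {g3, g4, g9}"
    using 3 unfolding part_type_def by auto
  then have n2: "q2 \<noteq> g7" "q2 \<noteq> g8" "q2 \<in> {g5, g6, g10}"
    using 2 unfolding part_type_def by auto
  \<comment> \<open>If \<open>p1 = q2\<close> and \<open>p3 = q4\<close>, then both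
    \<open>p1\<close> and \<open>p3\<close> can only be \<open>g9\<close>; if \<open>p1 = q4\<close>
    and \<open>p3 = q2\<close>, then both \<open>q4\<close> and \<open>q2\<close> can only be
    \<open>g10\<close>. Either way two distinct colours coincide.\<close>
  show False using n1 n2 n3 n4 pq unfolding same_pair_def by auto
qed

context assembly
begin

lemma link_glued:
  "link x 4 4 = link x 1 1" "link x 4 5 = link x 1 3" "link x 3 4 = link x 4 1" "link x 3 5 = link x 4 2"
  "link x 2 4 = link x 3 1" "link x 2 5 = link x 3 3" "link x 1 4 = link x 2 1" "link x 1 5 = link x 2 2"
  "link x 3 6 = link x 1 6" "link x 4 6 = link x 2 6"
  by (simp_all add: link_def foot_def mate_def insert_commute)

text \<open>Restricted to one part, a colouring of the assembled factor is exactly what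
  \<open>part_degree\<close> counts, if each half-edge is given the colour of the edge it becomes in
  \<open>H\<close>.\<close>

lemma colour_degree_part:
  assumes "i \<in> {1..4}"
  shows "colour_degree FH \<phi> c (Part i y) =
    labelled.part_degree (F i) (x i) (z i) (\<lambda>e. \<phi> (Part i ` e)) (\<lambda>k. \<phi> (link x i k)) c y"
proof -
  have fin: "finite (edges FH)" "finite (edges (coreF i))"
    using simple_assemble(2) simple_cores(2)[OF assms] simple_graph_finite_edges by blast+
  have "colour_degree FH \<phi> c (Part i y) = (\<Sum>e\<in>edges FH. of_bool (Part i y \<in> e) * of_bool (\<phi> e = c))"
    unfolding colour_degree_def of_bool_conj[symmetric] using fin(1) by (simp add: sum_of_bool_eq Int_def)
  also have "\<dots> = (\<Sum>e\<in>edges (coreF i). of_bool (y \<in> e) * of_bool (\<phi> (Part i ` e) = c)) +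
    of_bool (y = x i 1) * of_bool (\<phi> (link x i 1) = c) + of_bool (y = x i 2) * of_bool (\<phi> (link x i 2) = c) +
    of_bool (y = x i 2) * of_bool (\<phi> (link x i 3) = c) + of_bool (y = x i 4) * of_bool (\<phi> (link x i 4) = c) +
    of_bool (y = x i 5) * of_bool (\<phi> (link x i 5) = c) + of_bool (y = x i 6) * of_bool (\<phi> (link x i 6) = c)"
    unfolding H_factor_def using simple_cores(2) assms by (rule sum_incident_edges)
  also have "(\<Sum>e\<in>edges (coreF i). of_bool (y \<in> e) * of_bool (\<phi> (Part i ` e) = c)) =
      card {f \<in> edges (coreF i). y \<in> f \<and> \<phi> (Part i ` f) = c}"
    unfolding of_bool_conj[symmetric] using fin(2) by (simp add: sum_of_bool_eq Int_def)
  finally show ?thesis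
    unfolding labelled.part_degree_def[OF parts[OF assms]] of_bool_conj .
qed

lemma colour_degree_Pv_Qv:
  "colour_degree FH \<phi> c Pv = of_bool (\<phi> (link x 1 2) = c) + of_bool (\<phi> (link x 3 2) = c)"
  "colour_degree FH \<phi> c Qv = of_bool (\<phi> (link x 2 3) = c) + of_bool (\<phi> (link x 4 3) = c)"
proof -
  have "finite (edges FH)" using simple_assemble(2) simple_graph_finite_edges by blast
  then have "colour_degree FH \<phi> c v = (\<Sum>e\<in>edges FH. of_bool (v \<in> e) * of_bool (\<phi> e = c))" for v
    unfolding colour_degree_def of_bool_conj[symmetric] by (simp add: sum_of_bool_eq Int_def)
  then show "colour_degree FH \<phi> c Pv = of_bool (\<phi> (link x 1 2) = c) + of_bool (\<phi> (link x 3 2) = c)"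
    "colour_degree FH \<phi> c Qv = of_bool (\<phi> (link x 2 3) = c) + of_bool (\<phi> (link x 4 3) = c)"
    unfolding H_factor_def
    using sum_incident_Pv[OF simple_cores(2), of "\<lambda>e. of_bool (\<phi> e = c)"] by (simp_all only:)
qed

lemma part_edge_H:
  assumes i: "i \<in> {1..4}" and e: "e \<in> edges (coreQ i) - edges (coreF i)"
  shows "Part i ` e \<in> edges H - edges FH"
proof -
  have "e \<noteq> {}" using e simple_cores(1)[OF i] by (auto simp: simple_graph_def)
  then show ?thesis using e Part_edge_iff[OF i] by (simp add: edges_H H_factor_def)
qed

lemma part_type_H:
  fixes \<phi> :: "vertex set \<Rightarrow> nat"
  assumes pc: "pair_colouring H FH \<phi>" and i: "i \<in> {1..4}"
  shows "part_type (\<phi> (link x i 1)) (\<phi> (link x i 2)) (\<phi> (link x i 3)) (\<phi> (link x i 4)) (\<phi> (link x i 5)) (\<phi> (link x i 6))"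
proof -
  let ?d = "labelled.part_degree (F i) (x i) (z i) (\<lambda>e. \<phi> (Part i ` e)) (\<lambda>k. \<phi> (link x i k))"
  have le: "?d c v \<le> 1" if "v \<in> verts (coreQ i)" for c v
    using pc that Part_in_H[OF i] unfolding pair_colouring_def colour_degree_part[OF i, symmetric] by blast
  have eq: "?d c u = ?d c v" if "{u, v} \<in> edges (coreQ i) - edges (coreF i)" for c u v
  proof -
    have "{Part i u, Part i v} \<in> edges H - edges FH" using part_edge_H[OF i that] by simp
    then show ?thesis using pc unfolding pair_colouring_def colour_degree_part[OF i, symmetric] by blast
  qed
  show ?thesis
    unfolding part_type_def
    using labelled.part_colours_distinct[OF parts[OF i] le eq] labelled.part_colours[OF parts[OF i] le eq]
    by (simp only: simp_thms)
qed

lemma not_pair_colouring_H: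
  fixes \<phi> :: "vertex set \<Rightarrow> nat"
  shows "\<not> pair_colouring H FH \<phi>"
proof
  assume pc: "pair_colouring H FH \<phi>"
  have t: "part_type (\<phi> (link x 1 1)) (\<phi> (link x 1 2)) (\<phi> (link x 1 3)) (\<phi> (link x 2 1)) (\<phi> (link x 2 2)) (\<phi> (link x 1 6))"
    "part_type (\<phi> (link x 2 1)) (\<phi> (link x 2 2)) (\<phi> (link x 2 3)) (\<phi> (link x 3 1)) (\<phi> (link x 3 3)) (\<phi> (link x 2 6))"
    "part_type (\<phi> (link x 3 1)) (\<phi> (link x 3 2)) (\<phi> (link x 3 3)) (\<phi> (link x 4 1)) (\<phi> (link x 4 2)) (\<phi> (link x 1 6))"
    "part_type (\<phi> (link x 4 1)) (\<phi> (link x 4 2)) (\<phi> (link x 4 3)) (\<phi> (link x 1 1)) (\<phi> (link x 1 3)) (\<phi> (link x 2 6))"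
    using part_type_H[OF pc, of 1] part_type_H[OF pc, of 2] part_type_H[OF pc, of 3] part_type_H[OF pc, of 4]
    by (simp_all add: link_glued)
  have "{Pv, Qv} \<in> edges H - edges FH" using alpha_notin_assemble by (simp add: edges_H H_factor_def)
  then have "colour_degree FH \<phi> c Pv \<le> 1" "colour_degree FH \<phi> c Pv = colour_degree FH \<phi> c Qv" for c
    using pc Pv_Qv_in_H unfolding pair_colouring_def by blast+
  then have "same_pair (\<phi> (link x 1 2)) (\<phi> (link x 3 2)) (\<phi> (link x 2 3)) (\<phi> (link x 4 3))"
    unfolding same_pair_iff colour_degree_Pv_Qv by blast
  then show False using part_types_incompatible[OF t] by blast
qed

section \<open>The two circuits of the 2-factor of the assembled graph\<close>

definition circuits_of :: "nat \<Rightarrow> vertex set \<times> vertex set \<Rightarrow> bool" where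
  "circuits_of i KL \<longleftrightarrow> halves (Q i) (F i) (fst KL) (snd KL) \<and>
     x i 1 \<in> fst KL \<and> x i 2 \<in> fst KL \<and> z i 2 \<in> fst KL \<and> x i 6 \<in> fst KL \<and>
     x i 4 \<in> snd KL \<and> z i 1 \<in> snd KL \<and> x i 5 \<in> snd KL"

lemma ex_circuits_of: "i \<in> {1..4} \<Longrightarrow> \<exists>KL. circuits_of i KL"
  by (rule labelled.circuits[OF parts]) (auto simp: circuits_of_def intro!: exI)

definition circ1 where "circ1 i = fst (SOME KL. circuits_of i KL)"
definition circ2 where "circ2 i = snd (SOME KL. circuits_of i KL)"

lemma circ:
  assumes "i \<in> {1..4}"
  shows "halves (Q i) (F i) (circ1 i) (circ2 i)" "x i 1 \<in> circ1 i" "x i 2 \<in> circ1 i" "z i 2 \<in> circ1 i" "x i 6 \<in> circ1 i"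
    "x i 4 \<in> circ2 i" "z i 1 \<in> circ2 i" "x i 5 \<in> circ2 i"
  using someI_ex[OF ex_circuits_of[OF assms]] by (auto simp: circuits_of_def circ1_def circ2_def)

text \<open>The circuit through \<open>p\<close>. In cyclic order it passes \<open>p\<close>, the
  vertex \<open>x 1 2\<close>, the path of the second circuit of part 4, the paths of the first
  circuits of parts 1 and 3, the path of the second circuit of part 2, and
  \<open>x 3 2\<close>.\<close>

definition H1 where
  "H1 = insert Pv (Part 1 ` (circ1 1 - {z 1 2}) \<union> Part 3 ` (circ1 3 - {z 3 2}) \<union>
     Part 2 ` (circ2 2 - {z 2 1}) \<union> Part 4 ` (circ2 4 - {z 4 1}))"

text \<open>The circuit through \<open>q\<close>: after \<open>q\<close> come \<open>x 2 2\<close>,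
  the path of the second circuit of part 1, the paths of the first circuits of parts 2 and 4, the
  path of the second circuit of part 3, and \<open>x 4 2\<close>.\<close>

definition H2 where
  "H2 = insert Qv (Part 2 ` (circ1 2 - {z 2 2}) \<union> Part 4 ` (circ1 4 - {z 4 2}) \<union>
     Part 1 ` (circ2 1 - {z 1 1}) \<union> Part 3 ` (circ2 3 - {z 3 1}))"

lemma Part_in_H12:
  "Part i y \<in> H1 \<longleftrightarrow> (i = 1 \<or> i = 3) \<and> y \<in> circ1 i - {z i 2} \<or> (i = 2 \<or> i = 4) \<and> y \<in> circ2 i - {z i 1}"
  "Part i y \<in> H2 \<longleftrightarrow> (i = 2 \<or> i = 4) \<and> y \<in> circ1 i - {z i 2} \<or> (i = 1 \<or> i = 3) \<and> y \<in> circ2 i - {z i 1}"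
  "Pv \<in> H1" "Qv \<notin> H1" "Pv \<notin> H2" "Qv \<in> H2"
  by (auto simp: H1_def H2_def)

lemma circ_cover:
  assumes "i \<in> {1..4}"
  shows "circ1 i \<union> circ2 i = verts (Q i)" "circ1 i \<inter> circ2 i = {}"
    "verts (coreQ i) = (circ1 i - {z i 2}) \<union> (circ2 i - {z i 1})"
proof -
  show 1: "circ1 i \<union> circ2 i = verts (Q i)" "circ1 i \<inter> circ2 i = {}"
    using circ(1)[OF assms] by (auto simp: halves_def)
  show "verts (coreQ i) = (circ1 i - {z i 2}) \<union> (circ2 i - {z i 1})"
    using 1 circ(4,7)[OF assms] labelled.verts_core(1)[OF parts[OF assms]] by auto
qed

lemma closed_core:
  assumes "i \<in> {1..4}" "\<forall>e\<in>edges FH. \<not> crosses A e"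
  shows "Part i (x i 1) \<in> A \<longleftrightarrow> Part i (x i 6) \<in> A"
    "y \<in> circ1 i - {x i 2, z i 2} \<Longrightarrow> Part i y \<in> A \<Longrightarrow> Part i (x i 1) \<in> A"
    "Part i (x i 4) \<in> A \<longleftrightarrow> Part i (x i 5) \<in> A"
    "y \<in> circ2 i - {z i 1} \<Longrightarrow> Part i y \<in> A \<Longrightarrow> Part i (x i 4) \<in> A"
proof -
  have "\<not> crosses (Part i -` A) e" if e: "e \<in> edges (coreF i)" for e
  proof -
    have "e \<noteq> {}" using e simple_cores(2)[OF assms(1)] by (auto simp: simple_graph_def)
    then have "Part i ` e \<in> edges FH" using e Part_edge_iff[OF assms(1)] by (simp add: H_factor_def)
    then show ?thesis using assms(2) crosses_Part by blast
  qed
  then have c: "\<forall>e\<in>edges (coreF i). \<not> crosses (Part i -` A) e" by blast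
  note core = labelled.core_closed[OF parts[OF assms(1)] circ[OF assms(1)] c]
  show "Part i (x i 1) \<in> A \<longleftrightarrow> Part i (x i 6) \<in> A" "Part i (x i 4) \<in> A \<longleftrightarrow> Part i (x i 5) \<in> A"
    using core(1,3) by simp_all
  show "Part i (x i 1) \<in> A" if "y \<in> circ1 i - {x i 2, z i 2}" "Part i y \<in> A"
    using core(2) that by blast
  show "Part i (x i 4) \<in> A" if "y \<in> circ2 i - {z i 1}" "Part i y \<in> A"
    using core(4) that by blast
qed

lemma closed_link:
  assumes "\<forall>e\<in>edges FH. \<not> crosses A e" "{u, v} \<in> link_edges x"
  shows "u \<in> A \<longleftrightarrow> v \<in> A"
proof -
  have "{u, v} \<in> edges FH" using assms(2) by (simp add: H_factor_def assemble_def)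
  then show ?thesis using assms(1)[rule_format, of "{u, v}"] by simp
qed

lemma closed_links:
  assumes "\<forall>e\<in>edges FH. \<not> crosses A e"
  shows "Part 1 (x 1 1) \<in> A \<longleftrightarrow> Part 4 (x 4 4) \<in> A" "Part 1 (x 1 2) \<in> A \<longleftrightarrow> Part 4 (x 4 5) \<in> A"
    "Part 4 (x 4 1) \<in> A \<longleftrightarrow> Part 3 (x 3 4) \<in> A" "Part 4 (x 4 2) \<in> A \<longleftrightarrow> Part 3 (x 3 5) \<in> A"
    "Part 3 (x 3 1) \<in> A \<longleftrightarrow> Part 2 (x 2 4) \<in> A" "Part 3 (x 3 2) \<in> A \<longleftrightarrow> Part 2 (x 2 5) \<in> A"
    "Part 2 (x 2 1) \<in> A \<longleftrightarrow> Part 1 (x 1 4) \<in> A" "Part 2 (x 2 2) \<in> A \<longleftrightarrow> Part 1 (x 1 5) \<in> A"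
    "Part 1 (x 1 2) \<in> A \<longleftrightarrow> Pv \<in> A" "Part 3 (x 3 2) \<in> A \<longleftrightarrow> Pv \<in> A"
    "Part 2 (x 2 2) \<in> A \<longleftrightarrow> Qv \<in> A" "Part 4 (x 4 2) \<in> A \<longleftrightarrow> Qv \<in> A"
  by (rule closed_link[OF assms]; simp add: link_edges_eq)+

text \<open>Membership in \<open>A\<close> is passed along the paths inside the cores by
  \<open>closed_core\<close> and between parts by the links, so it reaches \<open>Pv\<close> from
  anywhere on \<open>H1\<close> and \<open>Qv\<close> from anywhere on \<open>H2\<close>.\<close>

lemma closed_H:
  assumes c: "\<forall>e\<in>edges FH. \<not> crosses A e"
  shows "v \<in> A \<Longrightarrow> v \<in> H1 \<Longrightarrow> Pv \<in> A" "v \<in> A \<Longrightarrow> v \<in> H2 \<Longrightarrow> Qv \<in> A"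
proof -
  have i: "1 \<in> {1..4::nat}" "2 \<in> {1..4::nat}" "3 \<in> {1..4::nat}" "4 \<in> {1..4::nat}" by auto
  note core = closed_core(1,3)[OF i(1) c] closed_core(1,3)[OF i(2) c] closed_core(1,3)[OF i(3) c] closed_core(1,3)[OF i(4) c]
  note links = closed_links[OF c]
  have 1: "Part 1 (x 1 1) \<in> A \<longleftrightarrow> Pv \<in> A" "Part 4 (x 4 4) \<in> A \<longleftrightarrow> Pv \<in> A"
    "Part 3 (x 3 1) \<in> A \<longleftrightarrow> Pv \<in> A" "Part 2 (x 2 4) \<in> A \<longleftrightarrow> Pv \<in> A"
    using core links by blast+
  have 2: "Part 2 (x 2 1) \<in> A \<longleftrightarrow> Qv \<in> A" "Part 1 (x 1 4) \<in> A \<longleftrightarrow> Qv \<in> A"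
    "Part 4 (x 4 1) \<in> A \<longleftrightarrow> Qv \<in> A" "Part 3 (x 3 4) \<in> A \<longleftrightarrow> Qv \<in> A"
    using core links by blast+
  show "Pv \<in> A" if v: "v \<in> A" "v \<in> H1"
  proof -
    consider "v = Pv" | y where "v = Part 1 y" "y \<in> circ1 1 - {z 1 2}" | y where "v = Part 3 y" "y \<in> circ1 3 - {z 3 2}"
      | y where "v = Part 2 y" "y \<in> circ2 2 - {z 2 1}" | y where "v = Part 4 y" "y \<in> circ2 4 - {z 4 1}"
      using v(2) unfolding H1_def by blast
    then show ?thesis
    proof cases
      case 2
      then show ?thesis using closed_core(2)[OF i(1) c, of y] v(1) 1 links by (cases "y = x 1 2") auto
    next
      case 3
      then show ?thesis using closed_core(2)[OF i(3) c, of y] v(1) 1 links by (cases "y = x 3 2") auto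
    next
      case 4
      then show ?thesis using closed_core(4)[OF i(2) c, of y] v(1) 1 by auto
    next
      case 5
      then show ?thesis using closed_core(4)[OF i(4) c, of y] v(1) 1 by auto
    qed (use v in simp)
  qed
  show "Qv \<in> A" if v: "v \<in> A" "v \<in> H2"
  proof -
    consider "v = Qv" | y where "v = Part 2 y" "y \<in> circ1 2 - {z 2 2}" | y where "v = Part 4 y" "y \<in> circ1 4 - {z 4 2}"
      | y where "v = Part 1 y" "y \<in> circ2 1 - {z 1 1}" | y where "v = Part 3 y" "y \<in> circ2 3 - {z 3 1}"
      using v(2) unfolding H2_def by blast
    then show ?thesis
    proof cases
      case 2
      then show ?thesis using closed_core(2)[OF i(2) c, of y] v(1) \<open>Part 2 (x 2 1) \<in> A \<longleftrightarrow> Qv \<in> A\<close> links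
        by (cases "y = x 2 2") auto
    next
      case 3
      then show ?thesis using closed_core(2)[OF i(4) c, of y] v(1) \<open>Part 4 (x 4 1) \<in> A \<longleftrightarrow> Qv \<in> A\<close> links
        by (cases "y = x 4 2") auto
    next
      case 4
      then show ?thesis using closed_core(4)[OF i(1) c, of y] v(1) \<open>Part 1 (x 1 4) \<in> A \<longleftrightarrow> Qv \<in> A\<close> by auto
    next
      case 5
      then show ?thesis using closed_core(4)[OF i(3) c, of y] v(1) \<open>Part 3 (x 3 4) \<in> A \<longleftrightarrow> Qv \<in> A\<close> by auto
    qed (use v in simp)
  qed
qed

text \<open>On the core, \<open>H1\<close> agrees with the first circuit in parts 1 and 3 and with
  its complement in parts 2 and 4, and passing to the complement does not affect crossing. So
  closedness and chordlessness carry over from the parts.\<close>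

lemma crosses_core:
  assumes i: "i \<in> {1..4}" and e: "e \<in> edges (coreQ i)"
  shows "crosses H1 (Part i ` e) \<longleftrightarrow> crosses (circ1 i) e"
proof -
  obtain u v where uv: "e = {u, v}" "u \<in> verts (coreQ i)" "v \<in> verts (coreQ i)"
    using simple_graph_edgeE[OF simple_cores(1)[OF i] e] by metis
  have "Part i y \<in> H1 \<longleftrightarrow> (if i = 1 \<or> i = 3 then y \<in> circ1 i else y \<notin> circ1 i)" if "y \<in> verts (coreQ i)" for y
    using that i circ_cover[OF i] circ(4,7)[OF i] labelled.verts_core(1)[OF parts[OF i]]
    unfolding Part_in_H12 in_1_4 by auto
  then show ?thesis using uv by (auto split: if_splits)
qed

lemma halves_H: "halves H FH H1 H2"
proof -
  have "v \<in> H1 \<union> H2 \<longleftrightarrow> v \<in> verts H" for v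
  proof (cases v)
    case (Part i y)
    show ?thesis
    proof (cases "i \<in> {1..4}")
      case True
      then show ?thesis
        unfolding Part Un_iff Part_in_H12 Part_in_H[OF True] circ_cover(3)[OF True] in_1_4 by auto
    next
      case False
      then show ?thesis unfolding Part Un_iff Part_in_H12 by (auto simp: verts_H in_1_4)
    qed
  qed (auto simp: H1_def H2_def verts_H)
  then have un: "H1 \<union> H2 = verts H" by (rule set_eqI)
  have dis: "H1 \<inter> H2 = {}"
    using circ_cover(2)[of 1] circ_cover(2)[of 2] circ_cover(2)[of 3] circ_cover(2)[of 4]
    by (auto simp: H1_def H2_def)
  have cl: "\<not> crosses H1 e" if e: "e \<in> edges FH" for e
    using e unfolding H_factor_def
  proof (cases rule: edges_assembleE)
    case (1 i f)
    then have f: "f \<in> edges (F i)" "f \<in> edges (coreQ i)"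
      using labelled.core_edge_iff[OF parts[OF 1(1)]] labelled.edges_F[OF parts[OF 1(1)]] by auto
    then have "\<not> crosses (circ1 i) f" using circ(1)[OF 1(1)] by (simp add: halves_def)
    then show ?thesis using crosses_core[OF 1(1) f(2)] 1(3) by simp
  next
    case 2
    have c: "i \<in> {1..4} \<Longrightarrow> x i 1 \<noteq> z i 2" "i \<in> {1..4} \<Longrightarrow> x i 2 \<noteq> z i 2" "i \<in> {1..4} \<Longrightarrow> x i 6 \<noteq> z i 2"
      "i \<in> {1..4} \<Longrightarrow> x i 4 \<noteq> z i 1" "i \<in> {1..4} \<Longrightarrow> x i 5 \<noteq> z i 1" for i
      using labelled.distinct_verts[OF parts] by auto
    have d: "x i 1 \<notin> circ2 i" "x i 2 \<notin> circ2 i" "x i 6 \<notin> circ2 i" "x i 4 \<notin> circ1 i" "x i 5 \<notin> circ1 i"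
      if "i \<in> {1..4}" for i
      using circ[OF that] circ_cover(2)[OF that] by auto
    show ?thesis
      using 2 unfolding link_edges_eq
      by (elim insertE) (simp_all add: Part_in_H12 circ c d)
  qed
  have mn: "(A \<subseteq> H1 \<longrightarrow> A = H1) \<and> (A \<subseteq> H2 \<longrightarrow> A = H2)" if A: "A \<noteq> {}" "\<forall>e\<in>edges FH. \<not> crosses A e" for A
  proof -
    \<comment> \<open>If \<open>A\<close> met \<open>H1\<close> without containing it, then
      \<open>A\<close> and its complement would both be closed sets meeting \<open>H1\<close>, and
      both would contain \<open>Pv\<close>; likewise for \<open>H2\<close> and
      \<open>Qv\<close>.\<close>
    have cA: "\<forall>e\<in>edges FH. \<not> crosses (- A) e" using A(2) by (auto simp: crosses_def)
    show ?thesis using closed_H[OF A(2)] closed_H[OF cA] A(1) by blast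
  qed
  have "crosses H1 e" if e: "e \<in> edges H - edges FH" for e
  proof (cases "e = {Pv, Qv}")
    case True
    then show ?thesis by (simp add: Part_in_H12)
  next
    case False
    then have "e \<in> edges (assemble Q x z)" using e by (simp add: edges_H)
    then show ?thesis
    proof (cases rule: edges_assembleE)
      case (1 i f)
      interpret labelled "Q i" "F i" "x i" "z i" using parts 1(1) .
      have "f \<noteq> {}" using 1(2) simple_core by (auto simp: simple_graph_def)
      then have "f \<notin> edges (coreF i)" using e 1(1,3) Part_edge_iff by (simp add: H_factor_def)
      then have "f \<in> edges (Q i) - edges (F i)" using 1(2) by (simp add: core_edge_iff)
      then have "crosses (circ1 i) f" using circ(1)[OF 1(1)] by (simp add: halves_def)
      then show ?thesis using crosses_core[OF 1(1,2)] 1(3) by simp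
    next
      case 2
      then show ?thesis using e by (simp add: H_factor_def assemble_def)
    qed
  qed
  then show ?thesis
    unfolding halves_def using un dis cl mn Part_in_H12(3,6) by blast
qed

lemma good_H: "good H FH"
proof -
  have "10 \<le> card (verts (Q i))" if "i \<in> {1..4}" for i
    using labelled.good[OF parts[OF that]] by (simp add: good_def)
  from this[of 1] this[of 2] have "10 \<le> card (verts H)" using card_verts_H unfolding sum_1_4 by simp
  then show ?thesis
    using cubic_H permutation_two_factorI[OF simple_H two_factor_H halves_H] cut_H not_pair_colouring_H
    by (simp add: good_def)
qed

end

section \<open>The graphs \<open>H\<^sub>n\<close>\<close>

text \<open>Any \<open>z2\<close> on one circuit can be taken: \<open>x2\<close> and
  \<open>x6\<close> are its factor neighbours, \<open>x1\<close> is the next vertex beyond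
  \<open>x2\<close>, and \<open>z1\<close> is the non-factor neighbour of \<open>z2\<close>, on the
  other circuit. The only condition that could fail is that \<open>x1\<close> and \<open>x6\<close>
  differ.\<close>

lemma good_ex_labelling:
  assumes "good Q F"
  shows "\<exists>x z. labelling Q F x z"
proof -
  have G: "cubic Q" "simple_graph Q" and P: "permutation_two_factor Q F" and F: "two_factor Q F" "simple_graph F"
    "verts F = verts Q" and r: "regular 2 F"
    using assms by (auto simp: good_def cubic_def permutation_two_factor_def two_factor_def subgraph_def)
  obtain K L where h: "halves Q F K L" and cK: "is_component (induced F K) F" and cL: "is_component (induced F L) F"
    by (rule permutation_two_factor_halvesE[OF G(2) P])
  have KL: "K \<union> L = verts Q" "K \<inter> L = {}" "K \<noteq> {}" using h by (auto simp: halves_def)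
  have h': "halves Q F L K" using halves_commute[OF G(2) _ h] F(1) by (simp add: two_factor_def)
  have minK: "A = K" if "A \<noteq> {}" "\<And>e. e \<in> edges F \<Longrightarrow> \<not> crosses A e" "A \<subseteq> K" for A
    using h that unfolding halves_def by simp
  have eK: "e \<subseteq> M" if "e \<in> edges F" "v \<in> e" "v \<in> M" "halves Q F M N" for e v M N
    using that by (auto simp: halves_def crosses_def)
  obtain z2 where z2: "z2 \<in> K" "z2 \<in> verts F" using KL F(3) by blast
  obtain x2 x6 where n2: "x2 \<noteq> x6" "x2 \<noteq> z2" "x6 \<noteq> z2" "{e \<in> edges F. z2 \<in> e} = {{z2, x2}, {z2, x6}}"
    by (rule regular_2_neighbours[OF F(2) r z2(2)])
  then have e2: "{z2, x2} \<in> edges F" "{z2, x6} \<in> edges F" by blast+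
  have x2: "x2 \<in> K" "x2 \<in> verts F" "x6 \<in> K"
    using eK[OF e2(1) _ z2(1) h] eK[OF e2(2) _ z2(1) h] simple_graph_pairD[OF F(2) e2(1)] by auto
  obtain a b where ab: "a \<noteq> b" "a \<noteq> x2" "b \<noteq> x2" "{e \<in> edges F. x2 \<in> e} = {{x2, a}, {x2, b}}"
    by (rule regular_2_neighbours[OF F(2) r x2(2)])
  have "{z2, x2} \<in> {e \<in> edges F. x2 \<in> e}" using e2 by simp
  then have "z2 = a \<or> z2 = b" unfolding ab(4) using n2 by (auto simp: doubleton_eq_iff)
  moreover have "{x2, a} \<in> edges F" "{x2, b} \<in> edges F" using ab(4) by blast+
  ultimately have "\<exists>x1. x1 \<noteq> z2 \<and> x1 \<noteq> x2 \<and> {x2, x1} \<in> edges F" using ab(1-3) by metis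
  then obtain x1 where x1: "x1 \<noteq> z2" "x1 \<noteq> x2" "{x2, x1} \<in> edges F" by blast
  have x1K: "x1 \<in> K" using eK[OF x1(3) _ x2(1) h] by auto
  \<comment> \<open>Otherwise \<open>K\<close> is a triangle: its degree sum is 9 and three edges
    lie inside, so at most 3 edges leave it, against the bound 5.\<close>
  have "x1 \<noteq> x6"
  proof
    assume "x1 = x6"
    then have tri: "{x2, x6} \<in> edges F" using x1 by simp
    have ff: "{e \<in> edges F. x6 \<in> e} = {{z2, x6}, {x2, x6}}" "{e \<in> edges F. x2 \<in> e} = {{z2, x2}, {x2, x6}}"
      using e2 tri n2 x2 F(3) simple_graph_pairD[OF F(2) e2(2)]
      by (intro two_factor_degree_two[OF F(1)]; auto simp: doubleton_eq_iff)+
    have "\<not> crosses {z2, x2, x6} e" if "e \<in> edges F" for e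
    proof -
      have "e \<subseteq> {z2, x2, x6}" if "v \<in> e" "v \<in> {z2, x2, x6}" for v
      proof -
        have e: "e \<in> {e \<in> edges F. v \<in> e}" using that(1) \<open>e \<in> edges F\<close> by simp
        from that(2) consider "v = z2" | "v = x2" | "v = x6" by blast
        then have "e \<in> {{z2, x2}, {z2, x6}, {x2, x6}}"
        proof cases
          case 1
          show ?thesis using e unfolding 1 n2(4) by (elim insertE emptyE) simp_all
        next
          case 2
          show ?thesis using e unfolding 2 ff(2) by (elim insertE emptyE) simp_all
        next
          case 3
          show ?thesis using e unfolding 3 ff(1) by (elim insertE emptyE) simp_all
        qed
        then show ?thesis by (elim insertE emptyE) simp_all
      qed
      then show ?thesis by (auto simp: crosses_def)
    qed
    moreover have "{z2, x2, x6} \<subseteq> K" "{z2, x2, x6} \<noteq> {}" using z2 x2 by auto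
    ultimately have K: "{z2, x2, x6} = K" by (intro minK)
    have cK3: "card K = 3" unfolding K[symmetric] using n2(1-3) n2(1-3)[symmetric] by simp
    have KQ: "K \<subseteq> verts Q" "finite K" using KL(1) K by (blast, metis finite.intros)
    have "10 \<le> card (verts Q)" using assms by (simp add: good_def)
    then have "3 \<le> card (verts Q - K)" using cK3 KQ by (simp add: card_Diff_subset)
    then have "5 \<le> cut (edges Q) K" using good_cut[OF assms KQ(1)] cK3 by simp
    moreover have "(\<Sum>v\<in>K. degree Q v) = 9"
    proof -
      have "(\<Sum>v\<in>K. degree Q v) = (\<Sum>v\<in>K. 3)"
        using G(1) KQ(1) by (intro sum.cong) (auto simp: cubic_def regular_def)
      then show ?thesis using cK3 by simp
    qed
    then have s: "cut (edges Q) K + 2 * card {e \<in> edges Q. e \<subseteq> K} = 9"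
      using sum_degrees[OF G(2) KQ(1)] by simp
    moreover have "{{z2, x2}, {z2, x6}, {x2, x6}} \<subseteq> {e \<in> edges Q. e \<subseteq> K}"
      using e2 tri F(1) K by (auto simp: two_factor_def subgraph_def)
    then have "card {{z2, x2}, {z2, x6}, {x2, x6}} \<le> card {e \<in> edges Q. e \<subseteq> K}"
      using simple_graph_finite_edges[OF G(2)] by (intro card_mono) auto
    moreover have "card {{z2, x2}, {z2, x6}, {x2, x6}} = 3" using n2 by (simp add: doubleton_eq_iff)
    ultimately show False by linarith
  qed
  obtain z1 where z1: "{z2, z1} \<in> edges Q - edges F" "z1 \<in> verts Q"
    using non_factor_edge[OF G(1) F(1), of z2] z2 F(3) by metis
  then have "crosses K {z2, z1}" using h by (simp add: halves_def del: crosses_pair)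
  then have z1L: "z1 \<in> L" "z1 \<in> verts F" using z1(2) z2 KL F(3) by auto
  obtain x4 x5 where n1: "x4 \<noteq> x5" "x4 \<noteq> z1" "x5 \<noteq> z1" "{e \<in> edges F. z1 \<in> e} = {{z1, x4}, {z1, x5}}"
    by (rule regular_2_neighbours[OF F(2) r z1L(2)])
  then have e1: "{z1, x4} \<in> edges F" "{z1, x5} \<in> edges F" by blast+
  have x45: "x4 \<in> L" "x5 \<in> L" using eK[OF e1(1) _ z1L(1) h'] eK[OF e1(2) _ z1L(1) h'] by auto
  \<comment> \<open>The last branch supplies index 6 and a default value elsewhere;
    \<open>foot\<close> attaches \<open>e\<^sub>3\<close> to the vertex at index 2.\<close>
  define x where "x = (\<lambda>i::nat. if i = 1 then x1 else if i = 2 then x2 else if i = 4 then x4 else if i = 5 then x5 else x6)"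
  define z where "z = (\<lambda>i::nat. if i = 1 then z1 else z2)"
  have "induced F K \<noteq> induced F L" using KL by (auto dest!: arg_cong[of _ _ verts])
  then have "labelling Q F x z"
    unfolding labelling_def
    using cK cL n1(1-3) n2(1-3) x1 \<open>x1 \<noteq> x6\<close> e1 e2 x2 x45 z1L z1 z2(1) x1K
    by (intro exI[of _ "induced F K"] exI[of _ "induced F L"])
      (auto simp: x_def z_def insert_commute)
  then show ?thesis by blast
qed

text \<open>Goodness of the parts comes from the induction hypothesis for \<open>Q 1\<close> and
  from \<open>petersen_good\<close> for the copies of the Petersen graph; the order is (10 + 24n) +
  30 - 6.\<close>

lemma H_stage_good: "H_stage n G F \<Longrightarrow> good G F \<and> card (verts G) = 10 + 24 * n"
proof (induction rule: H_stage.induct)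
  case (zero F)
  then show ?case using petersen_good card_verts_petersen by simp
next
  case (step n Q F x z)
  have Qp: "Q 2 = petersen" "Q 3 = petersen" "Q 4 = petersen" using step(2) by auto
  have "good (Q i) (F i)" if "i \<in> {1..4}" for i
  proof (cases "i = 1")
    case True
    then show ?thesis using step.IH by simp
  next
    case False
    then have "Q i = petersen" using that step(2) by simp
    moreover have "permutation_two_factor (Q i) (F i)" using step(3) that by (simp add: admissible_def)
    ultimately show ?thesis using petersen_good by simp
  qed
  then interpret assembly Q F x z
    using step(3) by unfold_locales (auto simp: labelled_def)
  show ?case using good_H card_verts_H step.IH Qp card_verts_petersen unfolding sum_1_4 by simp
qed

text \<open>Every stage can be continued: goodness provides both the labellings and the
  admissibility that the next step requires.\<close>

lemma H_stage_ex: "\<exists>G F. H_stage n G F"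
proof (induction n)
  case 0
  then show ?case using H_stage.zero petersen_factor by blast
next
  case (Suc n)
  then obtain G F where GF: "H_stage n G F" by blast
  define Q' where "Q' = (\<lambda>i::nat. if i = 1 then G else petersen)"
  define F' where "F' = (\<lambda>i::nat. if i = 1 then F else petersen_factor)"
  have good: "good (Q' i) (F' i)" for i
    using H_stage_good[OF GF] petersen_good[OF petersen_factor] by (simp add: Q'_def F'_def)
  have "\<exists>x z. \<forall>i. labelling (Q' i) (F' i) (x i) (z i)"
    using good_ex_labelling[OF good] by metis
  then obtain x z where "labelling (Q' i) (F' i) (x i) (z i)" for i by blast
  then have "H_stage (Suc n) (H_graph Q' x z) (H_factor F' x z)"
    using GF good_admissible[OF good] by (intro H_stage.step) (auto simp: Q'_def F'_def)
  then show ?case by blast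
qed

text \<open>The stages depend on choices, so the claims are made for every sequence of choices, and
  existence is asserted separately to exclude vacuity. Infinity is counted up to isomorphism:
  isomorphic graphs have equal order, while the orders 10 + 24n are pairwise distinct.\<close>

theorem corollary2p25:
  "(\<forall>n. \<exists>G F. H_stage n G F) \<and>
   (\<forall>n G F. H_stage n G F \<longrightarrow> admissible G F) \<and>
   (\<forall>H :: nat \<Rightarrow> vertex ugraph. (\<forall>n. \<exists>F. H_stage n (H n) F) \<longrightarrow>
      infinite ((\<Union>n. {H n}) // graph_iso) \<and>
      (\<forall>G \<in> (\<Union>n. {H n}). cyclically_edge_connected 5 G \<and> permutation_snark G) \<and>
      (\<forall>n. card (verts (H n)) = 10 + 24 * n))"
proof (intro conjI allI impI)
  fix n show "\<exists>G F. H_stage n G F" by (rule H_stage_ex)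
next
  fix n G F assume "H_stage n G F"
  then show "admissible G F" using H_stage_good good_admissible by blast
next
  fix H :: "nat \<Rightarrow> vertex ugraph"
  assume H: "\<forall>n. \<exists>F. H_stage n (H n) F"
  show "\<forall>G \<in> (\<Union>n. {H n}). cyclically_edge_connected 5 G \<and> permutation_snark G"
  proof
    fix G assume "G \<in> (\<Union>n. {H n})"
    then obtain n where "G = H n" by blast
    then obtain F where "H_stage n G F" using H by blast
    then have "admissible G F" using H_stage_good good_admissible by blast
    then show "cyclically_edge_connected 5 G \<and> permutation_snark G" by (simp add: admissible_def)
  qed
  show card: "card (verts (H n)) = 10 + 24 * n" for n using H H_stage_good by metis
  have refl: "(G, G) \<in> graph_iso" for G :: "vertex ugraph"
    unfolding graph_iso_def by (auto intro!: exI[of _ id])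
  have iso: "card (verts G) = card (verts G')" if "(G, G') \<in> graph_iso" for G G' :: "vertex ugraph"
    using that bij_betw_same_card unfolding graph_iso_def by blast
  let ?c = "\<lambda>n. graph_iso `` {H n}"
  have "inj ?c"
  proof
    fix m n assume "?c m = ?c n"
    then have "(H m, H n) \<in> graph_iso" using refl by blast
    then show "m = n" using iso card by fastforce
  qed
  then have "infinite (range ?c)" by (simp add: finite_image_iff)
  moreover have "range ?c \<subseteq> (\<Union>n. {H n}) // graph_iso" by (auto simp: quotient_def)
  ultimately show "infinite ((\<Union>n. {H n}) // graph_iso)" using finite_subset by blast
qed

end
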